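(* If $\Gamma$ is a cubic vertex-transitive graph other than $K_{3,3}$, then every $g \in \mathrm{Aut}(\Gamma)$ admits a regular orbit, and every orbit of $\langle g \rangle$ has size $\frac{\ell(g)}{k}$ for some $k \in \{1,2,3,4,6\}$.
   Context: A cubic graph is a finite connected graph in which every vertex has valence $3$. For a permutation $g$, $\ell(g)$ is the length of a longest orbit of $\langle g\rangle$, and a regular orbit of $g$ is an orbit of $\langle g\rangle$ whose length equals the order of $g$. *)

theory Defs
  imports
    "HOL-Algebra.Group_Action"
    "HOL-Algebra.Elementary_Groups"
    "HOL-Algebra.Multiplicative_Group"
    "Graph_Theory.Graph_Theory"
begin

text \<open>
  Graphs are the simple undirected graphs of \<^locale>\<open>pair_graph\<close>: finite, loopless, with a symmetric
  set of arcs, so each undirected edge is a pair of opposite arcs and the valence of a vertex is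
  its out-degree. Connectedness includes having at least one vertex.
\<close>

definition cubic_graph :: "'a pair_pre_digraph \<Rightarrow> bool" where
  "cubic_graph \<Gamma> \<longleftrightarrow>
     pair_graph \<Gamma> \<and>
     Digraph_Component.connected (with_proj \<Gamma>) \<and>
     (\<forall>v \<in> pverts \<Gamma>. out_degree (with_proj \<Gamma>) v = 3)"

text \<open>
  As in \<^const>\<open>BijGroup\<close>, automorphisms are extensional functions on the vertex set, so that distinct
  elements of the group are distinct permutations of the vertices.
\<close>

definition graph_aut :: "'a pair_pre_digraph \<Rightarrow> ('a \<Rightarrow> 'a) set" where
  "graph_aut \<Gamma> = {g \<in> Bij (pverts \<Gamma>).
     \<forall>u \<in> pverts \<Gamma>. \<forall>v \<in> pverts \<Gamma>. (g u, g v) \<in> parcs \<Gamma> \<longleftrightarrow> (u, v) \<in> parcs \<Gamma>}"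

definition Aut_group :: "'a pair_pre_digraph \<Rightarrow> ('a \<Rightarrow> 'a) monoid" where
  "Aut_group \<Gamma> = BijGroup (pverts \<Gamma>) \<lparr>carrier := graph_aut \<Gamma>\<rparr>"

lemma carrier_Aut_group [simp]: "carrier (Aut_group \<Gamma>) = graph_aut \<Gamma>"
  by (simp add: Aut_group_def)

lemma subgroup_graph_aut: "subgroup (graph_aut \<Gamma>) (BijGroup (pverts \<Gamma>))"
proof -
  let ?V = "pverts \<Gamma>"
  interpret B: group "BijGroup ?V" by (rule group_BijGroup)
  have Bij: "g \<in> Bij ?V" if "g \<in> graph_aut \<Gamma>" for g
    using that unfolding graph_aut_def by blast
  have adj: "(g u, g v) \<in> parcs \<Gamma> \<longleftrightarrow> (u, v) \<in> parcs \<Gamma>"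
    if "g \<in> graph_aut \<Gamma>" "u \<in> ?V" "v \<in> ?V" for g u v
    using that unfolding graph_aut_def by blast
  show ?thesis
  proof (rule B.subgroupI)
    show "graph_aut \<Gamma> \<subseteq> carrier (BijGroup ?V)"
      unfolding graph_aut_def BijGroup_def by auto
    have "(\<lambda>x\<in>?V. x) \<in> graph_aut \<Gamma>"
      unfolding graph_aut_def by (simp add: id_Bij)
    then show "graph_aut \<Gamma> \<noteq> {}" by blast
  next
    fix g assume g: "g \<in> graph_aut \<Gamma>"
    note gB = Bij[OF g]
    have inv: "inv\<^bsub>BijGroup ?V\<^esub> g = (\<lambda>x\<in>?V. inv_into ?V g x)"
      by (rule inv_BijGroup[OF gB])
    have mem: "inv_into ?V g x \<in> ?V" if "x \<in> ?V" for x
      by (rule Bij_inv_into_mem[OF gB that])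
    have "g ` ?V = ?V"
      using gB unfolding Bij_def bij_betw_def by blast
    then have f_inv: "g (inv_into ?V g x) = x" if "x \<in> ?V" for x
      using that by (simp add: f_inv_into_f)
    have "(inv_into ?V g u, inv_into ?V g v) \<in> parcs \<Gamma> \<longleftrightarrow> (u, v) \<in> parcs \<Gamma>"
      if "u \<in> ?V" "v \<in> ?V" for u v
      using adj[OF g mem[OF that(1)] mem[OF that(2)]] by (simp only: f_inv that)
    then show "inv\<^bsub>BijGroup ?V\<^esub> g \<in> graph_aut \<Gamma>"
      unfolding inv graph_aut_def using restrict_inv_into_Bij[OF gB] by simp
  next
    fix g h assume g: "g \<in> graph_aut \<Gamma>" and h: "h \<in> graph_aut \<Gamma>"
    have hV: "h u \<in> ?V" if "u \<in> ?V" for u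
      using Bij_imp_funcset[OF Bij[OF h]] that by (rule funcset_mem)
    have "compose ?V g h \<in> graph_aut \<Gamma>"
      unfolding graph_aut_def
      using compose_Bij[OF Bij[OF g] Bij[OF h]]
      by (simp add: compose_eq adj[OF g] adj[OF h] hV)
    then show "g \<otimes>\<^bsub>BijGroup ?V\<^esub> h \<in> graph_aut \<Gamma>"
      by (simp add: BijGroup_def Bij[OF g] Bij[OF h])
  qed
qed

lemma group_Aut_group: "group (Aut_group \<Gamma>)"
  unfolding Aut_group_def
  by (rule group.subgroup_imp_group[OF group_BijGroup subgroup_graph_aut])

lemma group_action_Aut_group: "group_action (Aut_group \<Gamma>) (pverts \<Gamma>) (\<lambda>g. g)"
proof -
  have "graph_aut \<Gamma> \<subseteq> carrier (BijGroup (pverts \<Gamma>))"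
    using subgroup_graph_aut by (rule subgroup.subset)
  then have "(\<lambda>g. g) \<in> hom (Aut_group \<Gamma>) (BijGroup (pverts \<Gamma>))"
    by (auto simp: hom_def Aut_group_def)
  then show ?thesis
    by (intro group_action.intro group_hom.intro group_hom_axioms.intro
        group_Aut_group group_BijGroup)
qed

definition vertex_transitive :: "'a pair_pre_digraph \<Rightarrow> bool" where
  "vertex_transitive \<Gamma> \<longleftrightarrow> transitive_action (Aut_group \<Gamma>) (pverts \<Gamma>) (\<lambda>g. g)"

definition cyclic_orbits :: "'a pair_pre_digraph \<Rightarrow> ('a \<Rightarrow> 'a) \<Rightarrow> 'a set set" where
  "cyclic_orbits \<Gamma> g = orbits (subgroup_generated (Aut_group \<Gamma>) {g}) (pverts \<Gamma>) (\<lambda>h. h)"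

definition longest_orbit_length :: "'a pair_pre_digraph \<Rightarrow> ('a \<Rightarrow> 'a) \<Rightarrow> nat" where
  "longest_orbit_length \<Gamma> g = Max (card ` cyclic_orbits \<Gamma> g)"

definition regular_orbit :: "'a pair_pre_digraph \<Rightarrow> ('a \<Rightarrow> 'a) \<Rightarrow> 'a set \<Rightarrow> bool" where
  "regular_orbit \<Gamma> g C \<longleftrightarrow> C \<in> cyclic_orbits \<Gamma> g \<and> card C = group.ord (Aut_group \<Gamma>) g"

end

theory Submission
  imports Defs "HOL-Combinatorics.Perm"
begin

text \<open>
  Let \<open>C\<close> be the group generated by \<open>g\<close>. An orbit of a vertex \<open>x\<close> has size \<open>|C| / |C\<^sub>x|\<close>, so the point is
  that an element fixing a vertex has order 1, 2, 3, 4 or 6. An element of odd order fixing an arc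
  is trivial, which bounds the odd part by 3. For elements of 2-power order, one passes to a strongly
  connected digraph of in- and out-valency 2 on which the automorphism group acts
  vertex-transitively: the arcs of the graph if it is arc-transitive, and otherwise its vertices,
  where one follows the edge fixed by the vertex stabilizer and then an edge not fixed by it.
  The stabilizer in such a digraph has order \<open>2^n\<close> and is generated by involutions
  \<open>a\<^sub>0, \<dots>, a\<^bsub>n - 1\<^esub>\<close>, where \<open>a\<^bsub>i + 1\<^esub>\<close> is conjugate to \<open>a\<^sub>i\<close> under a shift along a walk and the first
  \<open>k\<close> generators generate a subgroup of order \<open>2^k\<close>. Such a group has class at most 2 and exponent
  dividing 4. If an element \<open>s\<close> of order 4 and an element of order 3 fixing the same vertex
  commute, then \<open>s\<^sup>2\<close> is central in the vertex stabilizer, and the arguments of Tutte's theorem on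
  arc-transitive cubic graphs yield a contradiction.

  Finally, if there is no regular orbit, then every vertex is fixed by the involution or by the
  subgroup of order 3 in \<open>C\<close>, which forces \<open>K\<^bsub>3,3\<^esub>\<close>.
\<close>

section \<open>Groups generated by a chain of involutions\<close>

text \<open>The bounds 4 and 3 for the two parts of the order leave \<open>k = 12\<close> as the
  only unwanted value, and excluding it is what makes the proof long. Since all generators are
  conjugate under one shift, their commutation pattern is governed by a single number
  \<open>lam\<close>, the least distance of two that do not commute. The recurrent tool is trimming:
  an element commuting with the generators at distance \<open>lam\<close> from its outer factors
  cannot have those factors, and an element trimmed from both ends past the middle is trivial,
  because only 1 fixes a walk of \<open>n\<close> steps. For order 12 this gives
  \<open>2 \<le> m\<close>, \<open>2 * m \<le> lam\<close>, \<open>m + 1 < lam\<close> and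
  \<open>lam \<le> m + 2\<close> with \<open>m = n - lam\<close>, hence \<open>m = 2\<close>,
  \<open>lam = 4\<close>, \<open>n = 6\<close>. That case falls to a parity argument: for an element
  acting trivially on the neighbours of a vertex, ask at each of these three neighbours whether it
  also acts trivially around it. Rotation makes any two positive answers imply the third, while an
  element of order 4 commuting with the rotation would answer no three times.\<close>

definition icomm :: "'g::monoid_mult \<Rightarrow> 'g \<Rightarrow> 'g" where
  "icomm x y = x * y * x * y"

text \<open>An involution is its own inverse, so \<open>icomm\<close> is the group commutator, and
  exchanging its arguments inverts it. The relations supply all inverses, so a monoid
  suffices.\<close>

lemma icomm_inverse:
  fixes x y :: "'g::monoid_mult"
  assumes "x * x = 1" "y * y = 1"
  shows "icomm x y * icomm y x = 1"
proof -
  have x: "x * (x * z) = z" and y: "y * (y * z) = z" for z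
    using assms by (simp_all flip: mult.assoc)
  show ?thesis
    using assms x y by (simp add: icomm_def mult.assoc)
qed

lemma icomm_eq_1_iff:
  fixes x y :: "'g::monoid_mult"
  assumes "x * x = 1" "y * y = 1"
  shows "icomm x y = 1 \<longleftrightarrow> x * y = y * x"
proof
  assume "icomm x y = 1"
  then have "x * y * x * y * y * x = y * x"
    by (simp add: icomm_def mult.assoc)
  then show "x * y = y * x"
    using assms by (simp add: mult.assoc)
next
  assume eq: "x * y = y * x"
  have "icomm x y = x * y * (x * y)" by (simp add: icomm_def mult.assoc)
  also have "\<dots> = x * y * (y * x)" by (simp only: eq)
  also have "\<dots> = x * (y * y) * x" by (simp add: mult.assoc)
  finally show "icomm x y = 1" using assms by simp
qed

lemma commute_inverse:
  fixes x y r :: "'g::monoid_mult"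
  assumes "x * y = 1" "y * x = 1" "x * r = r * x"
  shows "y * r = r * y"
proof -
  have "y * r = y * r * (x * y)" using assms by simp
  also have "\<dots> = y * (x * r) * y" by (simp add: assms mult.assoc)
  also have "\<dots> = r * y" using assms by (metis mult.assoc mult_1_left)
  finally show ?thesis .
qed

text \<open>Conjugation by \<open>w\<close> fixes \<open>y\<close> and sends \<open>x\<close> to
  \<open>x * icomm x w = x * e * c\<close>. Being an involution, this image satisfies
  \<open>c * x * e * c = e * x\<close>; so \<open>c\<close>, which passes through \<open>y\<close>,
  disappears from the result.\<close>

lemma conj_icomm:
  fixes x y w e c :: "'g::monoid_mult"
  assumes xx: "x * x = 1" and yy: "y * y = 1" and ww: "w * w = 1" and ee: "e * e = 1"
    and wy: "w * y = y * w" and xw: "icomm x w = e * c" and yc: "y * c = c * y"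
  shows "w * icomm x y * w = x * e * y * e * x * y"
proof -
  have xl: "x * (x * z) = z" and wl: "w * (w * z) = z" and el: "e * (e * z) = z" for z
    using xx ww ee by (simp_all flip: mult.assoc)
  have wxw: "w * x * w = x * e * c"
  proof -
    have "w * x * w = x * icomm x w" by (simp add: icomm_def mult.assoc xl)
    then show ?thesis by (simp add: xw mult.assoc)
  qed
  have "x * e * c * (x * e * c) = 1"
    unfolding wxw[symmetric] using ww by (simp add: mult.assoc wl xl)
  then have "e * x * (x * e * c * (x * e * c)) = e * x" by simp
  then have cxec: "c * x * e * c = e * x" by (simp add: mult.assoc xl el)
  have "w * icomm x y * w = w * x * (y * w) * (w * x) * (y * w)"
    by (simp add: icomm_def mult.assoc wl)
  also have "\<dots> = (w * x * w) * y * (w * x * w) * y"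
    by (simp add: mult.assoc flip: wy)
  also have "\<dots> = x * e * (c * y) * x * e * c * y"
    unfolding wxw by (simp add: mult.assoc)
  also have "\<dots> = x * e * y * (c * x * e * c) * y"
    by (simp add: mult.assoc flip: yc)
  finally show ?thesis unfolding cxec by (simp add: mult.assoc)
qed

text \<open>Conjugation by \<open>y\<close> turns the commuting pair \<open>x\<close>,
  \<open>s\<close> into the commuting pair \<open>icomm y x * x\<close>,
  \<open>icomm y s * s\<close>. Since \<open>icomm y s\<close> passes through \<open>x\<close> and
  \<open>icomm y x\<close>, it can be cancelled.\<close>

lemma icomm_commuteI:
  fixes x y s :: "'g::monoid_mult"
  assumes sq: "x * x = 1" "y * y = 1" "s * s = 1"
    and xs: "x * s = s * x" and zx: "icomm y s * x = x * icomm y s"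
    and zc: "icomm y s * icomm y x = icomm y x * icomm y s"
  shows "icomm y x * s = s * icomm y x"
proof -
  have yl: "y * (y * w) = w" for w using sq by (simp flip: mult.assoc)
  let ?z = "icomm y s" and ?c = "icomm y x"
  have "(y * x * y) * (y * s * y) = (y * s * y) * (y * x * y)"
    by (simp add: mult.assoc yl) (simp add: xs flip: mult.assoc)
  moreover have "y * x * y = ?c * x" "y * s * y = ?z * s"
    using sq by (simp_all add: icomm_def mult.assoc)
  ultimately have eq: "?c * x * (?z * s) = ?z * s * (?c * x)" by simp
  have "?z * (?c * s) * x = ?c * (?z * (x * s))" using zc by (simp add: xs flip: mult.assoc)
  also have "\<dots> = ?c * x * (?z * s)" using zx by (simp flip: mult.assoc)
  also have "\<dots> = ?z * (s * ?c) * x" using eq by (simp add: mult.assoc)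
  finally have "?z * (?c * s) * x * x = ?z * (s * ?c) * x * x" by simp
  then have "?z * (?c * s) = ?z * (s * ?c)" using sq by (simp add: mult.assoc)
  then have "icomm s y * ?z * (?c * s) = icomm s y * ?z * (s * ?c)" by (simp add: mult.assoc)
  then show ?thesis using icomm_inverse[OF sq(3,2)] by simp
qed

text \<open>The second hypothesis says that conjugation by \<open>x\<close> inverts
  \<open>c\<close>; so \<open>x\<close> centralizes \<open>c\<close> exactly when \<open>c\<close>
  is its own inverse.\<close>

lemma inverted_commute_iff:
  fixes x c :: "'g::monoid_mult"
  assumes "x * x = 1" "x * c * x * c = 1"
  shows "c * x = x * c \<longleftrightarrow> c * c = 1"
proof
  assume "c * x = x * c"
  have "x * c * x * c = x * (c * x) * c" by (simp add: mult.assoc)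
  also have "\<dots> = x * x * (c * c)" by (simp only: \<open>c * x = x * c\<close> mult.assoc)
  finally show "c * c = 1" using assms by simp
next
  assume "c * c = 1"
  have "c * x = x * x * (c * x) * (c * c)" using assms \<open>c * c = 1\<close> by simp
  also have "\<dots> = x * (x * c * x * c) * c" by (simp only: mult.assoc)
  finally show "c * x = x * c" using assms by simp
qed

text \<open>\<open>S i j\<close> plays the role of the subgroup generated by \<open>a i, \<dots>, a (j - 1)\<close>, of order \<open>2^(j - i)\<close>;
  generators at distance less than \<open>lam\<close> commute and those at distance exactly \<open>lam\<close> do not.\<close>

locale involution_chain =
  fixes S :: "nat \<Rightarrow> nat \<Rightarrow> 'g::monoid_mult set" and a :: "nat \<Rightarrow> 'g" and n lam :: nat
  assumes S_diag: "i \<le> n \<Longrightarrow> S i i = {1}"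
    and S_mono: "\<lbrakk>i' \<le> i; i \<le> j; j \<le> j'; j' \<le> n\<rbrakk> \<Longrightarrow> S i j \<subseteq> S i' j'"
    and S_Int: "\<lbrakk>i < j; j < n\<rbrakk> \<Longrightarrow> S i j \<inter> S (Suc i) (Suc j) \<subseteq> S (Suc i) j"
    and a_in: "j < n \<Longrightarrow> a j \<in> S j (Suc j)"
    and a_notin_top: "\<lbrakk>i \<le> j; j < n\<rbrakk> \<Longrightarrow> a j \<notin> S i j"
    and a_notin_bot: "\<lbrakk>i < j; j \<le> n\<rbrakk> \<Longrightarrow> a i \<notin> S (Suc i) j"
    and S_mult: "\<lbrakk>i \<le> j; j \<le> n; g \<in> S i j; h \<in> S i j\<rbrakk> \<Longrightarrow> g * h \<in> S i j"
    and index_top: "\<lbrakk>i \<le> j; j < n; g \<in> S i (Suc j); h \<in> S i (Suc j)\<rbrakk>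
       \<Longrightarrow> g * h \<in> S i j \<longleftrightarrow> (g \<in> S i j \<longleftrightarrow> h \<in> S i j)"
    and index_bot: "\<lbrakk>i < j; j \<le> n; g \<in> S i j; h \<in> S i j\<rbrakk>
       \<Longrightarrow> g * h \<in> S (Suc i) j \<longleftrightarrow> (g \<in> S (Suc i) j \<longleftrightarrow> h \<in> S (Suc i) j)"
    and lam_pos: "0 < lam"
    and near: "\<lbrakk>i < j; j < n; j < i + lam\<rbrakk> \<Longrightarrow> a i * a j = a j * a i"
    and far: "i + lam < n \<Longrightarrow> a i * a (i + lam) \<noteq> a (i + lam) * a i"
    and distinct: "\<lbrakk>i < j; j + lam < n\<rbrakk> \<Longrightarrow> icomm (a i) (a (i + lam)) \<noteq> icomm (a j) (a (j + lam))"
begin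

section \<open>Factorization and commutation in a chain of involutions\<close>

lemma a_sq: "i < n \<Longrightarrow> a i * a i = 1"
  using index_top[of i i "a i" "a i"] a_in[of i] a_notin_top[of i i] S_diag[of i] by simp

lemma a_sq_left: "i < n \<Longrightarrow> a i * (a i * x) = x"
  using a_sq by (simp flip: mult.assoc)

lemma a_mem: "\<lbrakk>i \<le> k; k < j; j \<le> n\<rbrakk> \<Longrightarrow> a k \<in> S i j"
  using a_in[of k] S_mono[of i k "Suc k" j] by auto

lemma near': "\<lbrakk>i < n; j < n; j < i + lam; i < j + lam\<rbrakk> \<Longrightarrow> a i * a j = a j * a i"
  using near[of i j] near[of j i] by (metis linorder_neqE_nat)

lemma inv_icomm: "\<lbrakk>i < n; j < n\<rbrakk> \<Longrightarrow> icomm (a i) (a j) * icomm (a j) (a i) = 1"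
  by (simp add: icomm_inverse a_sq)

lemma split_top:
  assumes "i \<le> j" "j < n" "g \<in> S i (Suc j)"
  obtains "g \<in> S i j" | h where "h \<in> S i j" "g = h * a j"
proof (cases "g \<in> S i j")
  case False
  have "a j \<in> S i (Suc j)" using a_mem[of i j "Suc j"] assms by simp
  then have "g * a j \<in> S i j"
    using index_top[of i j g "a j"] assms False a_notin_top[of i j] by simp
  moreover have "g = g * a j * a j" using assms a_sq by (simp add: mult.assoc)
  ultimately show ?thesis using that by blast
qed (use that in auto)

lemma split_bot:
  assumes "i < j" "j \<le> n" "g \<in> S i j"
  obtains "g \<in> S (Suc i) j" | h where "h \<in> S (Suc i) j" "g = a i * h"
proof (cases "g \<in> S (Suc i) j")
  case False
  have "a i \<in> S i j" using a_mem[of i i j] assms by simp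
  then have "a i * g \<in> S (Suc i) j"
    using index_bot[of i j "a i" g] assms False a_notin_bot[of i j] by simp
  moreover have "g = a i * (a i * g)" using assms a_sq_left by simp
  ultimately show ?thesis using that by blast
qed (use that in auto)

text \<open>\<open>icomm (a i) (a j)\<close> is the square of \<open>a i * a j\<close>, and squares
  lie in every subgroup of index 2: here in the one without \<open>a j\<close> and in the one
  without \<open>a i\<close>, whose intersection \<open>S_Int\<close> controls.\<close>

lemma icomm_mem:
  assumes "i < j" "j < n"
  shows "icomm (a i) (a j) \<in> S (Suc i) j"
proof -
  have ai: "a i \<in> S i (Suc j)" and aj: "a j \<in> S i (Suc j)"
    using a_mem assms by auto
  then have aij: "a i * a j \<in> S i (Suc j)" using S_mult[of i "Suc j"] assms by auto
  have "a i * a j * (a i * a j) \<in> S i j"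
    using index_top[of i j "a i * a j" "a i * a j"] aij assms by simp
  moreover have "a i * a j * (a i * a j) \<in> S (Suc i) (Suc j)"
    using index_bot[of i "Suc j" "a i * a j" "a i * a j"] aij assms by simp
  ultimately show ?thesis
    using S_Int[of i j] assms by (auto simp: icomm_def mult.assoc)
qed

text \<open>This provides cancellation in the ambient monoid: a product of involutions is inverted
  by reversing it.\<close>

lemma S_unit:
  assumes "i \<le> j" "j \<le> n" "g \<in> S i j"
  obtains h where "g * h = 1" "h * g = 1"
proof -
  have "\<exists>h. g * h = 1 \<and> h * g = 1"
    using assms
  proof (induction j arbitrary: g rule: dec_induct)
    case base
    then show ?case using S_diag[of i] by auto
  next
    case (step j)
    then have "i \<le> j" "j < n" by auto
    then show ?case
      using \<open>g \<in> S i (Suc j)\<close>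
    proof (cases rule: split_top)
      case 1
      then show ?thesis using step by simp
    next
      case (2 h)
      then obtain h' where h': "h * h' = 1" "h' * h = 1" using step by auto
      have "g * (a j * h') = h * (a j * a j) * h'" "a j * h' * g = a j * (h' * h) * a j"
        by (simp_all add: 2 mult.assoc)
      then show ?thesis
        using h' a_sq[OF \<open>j < n\<close>] by (metis mult_1_right)
    qed
  qed
  with that show ?thesis by blast
qed

lemma commute_S:
  assumes "i \<le> j" "j \<le> n" "g \<in> S i j" "\<And>r. \<lbrakk>i \<le> r; r < j\<rbrakk> \<Longrightarrow> x * a r = a r * x"
  shows "x * g = g * x"
  using assms
proof (induction j arbitrary: g rule: dec_induct)
  case base
  then show ?case using S_diag[of i] by simp
next
  case (step j)
  then have "i \<le> j" "j < n" by auto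
  then show ?case
    using \<open>g \<in> S i (Suc j)\<close>
  proof (cases rule: split_top)
    case 1
    then show ?thesis using step by simp
  next
    case (2 h)
    have "x * a j = a j * x" "x * h = h * x" using step 2 by auto
    then show ?thesis by (metis 2(2) mult.assoc)
  qed
qed

lemma commute_S_near:
  assumes "i \<le> j" "j \<le> n" "g \<in> S i j" "r < n" "r < i + lam" "j \<le> r + lam"
  shows "a r * g = g * a r"
  using assms(1-3) by (rule commute_S) (use assms near'[of r] in auto)

text \<open>If \<open>g\<close> involves \<open>a k\<close> as its first factor, then \<open>g\<close> does not commute with \<open>a (k + lam)\<close>,
  because all later factors do.\<close>

lemma trim_left:
  assumes "g \<in> S i j" "i \<le> k" "k \<le> j" "j \<le> n" "j \<le> i + 2 * lam"
    and "\<And>r. \<lbrakk>i + lam \<le> r; r < k + lam\<rbrakk> \<Longrightarrow> r < n \<and> g * a r = a r * g"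
  shows "g \<in> S k j"
  using assms(2,3,6)
proof (induction k rule: dec_induct)
  case base
  then show ?case using assms by simp
next
  case (step k)
  then have g: "g \<in> S k j" by auto
  from \<open>Suc k \<le> j\<close> have kj: "k < j" by simp
  let ?w = "a (k + lam)"
  have r: "k + lam < n" "g * ?w = ?w * g"
    using step.prems(2)[of "k + lam"] step.hyps by auto
  from kj \<open>j \<le> n\<close> g show ?case
  proof (cases rule: split_bot)
    case (2 h)
    have h: "?w * h = h * ?w"
      using 2(1) by (rule commute_S_near[rotated 2]) (use kj assms step.hyps r in auto)
    have eq: "a k * ?w * h = ?w * a k * h"
    proof -
      have "a k * ?w * h = a k * h * ?w" using h by (simp add: mult.assoc)
      also have "\<dots> = ?w * a k * h" using r 2 by (simp add: mult.assoc)
      finally show ?thesis .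
    qed
    obtain h' where "h * h' = 1"
      using S_unit[of "Suc k" j h] kj \<open>j \<le> n\<close> 2(1) by auto
    then have "a k * ?w = ?w * a k"
      using eq by (metis mult.assoc mult_1_right)
    then show ?thesis using far r by blast
  qed
qed

text \<open>If \<open>2 * lam \<le> n\<close>, each generator that can occur in
  \<open>u = icomm (a 0) (a lam)\<close>, namely \<open>a 1\<close> to \<open>a (lam - 1)\<close>,
  has a partner at distance \<open>lam\<close> further up. By \<open>conj_icomm\<close> with
  \<open>e = 1\<close>, \<open>u\<close> commutes with all these partners, so trimming leaves
  \<open>u = 1\<close>, against \<open>far\<close>.\<close>

lemma lam_bound: "lam < n \<Longrightarrow> n < 2 * lam"
proof (rule ccontr)
  assume "lam < n" and "\<not> n < 2 * lam"
  define u where "u = icomm (a 0) (a lam)"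
  have u: "u \<in> S 1 lam"
    using icomm_mem[of 0 lam] lam_pos \<open>lam < n\<close> by (simp add: u_def)
  have "u * a r = a r * u" if r: "1 + lam \<le> r" "r < lam + lam" for r
  proof -
    let ?c = "icomm (a 0) (a r)"
    have rn: "r < n" "0 < n" using r \<open>\<not> n < 2 * lam\<close> by auto
    have c: "?c \<in> S 1 r" using icomm_mem[of 0 r] r rn by simp
    have "a lam * ?c = ?c * a lam"
      using c by (rule commute_S_near[rotated 2]) (use r rn in auto)
    moreover have "a r * a lam = a lam * a r"
      using near[of lam r] r rn by simp
    ultimately have "a r * u * a r = u"
      using conj_icomm[of "a 0" "a lam" "a r" 1 ?c] a_sq rn \<open>lam < n\<close>
      by (simp add: u_def icomm_def mult.assoc)
    then have "a r * (a r * u * a r) = a r * u" by simp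
    then show ?thesis using a_sq_left[OF rn(1)] by (simp add: mult.assoc)
  qed
  then have "u \<in> S lam lam"
    using u trim_left[of u 1 lam lam] lam_pos \<open>lam < n\<close> \<open>\<not> n < 2 * lam\<close> by force
  then have "u = 1" using S_diag[of lam] \<open>lam < n\<close> by simp
  then show False
    using far[of 0] a_sq \<open>lam < n\<close> icomm_eq_1_iff[of "a 0" "a lam"] by (simp add: u_def)
qed

section \<open>Nilpotency class at most two\<close>

lemma index_bound: "i < n \<Longrightarrow> j < n \<Longrightarrow> j < i + 2 * lam"
  using lam_bound lam_pos by (cases "lam < n") auto

text \<open>Centrality of all commutators of generators is class at most 2. The upper index is
  inclusive here, whereas \<open>S i j\<close> stops before \<open>a j\<close>.\<close>

definition central :: "nat \<Rightarrow> nat \<Rightarrow> bool" where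
  "central i j \<longleftrightarrow> (\<forall>k l r. i \<le> k \<longrightarrow> k < l \<longrightarrow> l \<le> j \<longrightarrow> i \<le> r \<longrightarrow> r \<le> j \<longrightarrow>
     icomm (a k) (a l) * a r = a r * icomm (a k) (a l))"

lemma centralD:
  "\<lbrakk>central i j; i \<le> k; k < l; l \<le> j; i \<le> r; r \<le> j\<rbrakk>
    \<Longrightarrow> icomm (a k) (a l) * a r = a r * icomm (a k) (a l)"
  by (auto simp: central_def)

lemma icomm_near:
  "\<lbrakk>i < n; j < n; j < i + lam; i < j + lam\<rbrakk> \<Longrightarrow> icomm (a i) (a j) = 1"
  using icomm_eq_1_iff[of "a i" "a j"] near'[of i j] a_sq by simp

text \<open>A least counterexample \<open>l\<close> would force \<open>[a (l - lam), a l] = [a (j - lam), a j]\<close>.\<close>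

lemma icomm_commute_right:
  assumes "i + lam < j" "j < n" and L: "central i (j - 1)" and R: "central (Suc i) j"
    and "i < l" "l < j"
  shows "icomm (a i) (a l) * a j = a j * icomm (a i) (a l)"
  using \<open>i < l\<close> \<open>l < j\<close>
proof (induction l rule: less_induct)
  case (less l)
  define u where "u = icomm (a i) (a l)"
  define c where "c = icomm (a i) (a j)"
  have n: "i < n" "l < n" using assms less by auto
  have j2: "j < i + 2 * lam" using index_bound n assms by blast
  note sq = a_sq[OF n(1)] a_sq[OF n(2)] a_sq[OF \<open>j < n\<close>]
  note sql = a_sq_left[OF n(1)] a_sq_left[OF n(2)] a_sq_left[OF \<open>j < n\<close>]
  show ?case
  proof (cases "l < i + lam")
    case True
    then have "icomm (a i) (a l) = 1" using icomm_near n less by simp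
    then show ?thesis by simp
  next
    case False
    have c: "c \<in> S (Suc i) j" using icomm_mem assms n by (simp add: c_def)
    \<comment> \<open>\<open>icomm_commuteI\<close> applies because, for \<open>r < l\<close>, the
      induction hypothesis makes \<open>icomm (a i) (a r)\<close> commute with \<open>a j\<close> as
      well. This is what allows \<open>c\<close> to be trimmed.\<close>
    have cr: "c * a r = a r * c" if "j < r + lam" "r < l" "i < r" for r
    proof -
      let ?z = "icomm (a i) (a r)"
      have rn: "r < n" using that n by simp
      have zr: "?z * a s = a s * ?z" if "i \<le> s" "s \<le> j" for s
        using that less.IH[OF \<open>r < l\<close>] centralD[OF L, of i r s] \<open>r < l\<close> \<open>i < r\<close> less
        by (cases "s = j") auto
      have zc: "?z * c = c * ?z"
        by (rule commute_S[OF _ _ c]) (use zr assms in auto)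
      show ?thesis
        unfolding c_def
      proof (rule icomm_commuteI)
        show "a j * a r = a r * a j" using near[of r j] that less \<open>j < n\<close> by simp
        show "?z * a j = a j * ?z" using zr assms by simp
        show "?z * icomm (a i) (a j) = icomm (a i) (a j) * ?z" using zc by (simp add: c_def)
      qed (simp_all add: sq a_sq[OF rn])
    qed
    \<comment> \<open>After trimming, the only factor of \<open>c\<close> that may fail to commute
      with \<open>a l\<close> is a leading \<open>a (l - lam)\<close>, split off as
      \<open>e\<close>. For \<open>l - lam = i\<close> it is absent because \<open>c\<close> lies in
      \<open>S (Suc i) j\<close>.\<close>
    obtain e c' where e: "c = e * c'" "c' \<in> S (Suc (l - lam)) j"
      "e = 1 \<or> (i < l - lam \<and> e = a (l - lam))"
    proof (cases "i < l - lam")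
      case True
      have "c \<in> S (l - lam) j"
        using c by (rule trim_left) (use True less assms j2 n cr in auto)
      moreover have "l - lam < j" "j \<le> n" using less assms by auto
      ultimately show ?thesis using that True split_bot by (metis mult_1_left)
    next
      case nl: False
      then have "l - lam = i" using False by simp
      then show ?thesis using that[of 1 c] c by simp
    qed
    have ee: "e * e = 1" using e(3) a_sq[of "l - lam"] n by auto
    have "a l * c' = c' * a l"
      by (rule commute_S_near[OF _ _ e(2)]) (use False less assms j2 n lam_pos in auto)
    moreover have "a j * a l = a l * a j"
      using near[of l j] False less assms j2 by simp
    ultimately have conj: "a j * u * a j = a i * e * a l * e * a i * a l"
      unfolding u_def using conj_icomm[of "a i" "a l" "a j" e c'] sq ee e(1) c_def by simp
    have u: "u \<in> S (Suc i) l" using icomm_mem less n by (simp add: u_def)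
    \<comment> \<open>Now \<open>u\<close> is trimmed in the same way with respect to
      \<open>a j\<close>: only a leading factor \<open>a (j - lam)\<close> can obstruct commutation
      with \<open>a j\<close>.\<close>
    have "u \<in> S (j - lam) l"
      using u by (rule trim_left)
       (use False less assms j2 n centralD[OF L, of i l] in \<open>auto simp: u_def\<close>)
    moreover have "j - lam < l" "l \<le> n" using False j2 n by auto
    ultimately consider "u \<in> S (Suc (j - lam)) l"
      | u' where "u' \<in> S (Suc (j - lam)) l" "u = a (j - lam) * u'"
      using split_bot by metis
    then show ?thesis
    proof cases
      case 1
      have "a j * u = u * a j"
        by (rule commute_S_near[OF _ _ 1]) (use False less assms j2 n lam_pos in auto)
      then show ?thesis by (simp add: u_def)
    next
      case (2 u')
      let ?q = "j - lam"
      have q: "?q < n" "i < ?q" "?q + lam = j" using assms by auto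
      have "a j * u' = u' * a j"
        by (rule commute_S_near[OF _ _ 2(1)]) (use False less assms j2 n lam_pos in auto)
      then have "a j * u * a j = a j * a ?q * a j * u'"
        by (simp add: 2(2) mult.assoc)
      also have "\<dots> = icomm (a j) (a ?q) * u"
        by (simp add: 2(2) icomm_def mult.assoc a_sq_left q)
      finally have conj2: "a j * u * a j = icomm (a j) (a ?q) * u" .
      show ?thesis
      proof (cases "e = 1")
        case True
        then have "a j * u * a j = u" using conj by (simp add: u_def icomm_def)
        then have "a j * (a j * u * a j) = a j * u" by simp
        then show ?thesis by (simp add: u_def mult.assoc sql)
      next
        case False
        let ?p = "l - lam"
        have p: "i < ?p" "e = a ?p" "?p < n" "?p + lam = l" using e(3) False n by auto
        have "icomm (a ?p) (a l) * a i = a i * icomm (a ?p) (a l)"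
          using centralD[OF L, of ?p l i] p less lam_pos by auto
        then have "icomm (a ?p) (a l) * u = a i * icomm (a ?p) (a l) * a l * a i * a l"
          unfolding u_def icomm_def[of "a i"] by (simp flip: mult.assoc)
        also have "\<dots> = a j * u * a j"
          unfolding conj p(2) by (simp add: icomm_def mult.assoc sql)
        \<comment> \<open>Both evaluations of \<open>a j * u * a j\<close> are a commutator times
          \<open>u\<close>, so the two commutators agree. Since \<open>a ?q\<close> commutes with
          its commutator with \<open>a j\<close>, the order of arguments in the latter is immaterial
          and \<open>distinct\<close> applies.\<close>
        finally have "icomm (a ?p) (a l) * u = icomm (a j) (a ?q) * u" using conj2 by simp
        then have "icomm (a ?p) (a l) * u * icomm (a l) (a i) = icomm (a j) (a ?q) * u * icomm (a l) (a i)"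
          by simp
        then have "icomm (a ?p) (a l) = icomm (a j) (a ?q)"
          using inv_icomm[OF n] by (simp add: u_def mult.assoc)
        also have "icomm (a j) (a ?q) = a ?q * icomm (a ?q) (a j) * a ?q"
          by (simp add: icomm_def mult.assoc a_sq_left q)
        also have "\<dots> = icomm (a ?q) (a j)"
        proof -
          have v: "icomm (a ?q) (a j) \<in> S (Suc ?q) j"
            using icomm_mem[of ?q j] q \<open>j < n\<close> lam_pos by simp
          have "a ?q * icomm (a ?q) (a j) = icomm (a ?q) (a j) * a ?q"
            by (rule commute_S_near[OF _ _ v]) (use q \<open>j < n\<close> lam_pos in auto)
          then show ?thesis using a_sq[OF q(1)] by (simp add: mult.assoc)
        qed
        finally have False using distinct[of ?p ?q] p q less assms by auto
        then show ?thesis ..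
      qed
    qed
  qed
qed

lemma icomm_swap_commute:
  assumes "i < n" "j < n" "icomm (a i) (a j) * x = x * icomm (a i) (a j)"
  shows "icomm (a j) (a i) * x = x * icomm (a j) (a i)"
  using commute_inverse[OF inv_icomm inv_icomm] assms by blast

text \<open>The axioms are symmetric under reading the generators backwards: \<open>S_Int\<close> is
  self-dual, and the axioms for top and bottom trade places. Hence
  \<open>icomm_commute_right\<close> and \<open>trim_left\<close> have mirror images.\<close>

lemma reverse: "involution_chain (\<lambda>i j. S (n - j) (n - i)) (\<lambda>i. a (n - 1 - i)) n lam"
proof
  show "S (n - i) (n - i) = {1}" if "i \<le> n" for i
    using S_diag that by simp
  show "S (n - j) (n - i) \<subseteq> S (n - j') (n - i')" if "i' \<le> i" "i \<le> j" "j \<le> j'" "j' \<le> n" for i i' j j'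
    using that by (intro S_mono) auto
  show "S (n - j) (n - i) \<inter> S (n - Suc j) (n - Suc i) \<subseteq> S (n - j) (n - Suc i)" if "i < j" "j < n" for i j
    using S_Int[of "n - Suc j" "n - Suc i"] that by (simp add: Suc_diff_Suc Int_commute)
  show "a (n - 1 - j) \<in> S (n - Suc j) (n - j)" if "j < n" for j
    using a_in[of "n - Suc j"] that by (simp add: Suc_diff_Suc)
  show "a (n - 1 - j) \<notin> S (n - j) (n - i)" if "i \<le> j" "j < n" for i j
    using a_notin_bot[of "n - Suc j" "n - i"] that by (simp add: Suc_diff_Suc)
  show "a (n - 1 - i) \<notin> S (n - j) (n - Suc i)" if "i < j" "j \<le> n" for i j
    using a_notin_top[of "n - j" "n - Suc i"] that by simp
  show "g * h \<in> S (n - j) (n - i)" if "i \<le> j" "j \<le> n" "g \<in> S (n - j) (n - i)" "h \<in> S (n - j) (n - i)" for i j g h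
    using S_mult[of "n - j" "n - i"] that by simp
  show "g * h \<in> S (n - j) (n - i) \<longleftrightarrow> (g \<in> S (n - j) (n - i) \<longleftrightarrow> h \<in> S (n - j) (n - i))"
    if "i \<le> j" "j < n" "g \<in> S (n - Suc j) (n - i)" "h \<in> S (n - Suc j) (n - i)" for i j g h
    using index_bot[of "n - Suc j" "n - i" g h] that by (simp add: Suc_diff_Suc)
  show "g * h \<in> S (n - j) (n - Suc i) \<longleftrightarrow> (g \<in> S (n - j) (n - Suc i) \<longleftrightarrow> h \<in> S (n - j) (n - Suc i))"
    if "i < j" "j \<le> n" "g \<in> S (n - j) (n - i)" "h \<in> S (n - j) (n - i)" for i j g h
    using index_top[of "n - j" "n - Suc i" g h] that by (simp add: Suc_diff_Suc)
  show "0 < lam" by (rule lam_pos)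
  show "a (n - 1 - i) * a (n - 1 - j) = a (n - 1 - j) * a (n - 1 - i)"
    if "i < j" "j < n" "j < i + lam" for i j
    using near[of "n - 1 - j" "n - 1 - i"] that by simp
  have idx: "n - 1 - i = n - 1 - (i + lam) + lam" if "i + lam < n" for i
    using that by simp
  show "a (n - 1 - i) * a (n - 1 - (i + lam)) \<noteq> a (n - 1 - (i + lam)) * a (n - 1 - i)"
    if "i + lam < n" for i
    using far[of "n - 1 - (i + lam)"] that idx[OF that] by simp
  show "icomm (a (n - 1 - i)) (a (n - 1 - (i + lam))) \<noteq> icomm (a (n - 1 - j)) (a (n - 1 - (j + lam)))"
    if "i < j" "j + lam < n" for i j
  proof
    let ?p = "n - 1 - (i + lam)" and ?q = "n - 1 - (j + lam)"
    have pq: "?q < ?p" "?p + lam = n - 1 - i" "?q + lam = n - 1 - j" "?p + lam < n" "?q + lam < n"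
      using that by auto
    assume "icomm (a (n - 1 - i)) (a ?p) = icomm (a (n - 1 - j)) (a ?q)"
    then have eq: "icomm (a (?p + lam)) (a ?p) = icomm (a (?q + lam)) (a ?q)" using pq by simp
    \<comment> \<open>Reversal exchanges the arguments of \<open>icomm\<close>; inverting both sides
      of the assumed equality restores the order in \<open>distinct\<close>.\<close>
    have "icomm (a ?q) (a (?q + lam)) = icomm (a ?q) (a (?q + lam)) * (icomm (a (?p + lam)) (a ?p) * icomm (a ?p) (a (?p + lam)))"
      using inv_icomm[of "?p + lam" ?p] pq by simp
    also have "\<dots> = icomm (a ?p) (a (?p + lam))"
      unfolding eq using inv_icomm[of ?q "?q + lam"] pq by (simp flip: mult.assoc)
    finally show False using distinct pq by blast
  qed
qed

lemma icomm_commute_left: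
  assumes "i + lam < j" "j < n" and L: "central i (j - 1)" and R: "central (Suc i) j"
    and "i < l" "l < j"
  shows "icomm (a l) (a j) * a i = a i * icomm (a l) (a j)"
proof -
  interpret rev: involution_chain "\<lambda>i j. S (n - j) (n - i)" "\<lambda>i. a (n - 1 - i)" n lam
    by (rule reverse)
  let ?r = "\<lambda>i. n - 1 - i"
  have rev: "rev.central i' j'" if "central (?r j') (?r i')" "j' < n" for i' j'
    unfolding rev.central_def
  proof (intro allI impI)
    fix k l r assume *: "i' \<le> k" "k < l" "l \<le> j'" "i' \<le> r" "r \<le> j'"
    then have "icomm (a (?r l)) (a (?r k)) * a (?r r) = a (?r r) * icomm (a (?r l)) (a (?r k))"
      using centralD[OF that(1), of "?r l" "?r k" "?r r"] \<open>j' < n\<close> by auto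
    then show "icomm (a (?r k)) (a (?r l)) * a (?r r) = a (?r r) * icomm (a (?r k)) (a (?r l))"
      by (rule icomm_swap_commute[rotated 2]) (use * \<open>j' < n\<close> in auto)
  qed
  have r: "?r (?r i) = i" "?r (?r j) = j" "?r (?r l) = l" "?r (?r j - 0) = j"
    using assms by auto
  have "icomm (a (?r (?r j))) (a (?r (?r l))) * a (?r (?r i)) = a (?r (?r i)) * icomm (a (?r (?r j))) (a (?r (?r l)))"
  proof (rule rev.icomm_commute_right)
    show "?r j + lam < ?r i" "?r i < n" "?r j < ?r l" "?r l < ?r i" using assms by auto
    have "?r (?r i - 1) = Suc i" "?r (Suc (?r j)) = j - 1" "?r i - 1 < n" "?r i < n"
      using assms by auto
    then show "rev.central (?r j) (?r i - 1)" "rev.central (Suc (?r j)) (?r i)"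
      using L R r rev[of "?r i - 1" "?r j"] rev[of "?r i" "Suc (?r j)"] by metis+
  qed
  then show ?thesis
    unfolding r using icomm_swap_commute[of j l] assms by simp
qed

lemma trim_right:
  assumes "g \<in> S i j" "i \<le> k" "k \<le> j" "j \<le> n" "j \<le> i + 2 * lam"
    and "lam \<le> k" "\<And>r. \<lbrakk>k \<le> r + lam; r + lam < j\<rbrakk> \<Longrightarrow> g * a r = a r * g"
  shows "g \<in> S i k"
proof -
  interpret rev: involution_chain "\<lambda>i j. S (n - j) (n - i)" "\<lambda>i. a (n - 1 - i)" n lam
    by (rule reverse)
  have "g \<in> S (n - (n - i)) (n - (n - k))"
  proof (rule rev.trim_left)
    show "g \<in> S (n - (n - i)) (n - (n - j))" using assms by simp
    show "r < n \<and> g * a (n - 1 - r) = a (n - 1 - r) * g"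
      if "n - j + lam \<le> r" "r < n - k + lam" for r
    proof -
      have "r < n" using that assms by linarith
      then show ?thesis using assms(7)[of "n - 1 - r"] that assms(2-4) by auto
    qed
  qed (use assms in auto)
  then show ?thesis using assms by simp
qed

text \<open>At most \<open>lam\<close> consecutive generators contain no noncommuting pair, so they
  generate an elementary abelian 2-group.\<close>

lemma square_near:
  assumes "i \<le> j" "j \<le> n" "j \<le> i + lam" "g \<in> S i j"
  shows "g * g = 1"
  using assms
proof (induction j arbitrary: g rule: dec_induct)
  case base
  then show ?case using S_diag[of i] by simp
next
  case (step j)
  then have "i \<le> j" "j < n" by auto
  then show ?case
    using \<open>g \<in> S i (Suc j)\<close>
  proof (cases rule: split_top)
    case 1
    then show ?thesis using step by simp
  next
    case (2 h)
    have "a j * h = h * a j"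
      by (rule commute_S_near[OF _ _ 2(1)]) (use step lam_pos in auto)
    then have "g * g = h * h * (a j * a j)" using 2 by (metis mult.assoc)
    then show ?thesis using step 2 a_sq[of j] by simp
  qed
qed

text \<open>Induction on the length of the interval. Apart from the two one-sided lemmas, only
  \<open>c = icomm (a i) (a j)\<close> for the two end generators is left. Commuting with the
  generators near either end confines \<open>c\<close> to an elementary abelian middle part, so
  \<open>c * c = 1\<close>; as \<open>a i\<close> and \<open>a j\<close> invert \<open>c\<close>,
  they commute with it.\<close>

lemma central_all: "\<lbrakk>i \<le> j; j < n\<rbrakk> \<Longrightarrow> central i j"
proof (induction "j - i" arbitrary: i j rule: less_induct)
  case less
  have near_central: "icomm (a i) (a j) * a r = a r * icomm (a i) (a j)"
    if "j \<le> i + lam" "i < j" "i \<le> r" "r \<le> j" for r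
  proof -
    have "icomm (a i) (a j) \<in> S (Suc i) j" using icomm_mem that less by simp
    then have "a r * icomm (a i) (a j) = icomm (a i) (a j) * a r"
      by (rule commute_S_near[rotated 2]) (use that less in auto)
    then show ?thesis by simp
  qed
  have sub: "central i' j'" if "i \<le> i'" "i' \<le> j'" "j' \<le> j" "i < i' \<or> j' < j" for i' j'
    using less.hyps[of j' i'] that less by auto
  show ?case unfolding central_def
  proof (intro allI impI)
    fix k l r assume *: "i \<le> k" "k < l" "l \<le> j" "i \<le> r" "r \<le> j"
    show "icomm (a k) (a l) * a r = a r * icomm (a k) (a l)"
    proof (cases "j \<le> i + lam")
      case True
      then show ?thesis
      proof (cases "l < k + lam")
        case True
        then show ?thesis using icomm_near[of k l] * less.prems by simp
      next
        case False
        then have "k = i" "l = j" using * \<open>j \<le> i + lam\<close> by auto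
        then show ?thesis using near_central[of r] * True by simp
      qed
    next
      case False
      then have ij: "i + lam < j" by simp
      have L: "central i (j - 1)" and R: "central (Suc i) j"
        using sub ij by auto
      consider "i < k" "i < r" | "l < j" "r < j" | "r = j" "k = i" "l < j" | "r = i" "i < k" "l = j"
        | "k = i" "l = j"
        using * by linarith
      then show ?thesis
      proof cases
        case 1
        then show ?thesis using centralD[OF R] * by auto
      next
        case 2
        then show ?thesis using centralD[OF L] * by auto
      next
        case 3
        then show ?thesis using icomm_commute_right[OF ij \<open>j < n\<close> L R] * by auto
      next
        case 4
        then show ?thesis using icomm_commute_left[OF ij \<open>j < n\<close> L R] * by auto
      next
        case 5
        have n: "i < n" "j < n" using less.prems by auto
        have j2: "j < i + 2 * lam" using index_bound n by blast
        note sq = a_sq[OF n(1)] a_sq[OF n(2)]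
        note sql = a_sq_left[OF n(1)] a_sq_left[OF n(2)]
        define c where "c = icomm (a i) (a j)"
        have c: "c \<in> S (Suc i) j" using icomm_mem ij n by (simp add: c_def)
        have cleft: "c * a s = a s * c" if "i < s" "s < i + lam" for s
        proof -
          let ?z = "icomm (a s) (a j)" and ?z' = "icomm (a j) (a s)"
          have sn: "s < n" and "s < j" using that ij n by auto
          have "?z * a r = a r * ?z" if "i \<le> r" "r \<le> j" for r
            using that centralD[OF R, of s j r] icomm_commute_left[OF ij \<open>j < n\<close> L R \<open>i < s\<close> \<open>s < j\<close>]
              \<open>i < s\<close> \<open>s < j\<close> by (cases "r = i") auto
          then have zr: "?z' * a r = a r * ?z'" if "i \<le> r" "r \<le> j" for r
            using that icomm_swap_commute sn n by blast
          have "?z' * c = c * ?z'"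
            by (rule commute_S[OF _ _ c]) (use zr ij n in auto)
          then have "c * ?z' = ?z' * c" by simp
          then have zc: "icomm (a j) (a i) * ?z' = ?z' * icomm (a j) (a i)"
            unfolding c_def by (rule icomm_swap_commute[OF n])
          have "icomm (a j) (a i) * a s = a s * icomm (a j) (a i)"
            by (rule icomm_commuteI) (use near[of i s] sn that zc zr[of i] ij in \<open>auto simp: sq a_sq[OF sn]\<close>)
          then show ?thesis unfolding c_def by (rule icomm_swap_commute[OF n(2,1)])
        qed
        have cright: "c * a s = a s * c" if "j < s + lam" "s < j" for s
        proof -
          let ?z = "icomm (a i) (a s)"
          have sn: "s < n" and "i < s" using that ij n by auto
          have zr: "?z * a r = a r * ?z" if "i \<le> r" "r \<le> j" for r
            using that centralD[OF L, of i s r] icomm_commute_right[OF ij \<open>j < n\<close> L R \<open>i < s\<close> \<open>s < j\<close>]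
              \<open>i < s\<close> \<open>s < j\<close> by (cases "r = j") auto
          have zc: "?z * c = c * ?z"
            by (rule commute_S[OF _ _ c]) (use zr ij n in auto)
          show ?thesis
            unfolding c_def
            by (rule icomm_commuteI)
               (use near[of s j] that zc zr[of j] ij n in \<open>auto simp: sq a_sq[OF sn] c_def\<close>)
        qed
        have "c \<in> S (j - lam) j"
          using c by (rule trim_left) (use ij j2 n cright in auto)
        then have cc: "c \<in> S (j - lam) (Suc (i + lam))"
          by (rule trim_right) (use ij j2 n cleft in auto)
        \<comment> \<open>The remaining interval has \<open>i + 2 * lam + 1 - j\<close> generators,
          which is at most \<open>lam\<close> because \<open>i + lam < j\<close>.\<close>
        have "c * c = 1"
          using square_near[OF _ _ _ cc] ij j2 n by auto
        moreover have "a i * c * a i * c = 1" "a j * c * a j * c = 1"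
          by (simp_all add: c_def icomm_def mult.assoc sq sql)
        ultimately have "c * a i = a i * c" "c * a j = a j * c"
          using inverted_commute_iff sq by blast+
        moreover have "i < s \<Longrightarrow> s < j \<Longrightarrow> c * a s = a s * c" for s
          using cleft[of s] cright[of s] j2 by linarith
        ultimately show ?thesis using * 5 by (metis c_def le_neq_implies_less)
      qed
    qed
  qed
qed

text \<open>Modulo the central elements of order at most 2, the generators are commuting
  involutions, so every square vanishes there. The induction on the factorization of
  \<open>g\<close> carries both facts along.\<close>

lemma square_central:
  assumes "g \<in> S 0 n"
  shows "r < n \<Longrightarrow> g * g * a r = a r * (g * g)" and "g * g * (g * g) = 1"
proof -
  define Z where "Z = {z \<in> S 0 n. z * z = 1 \<and> (\<forall>r<n. z * a r = a r * z)}"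
  have Z_commute: "z * g = g * z" if "z \<in> Z" "g \<in> S 0 n" for z g
    using that commute_S[of 0 n g z] by (auto simp: Z_def)
  have Z_1: "1 \<in> Z" using S_diag[of 0] S_mono[of 0 0 0 n] by (simp add: Z_def)
  have Z_mult: "y * z \<in> Z" if y: "y \<in> Z" and z: "z \<in> Z" for y z
  proof -
    have yz: "y \<in> S 0 n" "z \<in> S 0 n" "y * y = 1" "z * z = 1" using y z by (simp_all add: Z_def)
    have "y * z * (y * z) = y * (z * y) * z" by (simp add: mult.assoc)
    also have "\<dots> = y * y * (z * z)" unfolding Z_commute[OF z yz(1)] by (simp add: mult.assoc)
    finally have "y * z * (y * z) = 1" using yz by simp
    moreover have "y * z * a r = a r * (y * z)" if "r < n" for r
    proof -
      have "y * z * a r = y * (a r * z)" using z that by (simp add: Z_def mult.assoc)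
      also have "\<dots> = (y * a r) * z" by (simp add: mult.assoc)
      also have "\<dots> = a r * (y * z)" using y that by (simp add: Z_def mult.assoc)
      finally show ?thesis .
    qed
    ultimately show ?thesis using S_mult[of 0 n] yz by (auto simp: Z_def)
  qed
  have Z_icomm: "icomm (a i) (a j) \<in> Z" if "i < n" "j < n" for i j
  proof -
    note sq = a_sq[OF that(1)] a_sq[OF that(2)]
    note sql = a_sq_left[OF that(1)] a_sq_left[OF that(2)]
    have comm: "icomm (a i) (a j) * a r = a r * icomm (a i) (a j)" if "r < n" for r
    proof (cases i j rule: linorder_cases)
      case less
      then show ?thesis
        using centralD[OF central_all, of 0 "n - 1" i j r] that \<open>j < n\<close> by auto
    next
      case equal
      then show ?thesis by (simp add: icomm_def sq)
    next
      case greater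
      then have "icomm (a j) (a i) * a r = a r * icomm (a j) (a i)"
        using centralD[OF central_all, of 0 "n - 1" j i r] that \<open>i < n\<close> by auto
      then show ?thesis using icomm_swap_commute \<open>i < n\<close> \<open>j < n\<close> by blast
    qed
    have "a i * icomm (a i) (a j) * a i * icomm (a i) (a j) = 1"
      by (simp add: icomm_def mult.assoc sq sql)
    then have "icomm (a i) (a j) * icomm (a i) (a j) = 1"
      using inverted_commute_iff comm that sq by blast
    moreover have "a i \<in> S 0 n" "a j \<in> S 0 n" using a_mem that by auto
    then have "icomm (a i) (a j) \<in> S 0 n"
      unfolding icomm_def by (simp add: S_mult)
    ultimately show ?thesis using comm by (simp add: Z_def)
  qed
  have "g * g \<in> Z \<and> (\<forall>r<n. \<exists>z\<in>Z. g * a r = z * a r * g)" if "g \<in> S 0 j" "j \<le> n" for j g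
    using that
  proof (induction j arbitrary: g)
    case 0
    then have "g = 1" using S_diag[of 0] by simp
    then show ?case using Z_1 by force
  next
    case (Suc j)
    then have "0 \<le> j" "j < n" by auto
    then show ?case
      using \<open>g \<in> S 0 (Suc j)\<close>
    proof (cases rule: split_top)
      case 1
      then show ?thesis using Suc by simp
    next
      case (2 h)
      have hh: "h * h \<in> Z" "\<forall>r<n. \<exists>z\<in>Z. h * a r = z * a r * h" using Suc 2 by auto
      have hS: "h \<in> S 0 n" using 2 S_mono[of 0 0 j n] \<open>j < n\<close> by auto
      obtain z where z: "z \<in> Z" "h * a j = z * a j * h" using hh \<open>j < n\<close> by blast
      have "z * z = 1" using z(1) by (simp add: Z_def)
      have "a j * h = z * z * (a j * h)" using \<open>z * z = 1\<close> by simp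
      also have "\<dots> = z * h * a j" using z(2) by (simp add: mult.assoc)
      finally have ajh: "a j * h = z * h * a j" .
      have "g * g = h * (a j * h) * a j" using 2(2) by (simp add: mult.assoc)
      also have "\<dots> = (h * z) * h * (a j * a j)" unfolding ajh by (simp add: mult.assoc)
      also have "\<dots> = z * (h * h)"
        unfolding Z_commute[OF z(1) hS, symmetric] using a_sq[OF \<open>j < n\<close>] by (simp add: mult.assoc)
      finally have "g * g \<in> Z" using Z_mult z(1) hh(1) by simp
      moreover have "\<exists>z\<in>Z. g * a r = z * a r * g" if "r < n" for r
      proof -
        obtain y where y: "y \<in> Z" "h * a r = y * a r * h" using hh \<open>r < n\<close> by blast
        let ?x = "icomm (a j) (a r)"
        have "a j * a r = ?x * a r * a j"
          by (simp add: icomm_def mult.assoc a_sq_left a_sq that \<open>j < n\<close>)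
        then have "g * a r = (h * ?x) * a r * a j" using 2(2) by (simp add: mult.assoc)
        also have "\<dots> = ?x * (h * a r) * a j"
          unfolding Z_commute[OF Z_icomm[OF \<open>j < n\<close> that] hS, symmetric] by (simp add: mult.assoc)
        also have "\<dots> = ?x * y * a r * g" using y 2(2) by (simp add: mult.assoc)
        finally show ?thesis using Z_mult Z_icomm y(1) that \<open>j < n\<close> by blast
      qed
      ultimately show ?thesis by blast
    qed
  qed
  then have "g * g \<in> Z" using assms by blast
  then show "r < n \<Longrightarrow> g * g * a r = a r * (g * g)" and "g * g * (g * g) = 1"
    by (auto simp: Z_def)
qed

end

section \<open>Vertex stabilizers in digraphs of valency two\<close>

lemma finite_no_strict_descent:
  fixes f :: "nat \<Rightarrow> 'a set"
  assumes "finite (f 0)" "\<And>k. f (Suc k) \<subset> f k"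
  shows False
proof -
  have "finite (f k) \<and> card (f k) + k \<le> card (f 0)" for k
  proof (induction k)
    case (Suc k)
    then show ?case
      using assms(2)[of k] psubset_card_mono[of "f k" "f (Suc k)"] finite_subset[of "f (Suc k)" "f k"]
      by auto
  qed (use assms in simp)
  from this[of "Suc (card (f 0))"] show False by simp
qed

lemma perm_cancel: "inverse g * (g * h) = h" "g * (inverse g * h) = h" for g h :: "'a Perm.perm"
  by (simp_all flip: mult.assoc)

lemma conj_eq_iff: "t * g * inverse t = t * h * inverse t \<longleftrightarrow> g = h" for t g h :: "'a Perm.perm"
proof
  assume "t * g * inverse t = t * h * inverse t"
  then have "inverse t * (t * g * inverse t) * t = inverse t * (t * h * inverse t) * t" by simp
  then show "g = h" by (simp add: mult.assoc perm_cancel)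
qed simp

lemma conj_power: "(h * g * inverse h) ^ k = h * g ^ k * inverse h" for g h :: "'a Perm.perm"
  by (induction k) (simp_all add: mult.assoc perm_cancel)

locale perm_group =
  fixes G :: "'a Perm.perm set"
  assumes one_closed: "1 \<in> G"
    and mult_closed: "\<lbrakk>g \<in> G; h \<in> G\<rbrakk> \<Longrightarrow> g * h \<in> G"
    and inverse_closed: "g \<in> G \<Longrightarrow> inverse g \<in> G"
    and finite_G: "finite G"
begin

lemma power_closed: "g \<in> G \<Longrightarrow> g ^ k \<in> G"
  by (induction k) (auto intro: one_closed mult_closed)

end

text \<open>Valency at most two is expressed without cardinalities. The set \<open>X\<close> in
  \<open>faithful\<close> is a nonempty union of weak components, so the digraph itself need not be
  connected.\<close>

locale two_valent_digraph = perm_group G for G :: "'a Perm.perm set" +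
  fixes act :: "'a Perm.perm \<Rightarrow> 'x \<Rightarrow> 'x" and D :: "'x set" and E :: "'x \<Rightarrow> 'x \<Rightarrow> bool"
    and tau :: "'a Perm.perm" and v0 :: 'x
  assumes act_one: "act 1 x = x"
    and act_mult: "act (g * h) x = act g (act h x)"
    and finite_D: "finite D"
    and E_D: "E x y \<Longrightarrow> x \<in> D \<and> y \<in> D"
    and E_act: "\<lbrakk>g \<in> G; E x y\<rbrakk> \<Longrightarrow> E (act g x) (act g y)"
    and out_two: "\<lbrakk>E x y; E x y'; E x y''; y \<noteq> y'; y \<noteq> y''\<rbrakk> \<Longrightarrow> y' = y''"
    and in_two: "\<lbrakk>E y x; E y' x; E y'' x; y \<noteq> y'; y \<noteq> y''\<rbrakk> \<Longrightarrow> y' = y''"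
    and transitive: "\<lbrakk>x \<in> D; y \<in> D\<rbrakk> \<Longrightarrow> \<exists>g\<in>G. act g x = y"
    and faithful: "\<lbrakk>g \<in> G; X \<noteq> {}; X \<subseteq> D; \<And>x y. E x y \<Longrightarrow> x \<in> X \<longleftrightarrow> y \<in> X; \<And>x. x \<in> X \<Longrightarrow> act g x = x\<rbrakk>
       \<Longrightarrow> g = 1"
    and tau_G: "tau \<in> G" and tau_E: "E v0 (act tau v0)"
begin

lemma act_inverse [simp]: "act (inverse g) (act g x) = x" "act g (act (inverse g) x) = x"
  by (simp_all flip: act_mult add: act_one)

lemma act_eq_iff: "act g x = act g y \<longleftrightarrow> x = y"
  by (metis act_inverse(1))

lemma act_inverse_iff: "act (inverse g) x = y \<longleftrightarrow> x = act g y"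
  by auto

section \<open>A walk along the powers of a shift and the stabilizers of its segments\<close>

definition v :: "nat \<Rightarrow> 'x" where "v i = act (tau ^ i) v0"

lemma v_add: "v (k + i) = act (tau ^ k) (v i)"
  by (simp add: v_def power_add act_mult)

lemma E_v: "E (v i) (v (Suc i))"
proof -
  have "E (act (tau ^ i) v0) (act (tau ^ i) (act tau v0))"
    using E_act power_closed tau_G tau_E by blast
  then show ?thesis by (simp add: v_def power_Suc2 act_mult del: power_Suc)
qed

lemma v_D: "v i \<in> D" using E_v E_D by blast

definition F :: "nat \<Rightarrow> nat \<Rightarrow> 'a Perm.perm set" where
  "F p q = {g \<in> G. \<forall>k. p \<le> k \<longrightarrow> k \<le> q \<longrightarrow> act g (v k) = v k}"

lemma F_G: "g \<in> F p q \<Longrightarrow> g \<in> G" by (simp add: F_def)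

lemma F_fix: "\<lbrakk>g \<in> F p q; p \<le> k; k \<le> q\<rbrakk> \<Longrightarrow> act g (v k) = v k" by (simp add: F_def)

lemma F_mult: "\<lbrakk>g \<in> F p q; h \<in> F p q\<rbrakk> \<Longrightarrow> g * h \<in> F p q"
  by (simp add: F_def mult_closed act_mult)

lemma F_mono: "\<lbrakk>p' \<le> p; q \<le> q'\<rbrakk> \<Longrightarrow> F p' q' \<subseteq> F p q"
  by (auto simp: F_def)

lemma F_shift:
  assumes "g \<in> G"
  shows "tau ^ k * g * inverse (tau ^ k) \<in> F (p + k) (q + k) \<longleftrightarrow> g \<in> F p q"
proof -
  have "tau ^ k * g * inverse (tau ^ k) \<in> G"
    using assms by (simp add: mult_closed inverse_closed power_closed tau_G)
  moreover have "act (tau ^ k * g * inverse (tau ^ k)) (v (k + i)) = v (k + i) \<longleftrightarrow> act g (v i) = v i" for i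
    by (simp add: v_add act_mult act_eq_iff)
  moreover have "(\<forall>i. p + k \<le> i \<longrightarrow> i \<le> q + k \<longrightarrow> P i) \<longleftrightarrow> (\<forall>i. p \<le> i \<longrightarrow> i \<le> q \<longrightarrow> P (k + i))" for P
  proof (intro iffI allI impI)
    show "P (k + i)" if "\<forall>i. p + k \<le> i \<longrightarrow> i \<le> q + k \<longrightarrow> P i" "p \<le> i" "i \<le> q" for i
      using that by simp
    show "P i" if "\<forall>i. p \<le> i \<longrightarrow> i \<le> q \<longrightarrow> P (k + i)" "p + k \<le> i" "i \<le> q + k" for i
    proof -
      have "P (k + (i - k))" using that by (intro that(1)[rule_format]) auto
      then show ?thesis using that by simp
    qed
  qed
  ultimately show ?thesis using assms by (simp add: F_def)
qed

text \<open>The stabilizer of \<open>y\<close> acts on the at most two predecessors of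
  \<open>y\<close> through a group of order at most 2; the equivalence is membership in a subgroup
  of index at most 2, in the form of the chain axioms.\<close>

lemma fix_pred:
  assumes "g \<in> G" "h \<in> G" "act g y = y" "act h y = y" "E x y"
  shows "act (g * h) x = x \<longleftrightarrow> (act g x = x \<longleftrightarrow> act h x = x)"
proof -
  have p: "E (act g x) y" "E (act h x) y" "E (act g (act h x)) y"
    using E_act assms by metis+
  show ?thesis
  proof (cases "act h x = x")
    case False
    then have ne: "act g (act h x) \<noteq> act g x" by (simp add: act_eq_iff)
    show ?thesis
    proof (cases "act g x = x")
      case True
      then show ?thesis using False ne by (simp add: act_mult)
    next
      case gx: False
      then have "act h x = act g x" using in_two[OF \<open>E x y\<close> p(1,2)] False by simp
      then have "act g (act h x) = x" using in_two[OF \<open>E x y\<close> p(1,3)] gx ne by metis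
      then show ?thesis using gx False by (simp add: act_mult)
    qed
  qed (simp add: act_mult)
qed

lemma fix_succ:
  assumes "g \<in> G" "h \<in> G" "act g y = y" "act h y = y" "E y x"
  shows "act (g * h) x = x \<longleftrightarrow> (act g x = x \<longleftrightarrow> act h x = x)"
proof -
  have p: "E y (act g x)" "E y (act h x)" "E y (act g (act h x))"
    using E_act assms by metis+
  show ?thesis
  proof (cases "act h x = x")
    case False
    then have ne: "act g (act h x) \<noteq> act g x" by (simp add: act_eq_iff)
    show ?thesis
    proof (cases "act g x = x")
      case True
      then show ?thesis using False ne by (simp add: act_mult)
    next
      case gx: False
      then have "act h x = act g x" using out_two[OF \<open>E y x\<close> p(1,2)] False by simp
      then have "act g (act h x) = x" using out_two[OF \<open>E y x\<close> p(1,3)] gx ne by metis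
      then show ?thesis using gx False by (simp add: act_mult)
    qed
  qed (simp add: act_mult)
qed

lemma fix_out:
  assumes "g \<in> G" "act g x = x" "E x y" "E x z" "act g y = y"
  shows "act g z = z"
proof (rule ccontr)
  assume "act g z \<noteq> z"
  then have "z \<noteq> y" "act g z \<noteq> y" using assms(5) act_eq_iff by metis+
  moreover have "E x (act g z)" using E_act assms by metis
  ultimately show False using out_two assms(3,4) \<open>act g z \<noteq> z\<close> by blast
qed

text \<open>This becomes the number of involutions generating a vertex stabilizer: each shorter
  segment still has a stabilizer that moves the next vertex, and \<open>F 0 n\<close> will turn out
  to be trivial.\<close>

definition n :: nat where
  "n = (LEAST k. \<forall>g \<in> F 0 k. act g (v (Suc k)) = v (Suc k))"

lemma n_fix: "g \<in> F 0 n \<Longrightarrow> act g (v (Suc n)) = v (Suc n)"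
proof -
  have "\<exists>k. \<forall>g \<in> F 0 k. act g (v (Suc k)) = v (Suc k)"
  proof (rule ccontr)
    assume *: "\<not> ?thesis"
    have "F 0 (Suc k) \<subset> F 0 k" for k
    proof -
      obtain g where "g \<in> F 0 k" "act g (v (Suc k)) \<noteq> v (Suc k)" using * by blast
      then have "g \<notin> F 0 (Suc k)" by (auto simp: F_def)
      then show ?thesis using \<open>g \<in> F 0 k\<close> F_mono[of 0 0 k "Suc k"] by auto
    qed
    moreover have "finite (F 0 0)" using finite_G by (simp add: F_def)
    ultimately show False by (rule finite_no_strict_descent[rotated])
  qed
  from LeastI_ex[OF this] show "g \<in> F 0 n \<Longrightarrow> act g (v (Suc n)) = v (Suc n)"
    by (simp add: n_def)
qed

lemma n_move:
  assumes "k < n"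
  obtains g where "g \<in> F 0 k" "act g (v (Suc k)) \<noteq> v (Suc k)"
  using not_less_Least[of k "\<lambda>k. \<forall>g \<in> F 0 k. act g (v (Suc k)) = v (Suc k)"] assms
  unfolding n_def by blast

text \<open>For \<open>k < n\<close> some element of \<open>F 0 k\<close> exchanges the two
  continuations of the walk after \<open>v k\<close>, so an arbitrary walk can be straightened step
  by step.\<close>

lemma walk_transitive:
  assumes "k \<le> n" "w 0 \<in> D" "\<And>i. i < k \<Longrightarrow> E (w i) (w (Suc i))"
  shows "\<exists>h\<in>G. \<forall>i\<le>k. act h (w i) = v i"
  using assms
proof (induction k)
  case 0
  then show ?case using transitive[of "w 0" "v 0"] v_D by auto
next
  case (Suc k)
  then obtain h where h: "h \<in> G" "\<And>i. i \<le> k \<Longrightarrow> act h (w i) = v i" by auto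
  show ?case
  proof (cases "act h (w (Suc k)) = v (Suc k)")
    case True
    then show ?thesis using h by (metis le_Suc_eq)
  next
    case False
    obtain g where g: "g \<in> F 0 k" "act g (v (Suc k)) \<noteq> v (Suc k)" using n_move[of k] Suc.prems(1) by auto
    have "E (v k) (act h (w (Suc k)))"
      using E_act[OF h(1) Suc.prems(3)[of k]] h(2)[of k] by simp
    moreover have "E (v k) (act g (v (Suc k)))"
      using E_act[OF F_G[OF g(1)] E_v[of k]] F_fix[OF g(1), of k] by simp
    ultimately have "act h (w (Suc k)) = act g (v (Suc k))"
      using out_two[OF E_v[of k]] False g(2) by metis
    then have "\<forall>i\<le>Suc k. act (inverse g * h) (w i) = v i"
      using h(2) F_fix[OF g(1)] by (auto simp: act_mult act_inverse_iff le_Suc_eq)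
    then show ?thesis using h(1) F_G[OF g(1)] mult_closed inverse_closed by blast
  qed
qed

text \<open>The defining property of \<open>n\<close>, carried from the standard walk to an
  arbitrary one by \<open>walk_transitive\<close>.\<close>

lemma walk_fix_out:
  assumes "g \<in> G" "\<And>i. i < n \<Longrightarrow> E (w i) (w (Suc i))" "\<And>i. i \<le> n \<Longrightarrow> act g (w i) = w i" "E (w n) z"
  shows "act g z = z"
proof -
  have "w 0 \<in> D" using assms(2)[of 0] assms(4) E_D by (cases n) auto
  then obtain h where h: "h \<in> G" "\<And>i. i \<le> n \<Longrightarrow> act h (w i) = v i"
    using walk_transitive[of n w] assms(2) by auto
  have wi: "act (inverse h) (v i) = w i" if "i \<le> n" for i
    using h(2)[OF that] act_inverse_iff by metis
  have "h * g * inverse h \<in> F 0 n"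
    using h assms wi by (simp add: F_def mult_closed inverse_closed act_mult)
  then have "act (h * g * inverse h) (v (Suc n)) = v (Suc n)" "h * g * inverse h \<in> G"
    and "act (h * g * inverse h) (v n) = v n"
    using n_fix F_G F_fix by auto
  moreover have "E (v n) (act h z)" using E_act[OF h(1) assms(4)] h(2) by simp
  ultimately have "act (h * g * inverse h) (act h z) = act h z"
    using fix_out E_v by blast
  then show ?thesis by (simp add: act_mult act_eq_iff)
qed

text \<open>What is reachable from \<open>y\<close> is reachable from \<open>x\<close>; transitivity
  makes the two sets equally large, so they coincide and \<open>x\<close> is reachable from
  \<open>y\<close>. Thus weak components are strongly connected, and reachable sets are admissible
  in \<open>faithful\<close>.\<close>

lemma reachable_E_iff:
  assumes "E x y"
  shows "E\<^sup>*\<^sup>* z x \<longleftrightarrow> E\<^sup>*\<^sup>* z y"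
proof
  define R where "R x = {y. E\<^sup>*\<^sup>* x y}" for x
  have R_D: "R x \<subseteq> D" if "x \<in> D" for x
  proof
    fix y assume "y \<in> R x"
    then have "E\<^sup>*\<^sup>* x y" by (simp add: R_def)
    then show "y \<in> D" using that by (induction) (use E_D in auto)
  qed
  then have fin: "finite (R x)" if "x \<in> D" for x
    using that finite_D finite_subset by blast
  have R_act: "act g ` R x \<subseteq> R (act g x)" if "g \<in> G" for g x
  proof -
    have "E\<^sup>*\<^sup>* (act g x) (act g y)" if "E\<^sup>*\<^sup>* x y" for y
      using that by (induction) (use E_act[OF \<open>g \<in> G\<close>] in \<open>auto intro: rtranclp.rtrancl_into_rtrancl\<close>)
    then show ?thesis by (auto simp: R_def)
  qed
  have xy: "x \<in> D" "y \<in> D" using E_D assms by auto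
  obtain g where g: "g \<in> G" "act g x = y" using transitive xy by blast
  have "inj_on (act g) (R x)" using act_eq_iff by (auto intro: inj_onI)
  then have "card (R x) \<le> card (R y)"
    using R_act[OF g(1), of x] g(2) fin[OF xy(2)] by (metis card_image card_mono)
  moreover have "R y \<subseteq> R x"
    using assms by (auto simp: R_def intro: converse_rtranclp_into_rtranclp)
  ultimately have "R y = R x" using fin[OF xy(1)] card_seteq by blast
  then have yx: "E\<^sup>*\<^sup>* y x" by (auto simp: R_def)
  then show "E\<^sup>*\<^sup>* z y \<Longrightarrow> E\<^sup>*\<^sup>* z x" by (rule rtranclp_trans[rotated])
  show "E\<^sup>*\<^sup>* z x \<Longrightarrow> E\<^sup>*\<^sup>* z y" using assms by (rule rtranclp.rtrancl_into_rtrancl[rotated])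
qed

lemma F_n: "F p (p + n) = {1}"
proof -
  have "g = 1" if g: "g \<in> F 0 n" for g
  proof (rule faithful)
    show "g \<in> G" using g F_G by blast
    define X where "X = {y. E\<^sup>*\<^sup>* (v n) y}"
    show "X \<noteq> {}" by (auto simp: X_def)
    show "X \<subseteq> D"
    proof
      fix y assume "y \<in> X"
      then have "E\<^sup>*\<^sup>* (v n) y" by (simp add: X_def)
      then show "y \<in> D" by induction (use v_D E_D in auto)
    qed
    show "x \<in> X \<longleftrightarrow> y \<in> X" if "E x y" for x y
      using reachable_E_iff[OF that] by (simp add: X_def)
    \<comment> \<open>A sliding window: a walk of \<open>n\<close> steps fixed pointwise by
      \<open>g\<close> has its next vertex fixed by \<open>walk_fix_out\<close>, and dropping the
      first vertex gives such a walk ending there.\<close>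
    have "\<exists>w. (\<forall>i<n. E (w i) (w (Suc i))) \<and> (\<forall>i\<le>n. act g (w i) = w i) \<and> w n = y" if "E\<^sup>*\<^sup>* (v n) y" for y
      using that
    proof induction
      case base
      then show ?case using g E_v F_fix by (intro exI[of _ v]) auto
    next
      case (step y z)
      then obtain w where w: "\<And>i. i < n \<Longrightarrow> E (w i) (w (Suc i))" "\<And>i. i \<le> n \<Longrightarrow> act g (w i) = w i" "w n = y"
        by blast
      have "act g z = z"
        by (rule walk_fix_out[of g w]) (use g F_G w step in auto)
      let ?w = "\<lambda>i. if i < n then w (Suc i) else z"
      have "E (?w i) (?w (Suc i))" if "i < n" for i
        using that w(1)[of "Suc i"] w(3) step(2) by (cases "Suc i < n") (auto simp: not_less le_Suc_eq)
      moreover have "act g (?w i) = ?w i" if "i \<le> n" for i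
        using that w(2)[of "Suc i"] \<open>act g z = z\<close> by auto
      ultimately show ?case by (intro exI[of _ ?w]) auto
    qed
    then show "act g x = x" if "x \<in> X" for x
      using that by (fastforce simp: X_def)
  qed
  then have F0: "F 0 n = {1}" by (auto simp: F_def one_closed act_one)
  show ?thesis
  proof (intro equalityI subsetI)
    fix g :: "'a Perm.perm" assume g: "g \<in> F p (p + n)"
    define h where "h = inverse (tau ^ p) * g * tau ^ p"
    have hG: "h \<in> G" using F_G[OF g] by (simp add: h_def mult_closed inverse_closed power_closed tau_G)
    have gh: "g = tau ^ p * h * inverse (tau ^ p)"
      by (simp add: h_def mult.assoc) (simp flip: mult.assoc)
    then have "h \<in> F 0 n" using F_shift[OF hG, of p 0 n] g by (simp add: add.commute)
    then show "g \<in> {1}" using gh F0 by simp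
  next
    fix g :: "'a Perm.perm" assume "g \<in> {1}"
    then show "g \<in> F p (p + n)" by (simp add: F_def one_closed act_one)
  qed
qed

text \<open>For \<open>0 < n\<close> the chosen element is the involution of the group
  \<open>F 1 n\<close> of order 2. Its shift \<open>a i\<close> fixes \<open>v (Suc i)\<close> up to
  \<open>v (i + n)\<close> and moves the vertices of the walk on either side. The guard keeps the
  choice satisfiable for \<open>n = 0\<close>.\<close>

definition a :: "nat \<Rightarrow> 'a Perm.perm" where
  "a i = tau ^ i * (SOME g. g \<in> F 1 n \<and> (0 < n \<longrightarrow> g \<noteq> 1)) * inverse (tau ^ i)"

lemma a_shift: "a (k + i) = tau ^ k * a i * inverse (tau ^ k)"
  by (simp add: a_def power_add mult.assoc)

lemma a_F: "a i \<in> F (Suc i) (i + n)"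
  and a_not_1: "0 < n \<Longrightarrow> a i \<noteq> 1"
proof -
  have "\<exists>g. g \<in> F 1 n \<and> (0 < n \<longrightarrow> g \<noteq> 1)"
  proof (cases "0 < n")
    case True
    then obtain g where g: "g \<in> F 0 (n - 1)" "act g (v n) \<noteq> v n"
      using n_move[of "n - 1"] by auto
    let ?h = "tau ^ 1 * g * inverse (tau ^ 1)"
    have "?h \<in> F 1 n"
      using F_shift[OF F_G[OF g(1)], of 1 0 "n - 1"] g(1) True by simp
    moreover have "?h \<noteq> 1"
    proof
      assume "?h = 1"
      then have "inverse tau * ?h * tau = 1" by simp
      then have "g = 1" by (simp add: mult.assoc perm_cancel)
      then show False using g(2) by (simp add: act_one)
    qed
    ultimately show ?thesis by blast
  next
    case False
    then show ?thesis by (auto simp: F_def one_closed act_one intro!: exI[of _ 1])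
  qed
  from someI_ex[OF this] have a0: "a 0 \<in> F 1 n" "0 < n \<longrightarrow> a 0 \<noteq> 1" by (simp_all add: a_def)
  show "a i \<in> F (Suc i) (i + n)"
    using F_shift[OF F_G[OF a0(1)], of i 1 n] a0 a_shift[of i 0] by (simp add: add.commute)
  show "0 < n \<Longrightarrow> a i \<noteq> 1"
  proof
    assume "0 < n" "a i = 1"
    then have "inverse (tau ^ i) * a i * tau ^ i = 1" by simp
    then have "a 0 = 1" using a_shift[of i 0] by (simp add: mult.assoc perm_cancel)
    then show False using a0 \<open>0 < n\<close> by simp
  qed
qed

text \<open>The disjunct \<open>n \<le> l\<close> makes the minimum exist. If \<open>a 0\<close>
  commutes with \<open>a 1\<close> up to \<open>a (n - 1)\<close>, then \<open>n \<le> lam\<close>;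
  so \<open>lam < n\<close> marks the nonabelian case.\<close>

definition lam :: nat where
  "lam = (LEAST l. 0 < l \<and> (n \<le> l \<or> a 0 * a l \<noteq> a l * a 0))"

lemma lam: "0 < lam" "lam < n \<Longrightarrow> a 0 * a lam \<noteq> a lam * a 0"
  and lam_near: "\<lbrakk>0 < l; l < lam\<rbrakk> \<Longrightarrow> a 0 * a l = a l * a 0"
proof -
  have "0 < Suc n \<and> (n \<le> Suc n \<or> a 0 * a (Suc n) \<noteq> a (Suc n) * a 0)" by simp
  from LeastI[of "\<lambda>l. 0 < l \<and> (n \<le> l \<or> a 0 * a l \<noteq> a l * a 0)", OF this]
  show "0 < lam" "lam < n \<Longrightarrow> a 0 * a lam \<noteq> a lam * a 0"
    by (auto simp: lam_def)
  show "\<lbrakk>0 < l; l < lam\<rbrakk> \<Longrightarrow> a 0 * a l = a l * a 0"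
    unfolding lam_def using not_less_Least by blast
qed

lemma commute_shift: "a (k + i) * a (k + j) = a (k + j) * a (k + i) \<longleftrightarrow> a i * a j = a j * a i"
proof -
  have "a (k + i) * a (k + j) = tau ^ k * (a i * a j) * inverse (tau ^ k)" for i j
    unfolding a_shift by (simp add: mult.assoc perm_cancel)
  then show ?thesis by (simp add: conj_eq_iff)
qed

lemma icomm_shift: "icomm (a (k + i)) (a (k + j)) = tau ^ k * icomm (a i) (a j) * inverse (tau ^ k)"
  unfolding a_shift icomm_def by (simp add: mult.assoc perm_cancel)

lemma a_near:
  assumes "i < j" "j < i + lam"
  shows "a i * a j = a j * a i"
  using commute_shift[of i 0 "j - i"] lam_near[of "j - i"] assms by auto

lemma F_extend_left:
  assumes "g \<in> F (Suc p) q" "p < q"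
  shows "g \<in> F p q \<longleftrightarrow> act g (v p) = v p"
proof
  assume g: "act g (v p) = v p"
  have "act g (v k) = v k" if "p \<le> k" "k \<le> q" for k
    using g F_fix[OF assms(1), of k] that by (cases "k = p") auto
  then show "g \<in> F p q" using F_G[OF assms(1)] by (simp add: F_def)
qed (use assms in \<open>simp add: F_def\<close>)

lemma F_extend_right: "\<lbrakk>g \<in> F p q; p \<le> q\<rbrakk> \<Longrightarrow> g \<in> F p (Suc q) \<longleftrightarrow> act g (v (Suc q)) = v (Suc q)"
  unfolding F_def by (auto simp: le_Suc_eq)

lemma F_index_left:
  assumes "g \<in> F (Suc p) q" "h \<in> F (Suc p) q" "p < q"
  shows "g * h \<in> F p q \<longleftrightarrow> (g \<in> F p q \<longleftrightarrow> h \<in> F p q)"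
  using fix_pred[OF _ _ _ _ E_v[of p], of g h] F_G[OF assms(1)] F_G[OF assms(2)]
    F_fix[OF assms(1), of "Suc p"] F_fix[OF assms(2), of "Suc p"]
    F_extend_left[of _ p q] F_mult[OF assms(1,2)] assms by simp

lemma F_index_right:
  assumes "g \<in> F p q" "h \<in> F p q" "p \<le> q"
  shows "g * h \<in> F p (Suc q) \<longleftrightarrow> (g \<in> F p (Suc q) \<longleftrightarrow> h \<in> F p (Suc q))"
  using fix_succ[OF _ _ _ _ E_v[of q], of g h] F_G[OF assms(1)] F_G[OF assms(2)]
    F_fix[OF assms(1), of q] F_fix[OF assms(2), of q]
    F_extend_right[of _ p q] F_mult[OF assms(1,2)] assms by simp

lemma F_Int: "p' \<le> Suc q \<Longrightarrow> F p q \<inter> F p' q' \<subseteq> F p q'"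
  by (auto simp: F_def)

lemma a_sq: "a i * a i = 1" if "0 < n"
proof -
  have "a i \<notin> F i (i + n)" using F_n a_not_1 that by blast
  then have "a i * a i \<in> F i (i + n)" using F_index_left[OF a_F a_F, of i] that by auto
  then show ?thesis using F_n by blast
qed

text \<open>The argument of \<open>icomm_mem\<close> in terms of walks, needed here because it
  enters the verification of the chain axioms.\<close>

lemma icomm_F:
  assumes "i < j" "j < i + n"
  shows "icomm (a i) (a j) \<in> F j (Suc (i + n))"
proof -
  let ?x = "a i * a j"
  have "a i \<in> F (Suc j) (i + n)" "a j \<in> F (Suc j) (i + n)"
    using a_F[of i] a_F[of j] F_mono[of "Suc i" "Suc j" "i + n" "i + n"] F_mono[of "Suc j" "Suc j" "i + n" "j + n"]
      assms by auto
  then have x: "?x \<in> F (Suc j) (i + n)" by (rule F_mult)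
  have "?x * ?x \<in> F j (i + n)" "?x * ?x \<in> F (Suc j) (Suc (i + n))"
    using F_index_left[OF x x] F_index_right[OF x x] assms by auto
  then show ?thesis
    using F_Int[of "Suc j" "i + n" j "Suc (i + n)"] assms by (auto simp: icomm_def mult.assoc)
qed

text \<open>If the commutators coincide, \<open>u\<close> commutes with
  \<open>tau ^ (j - i)\<close>, so the segment that it fixes can be translated. Successive
  translates overlap, so \<open>u\<close> fixes arbitrarily long segments and is trivial by
  \<open>F_n\<close>.\<close>

lemma icomm_distinct:
  assumes "i < j" "j + l < i + n" "0 < l" "a i * a (i + l) \<noteq> a (i + l) * a i"
  shows "icomm (a i) (a (i + l)) \<noteq> icomm (a j) (a (j + l))"
proof
  define u where "u = icomm (a i) (a (i + l))"
  define k where "k = j - i"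
  assume "icomm (a i) (a (i + l)) = icomm (a j) (a (j + l))"
  then have "u = icomm (a (k + i)) (a (k + (i + l)))"
    using assms(1) by (simp add: u_def k_def)
  then have u: "u = tau ^ k * u * inverse (tau ^ k)" unfolding u_def icomm_shift .
  have "u \<noteq> 1" using icomm_eq_1_iff[of "a i" "a (i + l)"] a_sq assms by (simp add: u_def)
  have uF: "u \<in> F (i + l) (Suc (i + n))" using icomm_F assms by (simp add: u_def)
  have "u \<in> F (i + l) (Suc (i + n) + m)" for m
  proof (induction m)
    case 0
    then show ?case using uF by simp
  next
    case (Suc m)
    then have "u \<in> F (i + l + k) (Suc (i + n) + m + k)"
      using F_shift[OF F_G[OF uF], of k] u by metis
    then have "u \<in> F (i + l + k) (Suc (i + n) + Suc m)"
      using F_mono[of "i + l + k" "i + l + k" "Suc (i + n) + Suc m" "Suc (i + n) + m + k"] assms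
      by (auto simp: k_def)
    then show ?case
      using Suc F_Int[of "i + l + k" "Suc (i + n) + m" "i + l" "Suc (i + n) + Suc m"] assms
      by (auto simp: k_def)
  qed
  from this[of l] have "u \<in> F (i + l) (i + l + n)"
    using F_mono[of "i + l" "i + l" "i + l + n" "Suc (i + n) + l"] by auto
  then show False using F_n \<open>u \<noteq> 1\<close> by simp
qed

text \<open>Increasing \<open>j\<close> drops a vertex at the start of the walk and increasing \<open>i\<close> adds one at its end.\<close>

lemma chain: "involution_chain (\<lambda>i j. F (j + d) (i + d + n)) (\<lambda>i. a (i + d)) n lam"
proof
  fix i j
  show "F (i + d) (i + d + n) = {1}" by (rule F_n)
  show "F (j + d) (i + d + n) \<subseteq> F (j' + d) (i' + d + n)" if "i' \<le> i" "j \<le> j'" for i' j'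
    using that by (intro F_mono) auto
  show "F (j + d) (i + d + n) \<inter> F (Suc j + d) (Suc i + d + n) \<subseteq> F (j + d) (Suc i + d + n)" if "j < n"
    using that by (intro F_Int) simp
  show "a (j + d) \<in> F (Suc j + d) (j + d + n)" using a_F[of "j + d"] by simp
  show "a (j + d) \<notin> F (j + d) (i + d + n)" if "i \<le> j" "j < n"
  proof
    assume "a (j + d) \<in> F (j + d) (i + d + n)"
    then have "a (j + d) \<in> F (j + d) (j + d + n)"
      using a_F[of "j + d"] F_extend_left[of "a (j + d)" "j + d" "j + d + n"] F_fix[of _ "j + d" _ "j + d"] that
      by auto
    then show False using F_n a_not_1 that by auto
  qed
  show "a (i + d) \<notin> F (j + d) (Suc i + d + n)" if "i < j" "j \<le> n"
  proof
    assume "a (i + d) \<in> F (j + d) (Suc i + d + n)"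
    then have "a (i + d) \<in> F (Suc (i + d)) (Suc (i + d) + n)"
      using a_F[of "i + d"] F_extend_right[of "a (i + d)" "Suc (i + d)" "i + d + n"]
        F_fix[of "a (i + d)" "j + d" "Suc i + d + n" "Suc (i + d + n)"] that
      by auto
    then show False using F_n[of "Suc (i + d)"] a_not_1 that by auto
  qed
  show "g * h \<in> F (j + d) (i + d + n)" if "g \<in> F (j + d) (i + d + n)" "h \<in> F (j + d) (i + d + n)" for g h
    using that by (rule F_mult)
  show "g * h \<in> F (j + d) (i + d + n) \<longleftrightarrow> (g \<in> F (j + d) (i + d + n) \<longleftrightarrow> h \<in> F (j + d) (i + d + n))"
    if "j < n" "g \<in> F (Suc j + d) (i + d + n)" "h \<in> F (Suc j + d) (i + d + n)" for g h
    using F_index_left[of g "j + d" "i + d + n" h] that by simp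
  show "g * h \<in> F (j + d) (Suc i + d + n) \<longleftrightarrow> (g \<in> F (j + d) (Suc i + d + n) \<longleftrightarrow> h \<in> F (j + d) (Suc i + d + n))"
    if "j \<le> n" "g \<in> F (j + d) (i + d + n)" "h \<in> F (j + d) (i + d + n)" for g h
    using F_index_right[of g "j + d" "i + d + n" h] that by simp
  show "0 < lam" by (rule lam)
  show "a (i + d) * a (j + d) = a (j + d) * a (i + d)" if "i < j" "j < i + lam"
    using a_near[of "i + d" "j + d"] that by simp
  have add: "i + lam + d = i + d + lam" for i by simp
  show far: "a (i + d) * a (i + lam + d) \<noteq> a (i + lam + d) * a (i + d)" if "i + lam < n" for i
    unfolding add using commute_shift[of "i + d" 0 lam] lam(2) that by fastforce
  show "icomm (a (i + d)) (a (i + lam + d)) \<noteq> icomm (a (j + d)) (a (j + lam + d))" if "i < j" "j + lam < n"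
    unfolding add
    by (rule icomm_distinct) (use lam(1) that far[of i, unfolded add] in auto)
qed

text \<open>By transitivity the fixed vertex may be taken to be \<open>v n\<close>, whose stabilizer
  \<open>F n n\<close> is the full group \<open>S 0 n\<close> of the chain.\<close>

lemma stabilizer_power_4:
  assumes "g \<in> G" "x \<in> D" "act g x = x"
  shows "g ^ 4 = 1"
proof -
  interpret involution_chain "\<lambda>i j. F (j + 0) (i + 0 + n)" "\<lambda>i. a (i + 0)" n lam by (rule chain)
  obtain h where h: "h \<in> G" "act h x = v n" using transitive[OF assms(2) v_D] by blast
  then have "act (inverse h) (v n) = x" by (simp add: act_inverse_iff)
  then have "h * g * inverse h \<in> F n n"
    using h assms by (auto simp: F_def mult_closed inverse_closed act_mult)
  then have "h * g * inverse h * (h * g * inverse h) * (h * g * inverse h * (h * g * inverse h)) = 1"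
    using square_central(2) by simp
  then have "(h * g * inverse h) ^ 4 = 1" by (simp add: power4_eq_xxxx mult.assoc)
  then have "h * g ^ 4 * inverse h = h * 1 * inverse h"
    by (simp add: conj_power)
  then show ?thesis unfolding conj_eq_iff .
qed

section \<open>Inequalities between \<open>n\<close> and \<open>lam\<close>\<close>

lemma lam_index_bound: "n \<le> 2 * lam"
proof -
  interpret involution_chain "\<lambda>i j. F (j + 0) (i + 0 + n)" "\<lambda>i. a (i + 0)" n lam by (rule chain)
  show ?thesis using lam_bound by (cases "lam < n") auto
qed

text \<open>By \<open>chain\<close> with offset \<open>p\<close>, \<open>F q (p + n)\<close> plays
  the role of the group generated by \<open>a p, ..., a (q - 1)\<close>. This dictionary is behind
  the following lemmas as well.\<close>

lemma commute_F:
  assumes "g \<in> F q (p + n)" "p \<le> q" "q \<le> p + n" "\<And>r. \<lbrakk>p \<le> r; r < q\<rbrakk> \<Longrightarrow> x * a r = a r * x"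
  shows "x * g = g * x"
proof -
  interpret involution_chain "\<lambda>i j. F (j + p) (i + p + n)" "\<lambda>i. a (i + p)" n lam by (rule chain)
  show ?thesis
    using commute_S[of 0 "q - p" g x] assms by (simp add: less_diff_conv)
qed

lemma square_F:
  assumes "g \<in> F q (p + n)" "p \<le> q" "q \<le> p + n" "q \<le> p + lam"
  shows "g * g = 1"
proof -
  interpret involution_chain "\<lambda>i j. F (j + p) (i + p + n)" "\<lambda>i. a (i + p)" n lam by (rule chain)
  show ?thesis
    using square_near[of 0 "q - p" g] assms by simp
qed

lemma trim_left_F:
  assumes "g \<in> F j (i + n)" "i \<le> k" "k \<le> j" "j \<le> i + n"
    and "\<And>r. \<lbrakk>i + lam \<le> r; r < k + lam\<rbrakk> \<Longrightarrow> r < i + n \<and> g * a r = a r * g"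
  shows "g \<in> F j (k + n)"
proof -
  interpret involution_chain "\<lambda>l j. F (j + i) (l + i + n)" "\<lambda>l. a (l + i)" n lam by (rule chain)
  have "g \<in> F (j - i + i) (k - i + i + n)"
  proof (rule trim_left)
    show "g \<in> F (j - i + i) (0 + i + n)" using assms by simp
    show "r < n \<and> g * a (r + i) = a (r + i) * g" if "0 + lam \<le> r" "r < k - i + lam" for r
      using assms(5)[of "r + i"] that \<open>i \<le> k\<close> by simp
  qed (use assms lam_index_bound in auto)
  then show ?thesis using assms by simp
qed

lemma trim_right_F:
  assumes "g \<in> F j (i + n)" "i \<le> k" "k \<le> j" "j \<le> n" "lam \<le> k"
    and "\<And>r. \<lbrakk>k \<le> r + lam; r + lam < j\<rbrakk> \<Longrightarrow> g * a r = a r * g"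
  shows "g \<in> F k (i + n)"
proof -
  interpret involution_chain "\<lambda>i j. F (j + 0) (i + 0 + n)" "\<lambda>i. a (i + 0)" n lam by (rule chain)
  have "g \<in> F (k + 0) (i + 0 + n)"
    using trim_right[where g = g and i = i and j = j and k = k] assms lam_index_bound by simp
  then show ?thesis by simp
qed

lemma square_central_F:
  assumes "g \<in> F n n" "r < n"
  shows "g * g * a r = a r * (g * g)"
proof -
  interpret involution_chain "\<lambda>i j. F (j + 0) (i + 0 + n)" "\<lambda>i. a (i + 0)" n lam by (rule chain)
  show ?thesis using square_central(1)[of g r] assms by simp
qed

lemma icomm_central_F:
  assumes "i < j" "j < n" "r < n"
  shows "icomm (a i) (a j) * a r = a r * icomm (a i) (a j)"
proof -
  interpret involution_chain "\<lambda>i j. F (j + 0) (i + 0 + n)" "\<lambda>i. a (i + 0)" n lam by (rule chain)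
  show ?thesis using centralD[OF central_all, of 0 "n - 1" i j r] assms by simp
qed

text \<open>Commuting with \<open>a 0, ..., a n\<close> allows \<open>z\<close> to be trimmed from
  both sides. If \<open>lam \<le> n - lam + 1\<close>, the two trimmings meet at
  \<open>n - lam + 1\<close> and nothing is left of \<open>z\<close>.\<close>

lemma central_lower_bound:
  assumes "z \<in> F n (1 + n)" "z \<noteq> 1" "lam < n" "\<And>r. r \<le> n \<Longrightarrow> z * a r = a r * z"
  shows "n - lam + 1 < lam"
proof (rule ccontr)
  let ?m = "n - lam"
  assume neg: "\<not> ?thesis"
  have "z \<in> F n (?m + 1 + n)"
    using assms(1) by (rule trim_left_F) (use assms lam in auto)
  then have "z \<in> F (?m + 1) (?m + 1 + n)"
    by (rule trim_right_F) (use assms neg lam(1) in auto)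
  then show False using F_n[of "?m + 1"] assms(2) by simp
qed

text \<open>The commutator \<open>u (m - 1)\<close> is located in two ways: as a shift of
  \<open>u 0\<close>, which was trimmed on the left, it fixes vertices far along the walk, and
  trimmed itself on the right it fixes early ones. If \<open>lam < 2 * m\<close>, the two segments
  together span \<open>n\<close> steps, so it would be trivial.\<close>

lemma lam_lower_bound:
  assumes "lam < n"
  shows "2 * (n - lam) \<le> lam"
proof (rule ccontr)
  define m where "m = n - lam"
  define u where "u i = icomm (a i) (a (i + lam))" for i
  assume "\<not> ?thesis"
  then have m: "0 < m" "lam < 2 * m" "n = m + lam" "m \<le> lam"
    using assms lam_index_bound by (auto simp: m_def)
  have "u 0 \<in> F lam (1 + n)" using icomm_F[of 0 lam] lam(1) assms by (simp add: u_def)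
  then have "u 0 \<in> F lam (m + n)"
    by (rule trim_left_F) (use m assms lam(1) icomm_central_F[of 0 lam] in \<open>auto simp: u_def\<close>)
  moreover have "u (m - 1) = tau ^ (m - 1) * u 0 * inverse (tau ^ (m - 1))"
    using icomm_shift[of "m - 1" 0 lam] by (simp add: u_def)
  ultimately have u1: "u (m - 1) \<in> F (lam + (m - 1)) (m + n + (m - 1))"
    using F_shift[OF F_G, of "u 0" lam "m + n" "m - 1" lam "m + n"] by simp
  have "u (m - 1) \<in> F (n - 1) (m + n)"
    using icomm_F[of "m - 1" "m - 1 + lam"] m lam(1) by (simp add: u_def)
  then have u2: "u (m - 1) \<in> F lam (m + n)"
    by (rule trim_right_F)
       (use m lam(1) icomm_central_F[of "m - 1" "m - 1 + lam"] in \<open>auto simp: u_def\<close>)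
  have "u (m - 1) \<in> F lam (m + n + (m - 1))"
  proof -
    have "lam + (m - 1) \<le> Suc (m + n)" using m by simp
    from F_Int[OF this, of lam "m + n + (m - 1)"] show ?thesis using u1 u2 by blast
  qed
  then have "u (m - 1) \<in> F lam (lam + n)"
  proof -
    have "lam + n \<le> m + n + (m - 1)" using m by simp
    from F_mono[OF order_refl this] show ?thesis
      using \<open>u (m - 1) \<in> F lam (m + n + (m - 1))\<close> by blast
  qed
  then have "u (m - 1) = 1" using F_n by simp
  then have "a (m - 1) * a (m - 1 + lam) = a (m - 1 + lam) * a (m - 1)"
    using icomm_eq_1_iff[of "a (m - 1)" "a (m - 1 + lam)"] a_sq m by (simp add: u_def)
  then show False using commute_shift[of "m - 1" 0 lam] lam(2) assms by simp
qed

end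

section \<open>Elements fixing a vertex of a cubic vertex-transitive graph\<close>

unbundle permutation_syntax

lemma apply_inverse_cancel [simp]:
  "inverse g \<langle>$\<rangle> (g \<langle>$\<rangle> x) = x" "g \<langle>$\<rangle> (inverse g \<langle>$\<rangle> x) = x"
  by (simp_all add: apply_inverse bij_is_inj bij_is_surj surj_f_inv_f)

lemma apply_inverse_iff: "inverse g \<langle>$\<rangle> y = x \<longleftrightarrow> y = g \<langle>$\<rangle> x"
  by auto

section \<open>Local action of elements of odd order and of 2-power order\<close>

lemma perm_odd_fix:
  fixes g :: "'a Perm.perm"
  assumes "g ^ k = 1" "odd k" "g \<langle>$\<rangle> (g \<langle>$\<rangle> u) = u"
  shows "g \<langle>$\<rangle> u = u"
proof -
  have "(g ^ 2) \<langle>$\<rangle> u = u" using assms(3) by (simp add: power2_eq_square apply_times)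
  then have "Perm.order g u dvd 2" by (simp add: apply_power_eq_self_iff)
  moreover have "Perm.order g u dvd k"
    using assms(1) by (simp flip: apply_power_eq_self_iff)
  moreover have "coprime 2 k" using assms(2) by simp
  ultimately have "Perm.order g u = 1" using coprime_common_divisor_nat by blast
  then show ?thesis by (simp add: order_eq_one_iff in_affected)
qed

lemma odd_part:
  fixes k :: nat
  assumes "0 < k"
  shows "\<exists>r m. k = 2 ^ r * m \<and> odd m"
  using assms
proof (induction k rule: less_induct)
  case (less k)
  show ?case
  proof (cases "odd k")
    case True
    then show ?thesis by (intro exI[of _ 0] exI[of _ k]) simp
  next
    case False
    then have "even k" by simp
    then obtain l where "k = 2 * l" by (rule dvdE)
    then obtain r m where "l = 2 ^ r * m" "odd m"
      using less.IH[of l] less.prems by auto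
    then show ?thesis
      using \<open>k = 2 * l\<close> by (intro exI[of _ "Suc r"] exI[of _ m]) simp
  qed
qed

definition act_arc :: "'a Perm.perm \<Rightarrow> 'a \<times> 'a \<Rightarrow> 'a \<times> 'a" where
  "act_arc g e = (g \<langle>$\<rangle> (fst e), g \<langle>$\<rangle> (snd e))"

definition next_arc :: "('a \<Rightarrow> 'a \<Rightarrow> bool) \<Rightarrow> 'a \<times> 'a \<Rightarrow> 'a \<times> 'a \<Rightarrow> bool" where
  "next_arc adj e f \<longleftrightarrow> adj (fst e) (snd e) \<and> adj (fst f) (snd f) \<and> snd e = fst f \<and> fst e \<noteq> snd f"

locale cubic_vertex_transitive = perm_group G for G :: "'a Perm.perm set" +
  fixes V :: "'a set" and adj :: "'a \<Rightarrow> 'a \<Rightarrow> bool"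
  assumes finite_V: "finite V" and V_ne: "V \<noteq> {}"
    and adj_sym: "adj x y \<Longrightarrow> adj y x"
    and adj_irrefl: "\<not> adj x x"
    and adj_V: "adj x y \<Longrightarrow> x \<in> V"
    and card_nbrs: "x \<in> V \<Longrightarrow> card {y. adj x y} = 3"
    and connected: "\<lbrakk>X \<subseteq> V; X \<noteq> {}; \<And>x y. \<lbrakk>x \<in> X; adj x y\<rbrakk> \<Longrightarrow> y \<in> X\<rbrakk> \<Longrightarrow> X = V"
    and G_adj: "g \<in> G \<Longrightarrow> adj (g \<langle>$\<rangle> x) (g \<langle>$\<rangle> y) \<longleftrightarrow> adj x y"
    and G_outside: "\<lbrakk>g \<in> G; x \<notin> V\<rbrakk> \<Longrightarrow> g \<langle>$\<rangle> x = x"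
    and G_transitive: "\<lbrakk>x \<in> V; y \<in> V\<rbrakk> \<Longrightarrow> \<exists>g\<in>G. g \<langle>$\<rangle> x = y"
begin

lemma adj_V2: "adj x y \<Longrightarrow> y \<in> V"
  using adj_V adj_sym by blast

lemma G_V: "g \<in> G \<Longrightarrow> x \<in> V \<Longrightarrow> g \<langle>$\<rangle> x \<in> V"
  using G_outside[of g "g \<langle>$\<rangle> x"] apply_inj[of g "g \<langle>$\<rangle> x" x] by metis

lemma nbrs:
  assumes "x \<in> V"
  obtains p q r where "p \<noteq> q" "p \<noteq> r" "q \<noteq> r" "\<And>y. adj x y \<longleftrightarrow> y = p \<or> y = q \<or> y = r"
proof -
  obtain p q r where pqr: "{y. adj x y} = {p, q, r}" "p \<noteq> q" "q \<noteq> r" "p \<noteq> r"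
    using card_nbrs[OF assms] unfolding card_3_iff by (elim exE conjE)
  have "adj x y \<longleftrightarrow> y = p \<or> y = q \<or> y = r" for y
    using pqr(1)[THEN eqset_imp_iff, of y] by simp
  then show ?thesis using that pqr(2-4) by presburger
qed

lemma third_nbr:
  assumes "adj x p" "adj x q" "p \<noteq> q"
  obtains r where "p \<noteq> r" "q \<noteq> r" "\<And>y. adj x y \<longleftrightarrow> y = p \<or> y = q \<or> y = r"
proof -
  have "card ({y. adj x y} - {p, q}) = 1"
    using card_nbrs[OF adj_V[OF assms(1)]] assms by (simp add: card_Diff_subset)
  then obtain r where r: "{y. adj x y} - {p, q} = {r}" by (rule card_1_singletonE)
  have "adj x y \<longleftrightarrow> y = p \<or> y = q \<or> y = r" for y
    using r[THEN eqset_imp_iff, of y] assms by auto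
  moreover have "p \<noteq> r" "q \<noteq> r" using r by auto
  ultimately show ?thesis using that by presburger
qed

lemma other_nbrs:
  assumes "adj x p"
  obtains q r where "p \<noteq> q" "p \<noteq> r" "q \<noteq> r" "\<And>y. adj x y \<longleftrightarrow> y = p \<or> y = q \<or> y = r"
proof -
  have "card ({y. adj x y} - {p}) = 2"
    using card_nbrs[OF adj_V[OF assms(1)]] assms by (simp add: card_Diff_subset)
  then obtain q where "q \<in> {y. adj x y} - {p}" unfolding card_2_iff by blast
  then have q: "adj x q" "p \<noteq> q" by auto
  show ?thesis by (rule third_nbr[OF assms q]) (rule that[OF q(2)])
qed

lemma adj_two:
  assumes "adj x u" "adj x y" "adj x y'" "adj x y''" "y \<noteq> u" "y' \<noteq> u" "y'' \<noteq> u" "y \<noteq> y'" "y \<noteq> y''"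
  shows "y' = y''"
proof -
  obtain q r where "\<And>z. adj x z \<longleftrightarrow> z = u \<or> z = q \<or> z = r"
    by (rule other_nbrs[OF assms(1)]) blast
  then show ?thesis using assms by auto
qed

lemma fix_nbrs:
  assumes "g \<in> G" "g \<langle>$\<rangle> x = x" "adj x p" "adj x q" "p \<noteq> q" "g \<langle>$\<rangle> p = p" "g \<langle>$\<rangle> q = q" "adj x y"
  shows "g \<langle>$\<rangle> y = y"
proof -
  obtain r where r: "p \<noteq> r" "q \<noteq> r" "\<And>y. adj x y \<longleftrightarrow> y = p \<or> y = q \<or> y = r"
    by (rule third_nbr[OF assms(3-5)]) blast
  have "adj x (g \<langle>$\<rangle> r)" using G_adj[OF assms(1), of x r] assms(2) r by simp
  then have "g \<langle>$\<rangle> r = r" using r assms by (metis apply_inj)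
  then show ?thesis using assms(6-8) r(3)[of y] by auto
qed

lemma fix_all:
  assumes "g \<in> G" "X \<subseteq> V" "X \<noteq> {}" "\<And>x y. \<lbrakk>x \<in> X; adj x y\<rbrakk> \<Longrightarrow> y \<in> X" "\<And>x. x \<in> X \<Longrightarrow> g \<langle>$\<rangle> x = x"
  shows "g = 1"
proof (rule perm_eqI)
  have "X = V" using connected assms by blast
  then show "g \<langle>$\<rangle> x = 1 \<langle>$\<rangle> x" for x
    using assms G_outside by (cases "x \<in> V") auto
qed

text \<open>An element fixing a vertex and one neighbour permutes the other two, and odd order rules
  out a swap. So the set of fixed vertices with a fixed neighbour is closed under adjacency.\<close>

lemma odd_fix_arc:
  assumes "g \<in> G" "g ^ k = 1" "odd k" "adj x y" "g \<langle>$\<rangle> x = x" "g \<langle>$\<rangle> y = y"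
  shows "g = 1"
proof (rule fix_all)
  define X where "X = {z. g \<langle>$\<rangle> z = z \<and> (\<exists>w. adj z w \<and> g \<langle>$\<rangle> w = w)}"
  show "X \<subseteq> V" using adj_V by (auto simp: X_def)
  show "X \<noteq> {}" using assms by (auto simp: X_def)
  show "y \<in> X" if "x \<in> X" "adj x y" for x y
  proof -
    obtain w where w: "g \<langle>$\<rangle> x = x" "adj x w" "g \<langle>$\<rangle> w = w" using \<open>x \<in> X\<close> by (auto simp: X_def)
    have "g \<langle>$\<rangle> y = y"
    proof (cases "y = w")
      case False
      have "adj x (g \<langle>$\<rangle> z) \<longleftrightarrow> adj x z" for z
        using G_adj[OF assms(1), of x z] w by simp
      then have "adj x (g \<langle>$\<rangle> y)" "adj x (g \<langle>$\<rangle> (g \<langle>$\<rangle> y))" using \<open>adj x y\<close> by auto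
      moreover have "g \<langle>$\<rangle> y \<noteq> w" "g \<langle>$\<rangle> (g \<langle>$\<rangle> y) \<noteq> w" using False w apply_inj by metis+
      ultimately have "g \<langle>$\<rangle> y = y \<or> g \<langle>$\<rangle> (g \<langle>$\<rangle> y) = y"
        using adj_two[OF w(2), of "g \<langle>$\<rangle> y" y "g \<langle>$\<rangle> (g \<langle>$\<rangle> y)"] \<open>adj x y\<close> False apply_inj by metis
      then show ?thesis using perm_odd_fix[OF assms(2,3)] by blast
    qed (use w in simp)
    then show ?thesis using w(1) that adj_sym by (auto simp: X_def)
  qed
  show "g \<langle>$\<rangle> x = x" if "x \<in> X" for x using that by (simp add: X_def)
qed (fact assms(1))

lemma rotates:
  assumes "g \<in> G" "g \<langle>$\<rangle> x = x" "x \<in> V" "\<And>y. adj x y \<Longrightarrow> g \<langle>$\<rangle> y \<noteq> y"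
  obtains p q r where "p \<noteq> q" "p \<noteq> r" "q \<noteq> r" "\<And>y. adj x y \<longleftrightarrow> y = p \<or> y = q \<or> y = r"
    "g \<langle>$\<rangle> p = q" "g \<langle>$\<rangle> q = r" "g \<langle>$\<rangle> r = p"
proof -
  obtain p q r where pqr: "p \<noteq> q" "p \<noteq> r" "q \<noteq> r" "\<And>y. adj x y \<longleftrightarrow> y = p \<or> y = q \<or> y = r"
    by (rule nbrs[OF assms(3)]) blast
  have "adj x (g \<langle>$\<rangle> z) \<longleftrightarrow> adj x z" for z
    using G_adj[OF assms(1), of x z] assms by simp
  then have im: "g \<langle>$\<rangle> z = p \<or> g \<langle>$\<rangle> z = q \<or> g \<langle>$\<rangle> z = r" if "z = p \<or> z = q \<or> z = r" for z
    using that pqr by metis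
  have ne: "g \<langle>$\<rangle> p \<noteq> p" "g \<langle>$\<rangle> q \<noteq> q" "g \<langle>$\<rangle> r \<noteq> r" using assms pqr by auto
  have inj: "g \<langle>$\<rangle> p \<noteq> g \<langle>$\<rangle> q" "g \<langle>$\<rangle> p \<noteq> g \<langle>$\<rangle> r" "g \<langle>$\<rangle> q \<noteq> g \<langle>$\<rangle> r" using pqr by (simp_all add: apply_inj)
  consider "g \<langle>$\<rangle> p = q" | "g \<langle>$\<rangle> p = r" using im ne by blast
  then show ?thesis
  proof cases
    case 1
    then show ?thesis using that[of p q r] pqr im ne inj by metis
  next
    case 2
    then have "g \<langle>$\<rangle> r = q" "g \<langle>$\<rangle> q = p" using im ne inj by metis+
    then show ?thesis using that[of p r q] pqr 2 by metis
  qed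
qed

lemma rotates_orbit:
  assumes "g \<in> G" "g \<langle>$\<rangle> x = x" "\<forall>y. adj x y \<longrightarrow> g \<langle>$\<rangle> y \<noteq> y" "adj x w"
  shows "adj x z \<Longrightarrow> z = w \<or> z = g \<langle>$\<rangle> w \<or> z = g \<langle>$\<rangle> (g \<langle>$\<rangle> w)"
    and "g \<langle>$\<rangle> (g \<langle>$\<rangle> (g \<langle>$\<rangle> w)) = w"
proof -
  have "(adj x z \<longrightarrow> z = w \<or> z = g \<langle>$\<rangle> w \<or> z = g \<langle>$\<rangle> (g \<langle>$\<rangle> w)) \<and> g \<langle>$\<rangle> (g \<langle>$\<rangle> (g \<langle>$\<rangle> w)) = w"
  proof (rule rotates[OF assms(1,2) adj_V[OF assms(4)]])
    show "g \<langle>$\<rangle> y \<noteq> y" if "adj x y" for y using assms(3) that by blast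
  next
    fix p q r
    assume pqr: "\<And>y. adj x y \<longleftrightarrow> y = p \<or> y = q \<or> y = r" "g \<langle>$\<rangle> p = q" "g \<langle>$\<rangle> q = r" "g \<langle>$\<rangle> r = p"
    have "w = p \<or> w = q \<or> w = r" using pqr(1) assms(4) by simp
    then show "(adj x z \<longrightarrow> z = w \<or> z = g \<langle>$\<rangle> w \<or> z = g \<langle>$\<rangle> (g \<langle>$\<rangle> w)) \<and> g \<langle>$\<rangle> (g \<langle>$\<rangle> (g \<langle>$\<rangle> w)) = w"
      unfolding pqr(1) by (elim disjE) (auto simp: pqr(2-4))
  qed
  then show "adj x z \<Longrightarrow> z = w \<or> z = g \<langle>$\<rangle> w \<or> z = g \<langle>$\<rangle> (g \<langle>$\<rangle> w)"
    and "g \<langle>$\<rangle> (g \<langle>$\<rangle> (g \<langle>$\<rangle> w)) = w" by simp_all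
qed

lemma odd_cube:
  assumes "g \<in> G" "g ^ k = 1" "odd k" "x \<in> V" "g \<langle>$\<rangle> x = x"
  shows "g ^ 3 = 1"
proof (cases "\<exists>y. adj x y \<and> g \<langle>$\<rangle> y = y")
  case True
  then have "g = 1" using odd_fix_arc assms by metis
  then show ?thesis by simp
next
  case False
  then have "g \<langle>$\<rangle> y \<noteq> y" if "adj x y" for y using that by blast
  from rotates[OF assms(1,5,4) this] obtain p q r
    where "adj x p" "g \<langle>$\<rangle> p = q" "g \<langle>$\<rangle> q = r" "g \<langle>$\<rangle> r = p"
    by metis
  then have "(g ^ 3) \<langle>$\<rangle> p = p" by (simp add: numeral_3_eq_3 apply_times)
  moreover have "(g ^ 3) ^ k = 1"
    using assms(2) by (metis power_commutes power_mult mult.commute power_one)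
  moreover have "(g ^ 3) \<langle>$\<rangle> x = x" using assms(5) by (simp add: numeral_3_eq_3 apply_times)
  ultimately show ?thesis
    using odd_fix_arc[of "g ^ 3" k x p] power_closed assms \<open>adj x p\<close> by blast
qed

lemma two_power_fix_nbr:
  assumes "g \<in> G" "g ^ (2 ^ c) = 1" "x \<in> V" "g \<langle>$\<rangle> x = x"
  obtains y where "adj x y" "g \<langle>$\<rangle> y = y"
proof (rule ccontr)
  assume "\<not> thesis"
  then have "g \<langle>$\<rangle> y \<noteq> y" if "adj x y" for y using that \<open>\<And>y. \<lbrakk>adj x y; g \<langle>$\<rangle> y = y\<rbrakk> \<Longrightarrow> thesis\<close> by blast
  from rotates[OF assms(1,4,3) this] obtain p q r where p: "p \<noteq> q" "g \<langle>$\<rangle> p = q" "g \<langle>$\<rangle> q = r" "g \<langle>$\<rangle> r = p"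
    by metis
  then have "(g ^ 3) \<langle>$\<rangle> p = p" by (simp add: numeral_3_eq_3 apply_times)
  then have "Perm.order g p dvd 3" by (simp add: apply_power_eq_self_iff)
  moreover have "Perm.order g p dvd 2 ^ c"
    using assms(2) by (simp flip: apply_power_eq_self_iff)
  moreover have "coprime 3 (2 ^ c :: nat)" by simp
  ultimately have "Perm.order g p = 1" using coprime_common_divisor_nat by blast
  then show False using p by (simp add: order_eq_one_iff in_affected)
qed

section \<open>The digraph of arcs\<close>

definition arc_transitive :: bool where
  "arc_transitive \<longleftrightarrow> (\<forall>x y x' y'. adj x y \<longrightarrow> adj x' y' \<longrightarrow> (\<exists>g\<in>G. g \<langle>$\<rangle> x = x' \<and> g \<langle>$\<rangle> y = y'))"

lemma arc_digraph:
  assumes arc_transitive "tau \<in> G" "next_arc adj v0 (act_arc tau v0)"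
  shows "two_valent_digraph G act_arc {e. adj (fst e) (snd e)} (next_arc adj) tau v0"
proof
  show "finite {e. adj (fst e) (snd e)}"
  proof (rule finite_subset)
    show "{e. adj (fst e) (snd e)} \<subseteq> V \<times> V"
      by (auto simp: mem_Times_iff dest: adj_V adj_V2)
  qed (simp add: finite_V)
  show "next_arc adj (act_arc g e) (act_arc g f)" if "g \<in> G" "next_arc adj e f" for g e f
    using that G_adj[OF that(1)] by (auto simp: next_arc_def act_arc_def apply_inj)
  show "f' = f''" if *: "next_arc adj e f" "next_arc adj e f'" "next_arc adj e f''" "f \<noteq> f'" "f \<noteq> f''" for e f f' f''
  proof -
    obtain x y z z' z'' where e: "e = (x, y)" "f = (y, z)" "f' = (y, z')" "f'' = (y, z'')"
      using * by (metis next_arc_def prod.collapse)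
    have "adj y x" "adj y z" "adj y z'" "adj y z''" "z \<noteq> x" "z' \<noteq> x" "z'' \<noteq> x" "z \<noteq> z'" "z \<noteq> z''"
      using * adj_sym[of x y] unfolding e next_arc_def fst_conv snd_conv by blast+
    then show ?thesis using adj_two unfolding e by blast
  qed
  show "f' = f''" if *: "next_arc adj f e" "next_arc adj f' e" "next_arc adj f'' e" "f \<noteq> f'" "f \<noteq> f''" for e f f' f''
  proof -
    obtain x y z z' z'' where e: "e = (y, x)" "f = (z, y)" "f' = (z', y)" "f'' = (z'', y)"
      using * by (metis next_arc_def prod.collapse)
    have "adj y x" "adj y z" "adj y z'" "adj y z''" "z \<noteq> x" "z' \<noteq> x" "z'' \<noteq> x" "z \<noteq> z'" "z \<noteq> z''"
      using * adj_sym[of _ y] unfolding e next_arc_def fst_conv snd_conv by blast+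
    then show ?thesis using adj_two unfolding e by blast
  qed
  show "\<exists>g\<in>G. act_arc g e = f" if "e \<in> {e. adj (fst e) (snd e)}" "f \<in> {e. adj (fst e) (snd e)}" for e f
    using assms(1) that unfolding arc_transitive_def act_arc_def by (metis mem_Collect_eq prod.collapse)
  show "g = 1" if g: "g \<in> G" and X: "X \<noteq> {}" "X \<subseteq> {e. adj (fst e) (snd e)}"
    and iff: "\<And>e f. next_arc adj e f \<Longrightarrow> e \<in> X \<longleftrightarrow> f \<in> X" and fixed: "\<And>e. e \<in> X \<Longrightarrow> act_arc g e = e" for g X
  proof (rule fix_all)
    \<comment> \<open>At \<open>w\<close>, the relation joins the arc \<open>(p, w)\<close> to
      \<open>(w, q)\<close> for distinct neighbours \<open>p\<close>, \<open>q\<close>. On the six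
      arcs at \<open>w\<close> this is a hexagon, so one arc of \<open>X\<close> brings in all
      six.\<close>
    have step: "(w, z) \<in> X \<and> (z, w) \<in> X" if "(u, w) \<in> X" "adj w z" for u w z
    proof -
      have uw: "adj w u" using X that adj_sym by auto
      have nxt: "(a, w) \<in> X \<longleftrightarrow> (w, b) \<in> X" if "adj w a" "adj w b" "a \<noteq> b" for a b
        by (rule iff) (use that adj_sym in \<open>auto simp: next_arc_def\<close>)
      obtain q r where "u \<noteq> q" "u \<noteq> r" "q \<noteq> r" "\<And>y. adj w y \<longleftrightarrow> y = u \<or> y = q \<or> y = r"
        by (rule other_nbrs[OF uw]) blast
      then show ?thesis using nxt that by metis
    qed
    show "fst ` X \<subseteq> V" using X adj_V by auto
    show "fst ` X \<noteq> {}" using X by simp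
    show "y \<in> fst ` X" if "x \<in> fst ` X" "adj x y" for x y
    proof -
      obtain z where "(x, z) \<in> X" using \<open>x \<in> fst ` X\<close> by auto
      then have "(z, x) \<in> X" using step[of x z x] X adj_sym by auto
      then have "(y, x) \<in> X" using step \<open>adj x y\<close> by blast
      then show ?thesis by force
    qed
    show "g \<langle>$\<rangle> x = x" if "x \<in> fst ` X" for x
      using fixed that by (auto simp: act_arc_def prod_eq_iff)
  qed (fact g)
  show "act_arc 1 e = e" "act_arc (g * h) e = act_arc g (act_arc h e)" for g h e
    by (simp_all add: act_arc_def apply_times)
  show "e \<in> {e. adj (fst e) (snd e)} \<and> f \<in> {e. adj (fst e) (snd e)}" if "next_arc adj e f" for e f
    using that unfolding next_arc_def mem_Collect_eq by blast
  show "tau \<in> G" "next_arc adj v0 (act_arc tau v0)" by (fact assms)+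
qed

text \<open>Vertex-transitivity reduces arc-transitivity to one vertex stabilizer being transitive
  on the neighbours.\<close>

lemma arc_transitiveI:
  assumes "adj x u" and "\<And>y. adj x y \<Longrightarrow> \<exists>h\<in>G. h \<langle>$\<rangle> x = x \<and> h \<langle>$\<rangle> u = y"
  shows arc_transitive
proof -
  have to: "\<exists>g\<in>G. g \<langle>$\<rangle> x = y \<and> g \<langle>$\<rangle> u = z" if "adj y z" for y z
  proof -
    obtain g where g: "g \<in> G" "g \<langle>$\<rangle> x = y" using G_transitive[OF adj_V[OF assms(1)] adj_V[OF \<open>adj y z\<close>]] by blast
    have inv: "inverse g \<in> G" "inverse g \<langle>$\<rangle> y = x"
      using g inverse_closed by (auto simp: apply_inverse_iff)
    then have "adj x (inverse g \<langle>$\<rangle> z)" using G_adj[OF inv(1), of y z] that by simp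
    then obtain h where h: "h \<in> G" "h \<langle>$\<rangle> x = x" "h \<langle>$\<rangle> u = inverse g \<langle>$\<rangle> z" using assms(2) by blast
    show ?thesis using g h mult_closed by (intro bexI[of _ "g * h"]) (auto simp: apply_times)
  qed
  show ?thesis
    unfolding arc_transitive_def
  proof (intro allI impI)
    fix y z y' z' assume "adj y z" "adj y' z'"
    then obtain g g' where g: "g \<in> G" "g \<langle>$\<rangle> x = y" "g \<langle>$\<rangle> u = z" and g': "g' \<in> G" "g' \<langle>$\<rangle> x = y'" "g' \<langle>$\<rangle> u = z'"
      using to[OF \<open>adj y z\<close>] to[OF \<open>adj y' z'\<close>] by blast
    have "inverse g \<langle>$\<rangle> y = x" "inverse g \<langle>$\<rangle> z = u"
      using g by (auto simp: apply_inverse_iff)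
    then show "\<exists>g\<in>G. g \<langle>$\<rangle> y = y' \<and> g \<langle>$\<rangle> z = z'"
      using g g' mult_closed inverse_closed by (intro bexI[of _ "g' * inverse g"]) (auto simp: apply_times)
  qed
qed

section \<open>The digraph of vertices without arc-transitivity\<close>

definition rigid :: "'a \<Rightarrow> 'a \<Rightarrow> bool" where
  "rigid x y \<longleftrightarrow> adj x y \<and> (\<forall>g\<in>G. g \<langle>$\<rangle> x = x \<longrightarrow> g \<langle>$\<rangle> y = y)"

lemma rigid_act:
  assumes "g \<in> G" "rigid x y"
  shows "rigid (g \<langle>$\<rangle> x) (g \<langle>$\<rangle> y)"
  unfolding rigid_def
proof (intro conjI ballI impI)
  show "adj (g \<langle>$\<rangle> x) (g \<langle>$\<rangle> y)" using assms G_adj by (simp add: rigid_def)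
  fix h assume h: "h \<in> G" "h \<langle>$\<rangle> (g \<langle>$\<rangle> x) = g \<langle>$\<rangle> x"
  have "inverse g * h * g \<in> G" using assms h by (simp add: mult_closed inverse_closed)
  moreover have "(inverse g * h * g) \<langle>$\<rangle> x = x"
    using h by (simp add: apply_times)
  ultimately have "(inverse g * h * g) \<langle>$\<rangle> y = y" using assms by (simp add: rigid_def)
  then have "g \<langle>$\<rangle> ((inverse g * h * g) \<langle>$\<rangle> y) = g \<langle>$\<rangle> y" by simp
  then show "h \<langle>$\<rangle> (g \<langle>$\<rangle> y) = g \<langle>$\<rangle> y"
    by (simp add: apply_times)
qed

text \<open>The stabilizer of \<open>x\<close> is contained in that of \<open>y\<close>; by
  vertex-transitivity the two are conjugate, so they have the same finite order and are
  equal.\<close>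

lemma rigid_sym:
  assumes "rigid x y"
  shows "rigid y x"
proof -
  define St where "St z = {g \<in> G. g \<langle>$\<rangle> z = z}" for z
  have xy: "adj x y" "x \<in> V" "y \<in> V" using assms adj_V adj_V2 by (auto simp: rigid_def)
  obtain h where h: "h \<in> G" "h \<langle>$\<rangle> y = x" using G_transitive xy by blast
  have "(\<lambda>g. h * g * inverse h) ` St y \<subseteq> St x"
  proof -
    have "inverse h \<langle>$\<rangle> x = y" using h by (auto simp: apply_inverse_iff)
    then show ?thesis using h by (auto simp: St_def mult_closed inverse_closed apply_times)
  qed
  moreover have "inj_on (\<lambda>g. h * g * inverse h) (St y)"
    by (rule inj_onI) (simp only: conj_eq_iff)
  moreover have "finite (St x)" "finite (St y)" using finite_G by (simp_all add: St_def)
  ultimately have "card (St y) \<le> card (St x)" by (metis card_image card_mono)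
  moreover have "St x \<subseteq> St y" using assms by (auto simp: St_def rigid_def)
  ultimately have "St x = St y" using \<open>finite (St y)\<close> card_seteq by blast
  then show ?thesis using xy adj_sym by (auto simp: rigid_def St_def)
qed

text \<open>The stabilizer of \<open>x\<close> has orbits of sizes 2 and 1 on the neighbours:
  \<open>g\<close> moves one of them, and a single orbit would give arc-transitivity.\<close>

lemma rigid_unique:
  assumes "\<not> arc_transitive" "x \<in> V" "g \<in> G" "g \<langle>$\<rangle> x = x" "adj x u" "g \<langle>$\<rangle> u \<noteq> u"
  shows "\<exists>!y. rigid x y"
proof -
  let ?w = "g \<langle>$\<rangle> u"
  have "adj x ?w" using G_adj[OF assms(3), of x u] assms by simp
  then obtain r where r: "u \<noteq> r" "?w \<noteq> r" "\<And>y. adj x y \<longleftrightarrow> y = u \<or> y = ?w \<or> y = r"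
    by (rule third_nbr[OF assms(5) _ assms(6)[symmetric]]) blast
  have "rigid x r"
    unfolding rigid_def
  proof (intro conjI ballI impI)
    show "adj x r" using r by blast
    fix h assume h: "h \<in> G" "h \<langle>$\<rangle> x = x"
    show "h \<langle>$\<rangle> r = r"
    proof (rule ccontr)
      assume ne: "h \<langle>$\<rangle> r \<noteq> r"
      have inv: "inverse h \<in> G" "inverse h \<langle>$\<rangle> x = x"
        using h inverse_closed by (auto simp: apply_inverse_iff)
      have "adj x (inverse h \<langle>$\<rangle> r)" using G_adj[OF inv(1), of x r] inv r by simp
      moreover have "inverse h \<langle>$\<rangle> r \<noteq> r"
        using ne by (auto simp: apply_inverse_iff)
      ultimately have "inverse h \<langle>$\<rangle> r = u \<or> inverse h \<langle>$\<rangle> r = ?w" using r(3) by simp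
      then consider "h \<langle>$\<rangle> u = r" | "h \<langle>$\<rangle> ?w = r" unfolding apply_inverse_iff by metis
      then obtain k where k: "k \<in> G" "k \<langle>$\<rangle> x = x" "k \<langle>$\<rangle> u = r"
      proof cases
        case 2
        then show ?thesis
          using that[of "h * g"] h assms mult_closed by (simp add: apply_times)
      qed (use h that in blast)
      have "arc_transitive"
      proof (rule arc_transitiveI[OF assms(5)])
        show "\<exists>h\<in>G. h \<langle>$\<rangle> x = x \<and> h \<langle>$\<rangle> u = y" if "adj x y" for y
        proof -
          from that r(3) consider "y = u" | "y = ?w" | "y = r" by blast
          then show ?thesis
          proof cases
            case 1
            then show ?thesis by (intro bexI[of _ 1]) (simp_all add: one_closed)
          qed (use k assms(3,4) in blast)+
        qed
      qed
      then show False using assms by blast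
    qed
  qed
  moreover have "\<not> rigid x u" using assms by (auto simp: rigid_def)
  moreover have "\<not> rigid x ?w"
  proof
    assume "rigid x ?w"
    moreover have inv: "inverse g \<in> G" "inverse g \<langle>$\<rangle> x = x" "inverse g \<langle>$\<rangle> ?w = u"
      using assms inverse_closed by (auto simp: apply_inverse_iff)
    ultimately show False using assms(6) by (auto simp: rigid_def)
  qed
  moreover have "y = u \<or> y = ?w \<or> y = r" if "rigid x y" for y
    using that r(3) by (simp add: rigid_def)
  ultimately show ?thesis by blast
qed

definition mate :: "'a \<Rightarrow> 'a" where "mate x = (THE y. rigid x y)"

definition next_vertex :: "'a \<Rightarrow> 'a \<Rightarrow> bool" where
  "next_vertex x y \<longleftrightarrow> x \<in> V \<and> adj (mate x) y \<and> x \<noteq> y"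

text \<open>\<open>mate\<close> is an involution on the vertices commuting with \<open>G\<close>,
  because rigidity is symmetric and invariant. Hence the predecessors of \<open>x\<close> are the
  mates of its neighbours other than \<open>mate x\<close>, which bounds the in-valency just as the
  out-valency.\<close>

lemma mate_digraph:
  assumes "\<not> arc_transitive" and ex: "\<And>x. x \<in> V \<Longrightarrow> \<exists>!y. rigid x y"
    and "tau \<in> G" "next_vertex v0 (tau \<langle>$\<rangle> v0)"
  shows "two_valent_digraph G (\<langle>$\<rangle>) V next_vertex tau v0"
proof -
  have rigid: "rigid x (mate x)" if "x \<in> V" for x
    unfolding mate_def using theI'[OF ex[OF that]] .
  have mateI: "mate x = y" if "rigid x y" for x y
  proof -
    have "x \<in> V" using that adj_V[of x y] by (simp add: rigid_def)
    then show ?thesis unfolding mate_def using the1_equality[OF ex that] by blast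
  qed
  have adj_mate: "adj x (mate x)" if "x \<in> V" for x
    using rigid[OF that] by (simp add: rigid_def)
  have mate_V: "mate x \<in> V" if "x \<in> V" for x
    using adj_mate[OF that] adj_V2 by blast
  have mate_mate: "mate (mate x) = x" if "x \<in> V" for x
    using mateI[OF rigid_sym[OF rigid[OF that]]] .
  have mate_act: "mate (g \<langle>$\<rangle> x) = g \<langle>$\<rangle> (mate x)" if "g \<in> G" "x \<in> V" for g x
    using mateI[OF rigid_act[OF that(1) rigid[OF that(2)]]] .
  have next_V: "x \<in> V \<and> y \<in> V" if "next_vertex x y" for x y
    using that adj_V2[of "mate x" y] by (simp add: next_vertex_def)
  show ?thesis
  proof
    show "x \<in> V \<and> y \<in> V" if "next_vertex x y" for x y using next_V[OF that] .
    show "next_vertex (g \<langle>$\<rangle> x) (g \<langle>$\<rangle> y)" if "g \<in> G" "next_vertex x y" for g x y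
      using that G_V[OF that(1)] mate_act[OF that(1)] G_adj[OF that(1)] by (simp add: next_vertex_def apply_inj)
    show "y' = y''" if "next_vertex x y" "next_vertex x y'" "next_vertex x y''" "y \<noteq> y'" "y \<noteq> y''" for x y y' y''
    proof (rule adj_two)
      show "adj (mate x) x" using adj_mate next_V[OF that(1)] adj_sym by blast
    qed (use that in \<open>auto simp: next_vertex_def\<close>)
    show "y' = y''" if "next_vertex y x" "next_vertex y' x" "next_vertex y'' x" "y \<noteq> y'" "y \<noteq> y''" for x y y' y''
    proof -
      have V: "x \<in> V" "y \<in> V" "y' \<in> V" "y'' \<in> V" using next_V that by blast+
      have inj: "mate u = mate w \<longleftrightarrow> u = w" if "u \<in> V" "w \<in> V" for u w
        using mate_mate that by metis
      have ne: "mate u \<noteq> mate x" "adj x (mate u)" if "next_vertex u x" for u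
        using inj[of u x] next_V[OF that] that adj_sym by (auto simp: next_vertex_def)
      have "mate y' = mate y''"
        by (rule adj_two[OF adj_mate[OF V(1)], of "mate y"]) (use that ne inj V in auto)
      then show ?thesis using inj V by blast
    qed
    show "\<exists>g\<in>G. g \<langle>$\<rangle> x = y" if "x \<in> V" "y \<in> V" for x y using G_transitive that .
    show "g = 1" if g: "g \<in> G" and X: "X \<noteq> {}" "X \<subseteq> V"
      and iff: "\<And>x y. next_vertex x y \<Longrightarrow> x \<in> X \<longleftrightarrow> y \<in> X" and fixed: "\<And>x. x \<in> X \<Longrightarrow> g \<langle>$\<rangle> x = x" for g X
    proof (rule fix_all[OF g])
      show "X \<union> mate ` X \<subseteq> V" using X mate_V by auto
      show "X \<union> mate ` X \<noteq> {}" using X by simp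
      show "y \<in> X \<union> mate ` X" if "x \<in> X \<union> mate ` X" "adj x y" for x y
        using that(1)
      proof
        assume x: "x \<in> X"
        then have xV: "x \<in> V" and yV: "y \<in> V" using X adj_V2[OF that(2)] by auto
        show ?thesis
        proof (cases "y = mate x")
          case False
          then have "mate y \<noteq> x" using mate_mate[OF yV] by auto
          then have "next_vertex (mate y) x"
            using mate_mate[OF yV] mate_V[OF yV] adj_sym[OF that(2)] by (simp add: next_vertex_def)
          then have "mate y \<in> X" using iff x by blast
          then show ?thesis using mate_mate[OF yV] by force
        qed (use x in auto)
      next
        assume "x \<in> mate ` X"
        then obtain w where w: "w \<in> X" "x = mate w" by blast
        then show ?thesis using iff[of w y] that(2) X by (cases "w = y") (auto simp: next_vertex_def)
      qed
      show "g \<langle>$\<rangle> x = x" if "x \<in> X \<union> mate ` X" for x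
      proof -
        have "g \<langle>$\<rangle> (mate w) = mate w" if "w \<in> X" for w
          using mate_act[OF g, of w] fixed[OF that] that X by auto
        then show ?thesis using that fixed by auto
      qed
    qed
    show "tau \<in> G" "next_vertex v0 (tau \<langle>$\<rangle> v0)" by (fact assms)+
  qed (simp_all add: finite_V apply_times)
qed

text \<open>In the arc-transitive case, 2-power order ensures a fixed neighbour, hence a fixed
  vertex of the arc digraph. Otherwise mates exist as soon as one vertex stabilizer moves a
  neighbour; if none does, the fixed vertices of \<open>g\<close> are closed under adjacency and
  \<open>g = 1\<close>.\<close>

lemma stabilizer_two_power:
  assumes "g \<in> G" "g ^ (2 ^ c) = 1" "x \<in> V" "g \<langle>$\<rangle> x = x"
  shows "g ^ 4 = 1"
proof (cases arc_transitive)
  case True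
  obtain y where y: "adj x y" "g \<langle>$\<rangle> y = y" using two_power_fix_nbr[OF assms] .
  obtain z where z: "adj y z" "x \<noteq> z" by (rule other_nbrs[OF adj_sym[OF y(1)]]) blast
  obtain tau where tau: "tau \<in> G" "tau \<langle>$\<rangle> x = y" "tau \<langle>$\<rangle> y = z"
    using True y(1) z(1) unfolding arc_transitive_def by metis
  interpret two_valent_digraph G act_arc "{e. adj (fst e) (snd e)}" "next_arc adj" tau "(x, y)"
    by (rule arc_digraph[OF True tau(1)]) (use y z tau in \<open>simp add: next_arc_def act_arc_def\<close>)
  show ?thesis
    using stabilizer_power_4[of g "(x, y)"] assms y by (simp add: act_arc_def)
next
  case False
  show ?thesis
  proof (cases "\<exists>h\<in>G. \<exists>w\<in>V. h \<langle>$\<rangle> w = w \<and> (\<exists>u. adj w u \<and> h \<langle>$\<rangle> u \<noteq> u)")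
    case True
    then obtain h w u where h: "h \<in> G" "w \<in> V" "h \<langle>$\<rangle> w = w" "adj w u" "h \<langle>$\<rangle> u \<noteq> u" by blast
    have ex_w: "\<exists>!y. rigid w y" using rigid_unique[OF False h(2,1,3,4,5)] .
    have ex: "\<exists>!y. rigid z y" if "z \<in> V" for z
    proof -
      obtain k where k: "k \<in> G" "k \<langle>$\<rangle> w = z" using G_transitive[OF h(2) \<open>z \<in> V\<close>] by blast
      obtain y where y: "rigid w y" "\<And>y'. rigid w y' \<Longrightarrow> y' = y" using ex_w by blast
      show ?thesis
      proof (rule ex1I)
        show "rigid z (k \<langle>$\<rangle> y)" using rigid_act[OF k(1) y(1)] k by simp
        show "y' = k \<langle>$\<rangle> y" if "rigid z y'" for y'
        proof -
          have "inverse k \<langle>$\<rangle> z = w" using k by (auto simp: apply_inverse_iff)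
          then have "rigid w (inverse k \<langle>$\<rangle> y')"
            using rigid_act[OF inverse_closed[OF k(1)] that] by simp
          then show ?thesis using y(2) by (auto simp: apply_inverse_iff dest: sym)
        qed
      qed
    qed
    have "rigid x (mate x)" unfolding mate_def using theI'[OF ex[OF assms(3)]] .
    then have "adj (mate x) x" using adj_sym by (simp add: rigid_def)
    then obtain y where "adj (mate x) y" "x \<noteq> y" by (rule other_nbrs) blast
    then have y: "next_vertex x y" "y \<in> V" using adj_V2 assms(3) by (auto simp: next_vertex_def)
    then obtain tau where tau: "tau \<in> G" "tau \<langle>$\<rangle> x = y" using G_transitive assms(3) by blast
    interpret two_valent_digraph G "(\<langle>$\<rangle>)" V next_vertex tau x
      by (rule mate_digraph[OF False ex tau(1)]) (use y tau in auto)
    show ?thesis using stabilizer_power_4 assms by blast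
  next
    case False
    have "g = 1"
    proof (rule fix_all[OF assms(1)])
      let ?X = "{w \<in> V. g \<langle>$\<rangle> w = w}"
      show "?X \<subseteq> V" "?X \<noteq> {}" using assms by auto
      show "y \<in> ?X" if "w \<in> ?X" "adj w y" for w y
        using False assms(1) that adj_V2 by blast
    qed simp
    then show ?thesis by simp
  qed
qed

lemma stabilizer_power_12:
  assumes "g \<in> G" "0 < k" "g ^ k = 1" "x \<in> V" "g \<langle>$\<rangle> x = x"
  shows "g ^ 12 = 1"
proof (rule perm_eqI)
  obtain r m where k: "k = 2 ^ r * m" "odd m"
    using odd_part[OF assms(2)] by blast
  have fixp: "(g ^ i) \<langle>$\<rangle> x = x" for i
    by (induction i) (simp_all add: apply_times assms(5))
  have "(g ^ m) ^ (2 ^ r) = 1" "(g ^ (2 ^ r)) ^ m = 1"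
    using assms(3) by (simp_all add: k mult.commute flip: power_mult)
  then have "(g ^ m) ^ 4 = 1" "(g ^ (2 ^ r)) ^ 3 = 1"
    using stabilizer_two_power[OF power_closed[OF assms(1)] _ assms(4) fixp]
      odd_cube[OF power_closed[OF assms(1)] _ k(2) assms(4) fixp] by blast+
  then have p: "g ^ (m * 4) = 1" "g ^ (2 ^ r * 3) = 1" by (simp_all add: power_mult)
  fix y
  have "Perm.order g y dvd m * 4" "Perm.order g y dvd 2 ^ r * 3"
    using p by (simp_all flip: apply_power_eq_self_iff)
  then have "Perm.order g y dvd 12 * m" "Perm.order g y dvd 12 * 2 ^ r"
    using dvd_mult[of "Perm.order g y" "m * 4" 3] dvd_mult[of "Perm.order g y" "2 ^ r * 3" 4]
    by (simp_all add: mult.commute mult.left_commute)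
  then have "Perm.order g y dvd gcd (12 * m) (12 * 2 ^ r)" by simp
  moreover have "coprime m (2 ^ r)" using k(2) by simp
  ultimately have "Perm.order g y dvd 12" by (simp add: gcd_mult_left coprime_iff_gcd_eq_1)
  then show "(g ^ 12) \<langle>$\<rangle> y = 1 \<langle>$\<rangle> y" by (simp add: apply_power_eq_self_iff)
qed

end

section \<open>Arc-transitive graphs\<close>

locale arc_walk = cubic_vertex_transitive G V adj +
  D: two_valent_digraph G act_arc "{e. adj (fst e) (snd e)}" "next_arc adj" tau "(x0, tau \<langle>$\<rangle> x0)"
  for G :: "'a Perm.perm set" and V adj tau x0 +
  assumes arc_transitive: arc_transitive
begin

definition y :: "nat \<Rightarrow> 'a" where "y i = (tau ^ i) \<langle>$\<rangle> x0"

lemma v_eq: "D.v i = (y i, y (Suc i))"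
  by (simp add: D.v_def y_def act_arc_def power_Suc2 apply_times del: power_Suc)

lemma adj_y: "adj (y i) (y (Suc i))" "adj (y (Suc i)) (y i)"
  using D.v_D[of i] adj_sym by (simp_all add: v_eq)

lemma y_neq: "y i \<noteq> y (Suc (Suc i))"
  using D.E_v[of i] by (simp add: v_eq next_arc_def)

lemma y_V: "y i \<in> V" using adj_y adj_V by blast

text \<open>Vertices of the digraph are arcs of the graph, so the segment from \<open>p\<close> to
  \<open>q\<close> reaches one vertex further, to \<open>y (Suc q)\<close>.\<close>

lemma F_iff:
  assumes "p \<le> q"
  shows "g \<in> D.F p q \<longleftrightarrow> g \<in> G \<and> (\<forall>k. p \<le> k \<longrightarrow> k \<le> Suc q \<longrightarrow> g \<langle>$\<rangle> (y k) = y k)"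
proof -
  have "(\<forall>k. p \<le> k \<longrightarrow> k \<le> q \<longrightarrow> P k \<and> P (Suc k)) \<longleftrightarrow> (\<forall>k. p \<le> k \<longrightarrow> k \<le> Suc q \<longrightarrow> P k)" for P
    using assms by (metis le_SucE le_SucI not_less_eq_eq order_refl)
  from this[of "\<lambda>k. g \<langle>$\<rangle> (y k) = y k"] show ?thesis
    by (simp add: D.F_def v_eq act_arc_def)
qed

lemma F_arc: "g \<in> D.F p p \<longleftrightarrow> g \<in> G \<and> g \<langle>$\<rangle> (y p) = y p \<and> g \<langle>$\<rangle> (y (Suc p)) = y (Suc p)"
  by (auto simp: D.F_def v_eq act_arc_def dest: order.antisym)

lemma a_fix: "\<lbrakk>i < k; k \<le> Suc (i + D.n)\<rbrakk> \<Longrightarrow> 0 < D.n \<Longrightarrow> D.a i \<langle>$\<rangle> (y k) = y k"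
  using D.a_F[of i] F_iff[of "Suc i" "i + D.n"] by simp

lemma a_G: "D.a i \<in> G" using D.a_F D.F_G by blast

lemma a_move_left: "0 < D.n \<Longrightarrow> D.a i \<langle>$\<rangle> (y i) \<noteq> y i"
proof
  assume "0 < D.n" "D.a i \<langle>$\<rangle> (y i) = y i"
  then have "D.a i \<langle>$\<rangle> (y k) = y k" if "i \<le> k" "k \<le> Suc (i + D.n)" for k
    using a_fix[of i k] that by (cases "k = i") auto
  then have "D.a i \<in> D.F i (i + D.n)" using F_iff a_G by simp
  then show False using D.F_n D.a_not_1 \<open>0 < D.n\<close> by simp
qed

lemma a_move_right: "0 < D.n \<Longrightarrow> D.a i \<langle>$\<rangle> (y (Suc (Suc (i + D.n)))) \<noteq> y (Suc (Suc (i + D.n)))"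
proof
  let ?l = "Suc (Suc (i + D.n))"
  assume "0 < D.n" "D.a i \<langle>$\<rangle> (y ?l) = y ?l"
  then have "D.a i \<langle>$\<rangle> (y k) = y k" if "Suc i \<le> k" "k \<le> ?l" for k
    using a_fix[of i k] that by (cases "k = ?l") auto
  then have "D.a i \<in> D.F (Suc i) (Suc i + D.n)" using F_iff a_G by simp
  then show False using D.F_n[of "Suc i"] D.a_not_1 \<open>0 < D.n\<close> by simp
qed

text \<open>The stabilizer of \<open>y (Suc p)\<close> is generated by those of the two arcs of the
  walk at this vertex: \<open>D.a (p - D.n)\<close> fixes \<open>y p\<close> and moves
  \<open>y (Suc (Suc p))\<close>, \<open>D.a p\<close> does the opposite, and together they are
  transitive on the three neighbours.\<close>

lemma commute_center:
  assumes n: "0 < D.n" "D.n \<le> p"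
    and left: "\<And>h. h \<in> D.F p p \<Longrightarrow> t * h = h * t"
    and right: "\<And>h. h \<in> D.F (Suc p) (Suc p) \<Longrightarrow> t * h = h * t"
    and h: "h \<in> G" "h \<langle>$\<rangle> (y (Suc p)) = y (Suc p)"
  shows "t * h = h * t"
proof -
  let ?u = "y p" and ?c = "y (Suc p)" and ?w = "y (Suc (Suc p))"
  obtain w' where w': "?u \<noteq> w'" "?w \<noteq> w'" "\<And>z. adj ?c z \<longleftrightarrow> z = ?u \<or> z = ?w \<or> z = w'"
    by (rule third_nbr[of ?c ?u ?w]) (use adj_y y_neq in auto)
  have nbr: "adj ?c (g \<langle>$\<rangle> z) \<longleftrightarrow> adj ?c z" if "g \<in> G" "g \<langle>$\<rangle> ?c = ?c" for g z
    using G_adj[OF that(1), of ?c z] that(2) by simp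
  define f where "f = D.a (p - D.n)"
  have f: "f \<in> D.F p p" and fw: "f \<langle>$\<rangle> ?w \<noteq> ?w"
    using n a_fix[of "p - D.n"] a_move_right[of "p - D.n"] a_G by (auto simp: f_def F_arc)
  then have fG: "f \<in> G" "f \<langle>$\<rangle> ?u = ?u" "f \<langle>$\<rangle> ?c = ?c" by (simp_all add: F_arc)
  have fw: "f \<langle>$\<rangle> ?w = w'"
    using nbr[OF fG(1,3), of ?w] w' fw y_neq[of p] apply_inj[of f ?w ?u] fG(2) by auto
  have e: "D.a p \<in> D.F (Suc p) (Suc p)" and eu: "D.a p \<langle>$\<rangle> ?u \<noteq> ?u"
    using n a_fix[of p] a_move_left[of p] a_G by (auto simp: F_arc)
  then have eG: "D.a p \<in> G" "D.a p \<langle>$\<rangle> ?w = ?w" "D.a p \<langle>$\<rangle> ?c = ?c" by (simp_all add: F_arc)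
  have eu: "D.a p \<langle>$\<rangle> ?u = w'"
    using nbr[OF eG(1,3), of ?u] w' eu y_neq[of p] apply_inj[of "D.a p" ?w ?u] eG(2) by auto
  \<comment> \<open>Coset decomposition: it suffices to find \<open>k\<close> commuting with
    \<open>t\<close> that agrees with \<open>h\<close> at \<open>y p\<close>, since
    \<open>inverse k * h\<close> then lies in \<open>D.F p p\<close>.\<close>
  have dec: "t * h = h * t" if k: "k \<in> G" "k \<langle>$\<rangle> ?c = ?c" "k \<langle>$\<rangle> ?u = h \<langle>$\<rangle> ?u" "t * k = k * t" for k
  proof -
    have "inverse k * h \<in> D.F p p"
      using k h inverse_closed mult_closed by (auto simp: F_arc apply_times apply_inverse_iff)
    then have "t * (inverse k * h) = inverse k * h * t" by (rule left)
    note comm = this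
    have "t * h = t * k * (inverse k * h)" by (simp add: mult.assoc perm_cancel)
    also have "\<dots> = k * (t * (inverse k * h))" by (simp only: k(4) mult.assoc)
    also have "\<dots> = h * t" by (simp only: comm) (simp add: mult.assoc perm_cancel)
    finally show ?thesis .
  qed
  have "adj ?c (h \<langle>$\<rangle> ?u)" using nbr[OF h] adj_y by blast
  then consider "h \<langle>$\<rangle> ?u = ?u" | "h \<langle>$\<rangle> ?u = ?w" | "h \<langle>$\<rangle> ?u = w'" using w' by blast
  then show ?thesis
  proof cases
    case 1
    then show ?thesis using left h by (simp add: F_arc)
  next
    case 2
    have "inverse f \<in> D.F p p" using fG inverse_closed by (auto simp: F_arc apply_inverse_iff)
    moreover have "inverse f \<langle>$\<rangle> w' = ?w" using fw by (simp add: apply_inverse_iff)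
    ultimately show ?thesis
      using left right[OF e] eG eu 2 fG inverse_closed mult_closed
      by (intro dec[of "inverse f * D.a p"]) (auto simp: apply_times F_arc, metis mult.assoc)
  next
    case 3
    then show ?thesis using dec[of "D.a p"] eG eu right[OF e] by simp
  qed
qed

text \<open>The centralizer of \<open>t\<close> contains the stabilizers of both ends of an edge,
  and by arc-transitivity these carry the edge to every adjacent one. So the translates of
  \<open>c\<close> and \<open>d\<close> under the centralizer exhaust the vertices, and
  \<open>t\<close> fixes all of them.\<close>

lemma central_trivial:
  assumes "t \<in> G" "adj c d" "t \<langle>$\<rangle> c = c" "t \<langle>$\<rangle> d = d"
    and c: "\<And>h. \<lbrakk>h \<in> G; h \<langle>$\<rangle> c = c\<rbrakk> \<Longrightarrow> t * h = h * t"
    and d: "\<And>h. \<lbrakk>h \<in> G; h \<langle>$\<rangle> d = d\<rbrakk> \<Longrightarrow> t * h = h * t"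
  shows "t = 1"
proof (rule fix_all)
  define X where "X = {h \<langle>$\<rangle> e | h e. h \<in> G \<and> t * h = h * t \<and> (e = c \<or> e = d)}"
  have "1 \<langle>$\<rangle> c \<in> X" unfolding X_def using one_closed by fastforce
  then show "X \<noteq> {}" by blast
  show "X \<subseteq> V" using adj_V[OF assms(2)] adj_V2[OF assms(2)] G_V by (auto simp: X_def)
  show "t \<langle>$\<rangle> x = x" if x: "x \<in> X" for x
  proof -
    obtain h e where "x = h \<langle>$\<rangle> e" "t * h = h * t" "t \<langle>$\<rangle> e = e"
      using x assms(3,4) by (auto simp: X_def)
    then show ?thesis by (metis apply_sequence)
  qed
  show "z \<in> X" if x: "x \<in> X" and z: "adj x z" for x z
  proof -
    obtain h e where h: "x = h \<langle>$\<rangle> e" "h \<in> G" "t * h = h * t" "e = c \<or> e = d"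
      using x by (auto simp: X_def)
    obtain e' where e': "e' = c \<or> e' = d" "adj e e'" using h(4) assms(2) adj_sym by blast
    have "inverse h \<langle>$\<rangle> x = e" by (simp add: h(1))
    then have "adj e (inverse h \<langle>$\<rangle> z)"
      using G_adj[OF inverse_closed[OF h(2)], of x z] z by simp
    then obtain k where k: "k \<in> G" "k \<langle>$\<rangle> e = e" "k \<langle>$\<rangle> e' = inverse h \<langle>$\<rangle> z"
      using arc_transitive e'(2) unfolding arc_transitive_def by blast
    have "t * k = k * t" using c d k h(4) by blast
    then have "t * (h * k) = h * k * t" using h(3) by (metis mult.assoc)
    moreover have "z = (h * k) \<langle>$\<rangle> e'" using k(3) by (simp add: apply_times)
    ultimately show ?thesis using e'(1) k(1) h(2) mult_closed unfolding X_def by blast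
  qed
qed (fact assms(1))

text \<open>Otherwise \<open>D.a m\<close> is within distance less than \<open>D.lam\<close> of each
  of \<open>D.a 0, ..., D.a (D.n + 1)\<close>. These generate the stabilizers of three consecutive
  arcs, so by \<open>commute_center\<close> it centralizes the stabilizers of two adjacent vertices,
  both of which it fixes, and would be trivial.\<close>

lemma lam_upper_bound:
  assumes "D.lam < D.n"
  shows "D.lam \<le> D.n - D.lam + 2"
proof (rule ccontr)
  define m where "m = D.n - D.lam + 2"
  assume "\<not> ?thesis"
  then have m: "m < D.lam" "m + D.lam = D.n + 2" "0 < D.n" using assms by (auto simp: m_def)
  let ?t = "D.a m"
  have near: "?t * D.a r = D.a r * ?t" if "r \<le> D.n + 1" for r
    using D.a_near[of r m] D.a_near[of m r] that m by (cases r m rule: linorder_cases) auto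
  have F: "?t * h = h * ?t" if "h \<in> D.F (D.n + p) (D.n + p)" "p \<le> 2" for h p
    by (rule D.commute_F[of h "D.n + p" p]) (use that near in \<open>auto simp: add.commute\<close>)
  have "?t = 1"
  proof (rule central_trivial)
    show "?t \<in> G" by (rule a_G)
    show "adj (y (Suc D.n)) (y (Suc (Suc D.n)))" by (rule adj_y)
    show "?t \<langle>$\<rangle> (y (Suc D.n)) = y (Suc D.n)" "?t \<langle>$\<rangle> (y (Suc (Suc D.n))) = y (Suc (Suc D.n))"
      using a_fix[of m] m assms by auto
    show "?t * h = h * ?t" if "h \<in> G" "h \<langle>$\<rangle> (y (Suc D.n)) = y (Suc D.n)" for h
      by (rule commute_center[OF _ _ _ _ that]) (use m F[of _ 0] F[of _ 1] in auto)
    show "?t * h = h * ?t" if "h \<in> G" "h \<langle>$\<rangle> (y (Suc (Suc D.n))) = y (Suc (Suc D.n))" for h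
      by (rule commute_center[OF _ _ _ _ that]) (use m F[of _ 1] F[of _ 2] in \<open>auto simp: numeral_2_eq_2\<close>)
  qed
  then show False using D.a_not_1 m by simp
qed

section \<open>Elements acting trivially on the neighbours of a vertex\<close>

definition pointwise :: "'a Perm.perm \<Rightarrow> 'a \<Rightarrow> bool" where
  "pointwise h w \<longleftrightarrow> (\<forall>z. adj w z \<longrightarrow> h \<langle>$\<rangle> z = z)"

lemma pointwiseI:
  assumes "h \<in> G" "h \<langle>$\<rangle> w = w" "adj w p" "adj w q" "p \<noteq> q" "h \<langle>$\<rangle> p = p" "h \<langle>$\<rangle> q = q"
  shows "pointwise h w"
  unfolding pointwise_def using fix_nbrs[OF assms] by blast

lemma pointwise_conj:
  assumes "k \<in> G"
  shows "pointwise (k * h * inverse k) (k \<langle>$\<rangle> w) \<longleftrightarrow> pointwise h w"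
proof -
  have "(\<forall>z. adj (k \<langle>$\<rangle> w) z \<longrightarrow> P z) \<longleftrightarrow> (\<forall>z. adj w z \<longrightarrow> P (k \<langle>$\<rangle> z))" for P
    using G_adj[OF assms, of w] by (metis apply_inverse_cancel(2))
  then show ?thesis by (simp add: pointwise_def apply_times apply_inj)
qed

text \<open>Elements fixing \<open>w\<close> and its neighbour \<open>c\<close> act on the other two
  neighbours through a group of order at most 2.\<close>

lemma pointwise_mult:
  assumes "h \<in> G" "k \<in> G" "h \<langle>$\<rangle> w = w" "k \<langle>$\<rangle> w = w" "adj w c" "h \<langle>$\<rangle> c = c" "k \<langle>$\<rangle> c = c"
  shows "pointwise (h * k) w \<longleftrightarrow> (pointwise h w \<longleftrightarrow> pointwise k w)"
proof -
  obtain s s' where s: "c \<noteq> s" "c \<noteq> s'" "s \<noteq> s'" "\<And>z. adj w z \<longleftrightarrow> z = c \<or> z = s \<or> z = s'"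
    by (rule other_nbrs[OF assms(5)]) blast
  have iff: "pointwise g w \<longleftrightarrow> g \<langle>$\<rangle> s = s" if "g \<in> G" "g \<langle>$\<rangle> w = w" "g \<langle>$\<rangle> c = c" for g
    using pointwiseI[OF that(1,2), of c s] s that(3) by (auto simp: pointwise_def)
  have im: "g \<langle>$\<rangle> z = s \<or> g \<langle>$\<rangle> z = s'" if "g \<in> G" "g \<langle>$\<rangle> w = w" "g \<langle>$\<rangle> c = c" "z = s \<or> z = s'" for g z
  proof -
    have "adj w (g \<langle>$\<rangle> z)" using G_adj[OF that(1), of w z] that(2,4) s(4) by auto
    moreover have "g \<langle>$\<rangle> z \<noteq> c" using apply_inj[of g z c] that(3,4) s by auto
    ultimately show ?thesis using s(4) by blast
  qed
  have "h * k \<in> G" "(h * k) \<langle>$\<rangle> w = w" "(h * k) \<langle>$\<rangle> c = c"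
    using assms mult_closed by (simp_all add: apply_times)
  then have "pointwise (h * k) w \<longleftrightarrow> h \<langle>$\<rangle> (k \<langle>$\<rangle> s) = s" using iff by (simp add: apply_times)
  moreover have "h \<langle>$\<rangle> s = s \<or> h \<langle>$\<rangle> s = s'" "h \<langle>$\<rangle> s' = s \<or> h \<langle>$\<rangle> s' = s'" "k \<langle>$\<rangle> s = s \<or> k \<langle>$\<rangle> s = s'"
    using im[OF assms(1,3,6)] im[OF assms(2,4,7)] by blast+
  moreover have "h \<langle>$\<rangle> s \<noteq> h \<langle>$\<rangle> s'" using s by (simp add: apply_inj)
  ultimately show ?thesis using iff[OF assms(1,3,6)] iff[OF assms(2,4,7)] s(3) by metis
qed

lemma F_center:
  "h \<in> D.F p (Suc p) \<longleftrightarrow> h \<in> G \<and> h \<langle>$\<rangle> (y (Suc p)) = y (Suc p) \<and> pointwise h (y (Suc p))"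
proof
  assume "h \<in> D.F p (Suc p)"
  then have h: "h \<in> G" "h \<langle>$\<rangle> (y p) = y p" "h \<langle>$\<rangle> (y (Suc p)) = y (Suc p)"
      "h \<langle>$\<rangle> (y (Suc (Suc p))) = y (Suc (Suc p))"
    by (simp_all add: F_iff)
  then show "h \<in> G \<and> h \<langle>$\<rangle> (y (Suc p)) = y (Suc p) \<and> pointwise h (y (Suc p))"
    using pointwiseI[OF h(1,3), of "y p" "y (Suc (Suc p))"] adj_y y_neq by blast
next
  assume h: "h \<in> G \<and> h \<langle>$\<rangle> (y (Suc p)) = y (Suc p) \<and> pointwise h (y (Suc p))"
  then have "h \<langle>$\<rangle> (y p) = y p" "h \<langle>$\<rangle> (y (Suc (Suc p))) = y (Suc (Suc p))"
    using adj_y by (auto simp: pointwise_def)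
  then have "h \<langle>$\<rangle> (y k) = y k" if "p \<le> k" "k \<le> Suc (Suc p)" for k
    using h that by (auto simp: le_Suc_eq le_antisym)
  then show "h \<in> D.F p (Suc p)" using h by (simp add: F_iff)
qed

text \<open>The bounds on \<open>D.lam\<close> leave only the case corresponding to 7-arc-transitivity in Tutte's theorem.
  There the pointwise stabilizer \<open>D.F 5 8\<close> of \<open>y 5, \<dots>, y 9\<close> is the centre of \<open>D.F 6 7\<close>, the kernel of
  the action on the neighbours of \<open>y 7\<close>, and is thus invariant under the stabilizer of \<open>y 7\<close>.\<close>

lemma exceptional_case:
  assumes n: "D.n = 6" "D.lam = 4"
    and s: "s \<in> D.F 6 7" "s * s \<noteq> 1"
    and b: "b \<in> G" "b \<langle>$\<rangle> (y 7) = y 7" "b * s = s * b" "b \<langle>$\<rangle> (y 6) = y 8" "b \<langle>$\<rangle> (b \<langle>$\<rangle> (y 8)) = y 6"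
  shows False
proof -
  let ?c = "y 7"
  have K: "h \<in> D.F 6 7 \<longleftrightarrow> h \<in> G \<and> h \<langle>$\<rangle> ?c = ?c \<and> pointwise h ?c" for h
    using F_center[of h 6] by simp
  have K_conj: "k * h * inverse k \<in> D.F 6 7" if "k \<in> G" "k \<langle>$\<rangle> ?c = ?c" "h \<in> D.F 6 7" for k h
  proof -
    have "inverse k \<langle>$\<rangle> ?c = ?c" using that(2) by (simp add: apply_inverse_iff)
    then show ?thesis
      using that pointwise_conj[OF that(1), of h ?c] by (simp add: K apply_times mult_closed inverse_closed)
  qed
  have N_sub: "D.F 5 8 \<subseteq> D.F 6 7" by (rule D.F_mono) auto
  have aK: "D.a r \<in> D.F 6 7" if "1 \<le> r" "r \<le> 5" for r
    using D.a_F[of r] D.F_mono[of "Suc r" 6 7 "r + D.n"] that n by auto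
  \<comment> \<open>\<open>D.F 6 7\<close> corresponds to \<open>a 1, ..., a 5\<close>, where
    \<open>D.lam = 4\<close> leaves \<open>a 1\<close>, \<open>a 5\<close> as the only noncommuting
    pair; \<open>D.F 5 8\<close> corresponds to \<open>a 2\<close>, \<open>a 3\<close>,
    \<open>a 4\<close>.\<close>
  have center: "h \<in> D.F 5 8 \<longleftrightarrow> (\<forall>k \<in> D.F 6 7. h * k = k * h)" if hK: "h \<in> D.F 6 7" for h
  proof
    assume h: "h \<in> D.F 5 8"
    have "D.a r * h = h * D.a r" if "1 \<le> r" "r < 6" for r
    proof (rule D.commute_F[of h 5 2])
      show "D.a r * D.a l = D.a l * D.a r" if "2 \<le> l" "l < 5" for l
        using D.a_near[of r l] D.a_near[of l r] n that \<open>1 \<le> r\<close> \<open>r < 6\<close>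
        by (cases r l rule: linorder_cases) auto
    qed (use h n in auto)
    then show "\<forall>k \<in> D.F 6 7. h * k = k * h"
      using D.commute_F[of _ 6 1 h] n by simp
  next
    assume *: "\<forall>k \<in> D.F 6 7. h * k = k * h"
    have "h \<in> D.F 6 (1 + D.n)" using hK n by simp
    then have "h \<in> D.F 6 (2 + D.n)"
      by (rule D.trim_left_F) (use n * aK in auto)
    then have "h \<in> D.F 5 (2 + D.n)"
      by (rule D.trim_right_F) (use n * aK in auto)
    then show "h \<in> D.F 5 8" using n by simp
  qed
  have N_conj: "k * h * inverse k \<in> D.F 5 8" if k: "k \<in> G" "k \<langle>$\<rangle> ?c = ?c" and h: "h \<in> D.F 5 8" for k h
  proof -
    have hK: "h \<in> D.F 6 7" using h N_sub by blast
    have "k * h * inverse k * l = l * (k * h * inverse k)" if l: "l \<in> D.F 6 7" for l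
    proof -
      have "inverse k * l * k \<in> D.F 6 7"
        using K_conj[of "inverse k" l] k l inverse_closed by (simp add: apply_inverse_iff)
      then have "h * (inverse k * l * k) = inverse k * l * k * h" using center[OF hK] h by blast
      then have "k * (h * (inverse k * l * k)) * inverse k = k * (inverse k * l * k * h) * inverse k" by simp
      then show ?thesis by (simp add: mult.assoc perm_cancel)
    qed
    then show ?thesis using center[OF K_conj[OF k hK]] by blast
  qed
  define u where "u = b \<langle>$\<rangle> (y 8)"
  have bu: "b \<langle>$\<rangle> u = y 6" using b(5) by (simp add: u_def)
  have inv_b: "inverse b \<in> G" "inverse b \<langle>$\<rangle> ?c = ?c" "inverse b \<langle>$\<rangle> (y 8) = y 6" "inverse b \<langle>$\<rangle> u = y 8"
    "inverse b \<langle>$\<rangle> (y 6) = u"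
    using b bu inverse_closed by (simp_all add: apply_inverse_iff u_def)
  have adj_c: "adj ?c (y 6)" "adj ?c (y 8)" "adj ?c u"
  proof -
    show *: "adj ?c (y 6)" "adj ?c (y 8)" using adj_y(2)[of 6] adj_y(1)[of 7] by simp_all
    show "adj ?c u" using G_adj[OF b(1), of ?c "y 8"] b(2) *(2) by (simp add: u_def)
  qed
  have N: "h \<in> D.F 5 8 \<longleftrightarrow> pointwise h (y 6) \<and> pointwise h (y 8)" if h: "h \<in> D.F 6 7" for h
  proof
    assume "h \<in> D.F 5 8"
    then have hG: "h \<in> G" and hfix: "\<And>k. \<lbrakk>5 \<le> k; k \<le> 9\<rbrakk> \<Longrightarrow> h \<langle>$\<rangle> (y k) = y k"
      by (simp_all add: F_iff)
    have "pointwise h (y 6)"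
      by (rule pointwiseI[of h "y 6" "y 5" "y 7"])
         (use hG hfix adj_y(1)[of 6] adj_y(2)[of 5] y_neq[of 5] in simp_all)
    moreover have "pointwise h (y 8)"
      by (rule pointwiseI[of h "y 8" "y 7" "y 9"])
         (use hG hfix adj_y(1)[of 8] adj_y(2)[of 7] y_neq[of 7] in simp_all)
    ultimately show "pointwise h (y 6) \<and> pointwise h (y 8)" by blast
  next
    assume *: "pointwise h (y 6) \<and> pointwise h (y 8)"
    have "h \<langle>$\<rangle> (y 5) = y 5" "h \<langle>$\<rangle> (y 9) = y 9"
      using * adj_y(2)[of 5] adj_y(1)[of 8] by (auto simp: pointwise_def)
    have "h \<langle>$\<rangle> (y k) = y k" if k: "5 \<le> k" "k \<le> 9" for k
    proof -
      from k consider "k = 5" | "k = 9" | "6 \<le> k \<and> k \<le> 8" by linarith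
      then show ?thesis
        using \<open>h \<langle>$\<rangle> (y 5) = y 5\<close> \<open>h \<langle>$\<rangle> (y 9) = y 9\<close> h by cases (simp_all add: F_iff)
    qed
    then show "h \<in> D.F 5 8" using D.F_G[OF h] by (simp add: F_iff)
  qed
  have third: "pointwise h u" if h: "h \<in> D.F 5 8" for h
  proof -
    have "inverse b * h * b \<in> D.F 5 8" using N_conj[OF inv_b(1,2) h] by simp
    then have "pointwise (inverse b * h * b) (y 8)" using N N_sub by blast
    then show ?thesis using pointwise_conj[OF b(1), of "inverse b * h * b" "y 8"]
      by (simp add: u_def mult.assoc perm_cancel)
  qed
  \<comment> \<open>As \<open>b\<close> permutes \<open>y 6\<close>, \<open>y 8\<close>,
    \<open>u\<close> cyclically and normalizes \<open>D.F 6 7\<close>, the implication from two of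
    the three conditions to the third can be rotated.\<close>
  have two_01: "pointwise h u" if "h \<in> D.F 6 7" "pointwise h (y 6)" "pointwise h (y 8)" for h
    using third N that by blast
  have two_12: "pointwise h (y 6)" if h: "h \<in> D.F 6 7" "pointwise h (y 8)" "pointwise h u" for h
  proof -
    have "inverse b * h * b \<in> D.F 6 7" using K_conj[OF inv_b(1,2) h(1)] by simp
    moreover have "pointwise (inverse b * h * b) (y 6)" "pointwise (inverse b * h * b) (y 8)"
      using pointwise_conj[OF inv_b(1), of h] inv_b h by (metis perm.inverse_inverse)+
    ultimately have "pointwise (inverse b * h * b) u" by (rule two_01)
    then show ?thesis using pointwise_conj[OF b(1), of "inverse b * h * b" u] bu
      by (simp add: mult.assoc perm_cancel)
  qed
  have two_02: "pointwise h (y 8)" if h: "h \<in> D.F 6 7" "pointwise h (y 6)" "pointwise h u" for h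
  proof -
    have "b * h * inverse b \<in> D.F 6 7" using K_conj[OF b(1,2) h(1)] .
    moreover have "pointwise (b * h * inverse b) (y 8)" "pointwise (b * h * inverse b) (y 6)"
      using pointwise_conj[OF b(1), of h] b bu h by metis+
    ultimately have "pointwise (b * h * inverse b) u" using two_01 by blast
    then show ?thesis using pointwise_conj[OF b(1), of h "y 8"] by (simp add: u_def)
  qed
  have s_b: "b * s * inverse b = s" using b(3) by (simp add: mult.assoc)
  have s_iff: "pointwise s (y 8) \<longleftrightarrow> pointwise s (y 6)" "pointwise s u \<longleftrightarrow> pointwise s (y 8)"
    using pointwise_conj[OF b(1), of s "y 6"] pointwise_conj[OF b(1), of s "y 8"] b(4)
    by (simp_all add: s_b u_def)
  \<comment> \<open>Since \<open>s\<close> commutes with \<open>b\<close>, it satisfies all three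
    conditions or none; if all, it would lie in the elementary abelian group
    \<open>D.F 5 8\<close>.\<close>
  have s6: "\<not> pointwise s (y 6)"
  proof
    assume "pointwise s (y 6)"
    then have "s \<in> D.F 5 (2 + D.n)" using N s(1) s_iff n by simp
    then have "s * s = 1" by (rule D.square_F) (use n in auto)
    then show False using s(2) by blast
  qed
  \<comment> \<open>\<open>D.a 1\<close> satisfies the condition at \<open>y 6\<close> but not at
    \<open>y 8\<close>, hence not at \<open>u\<close>. Multiplying by \<open>s\<close>, which
    violates all three, flips every answer, so \<open>s * e\<close> satisfies exactly two
    conditions.\<close>
  define e where "e = D.a 1"
  have eK: "e \<in> D.F 6 7" using aK[of 1] by (simp add: e_def)
  have e6: "pointwise e (y 6)"
    by (rule pointwiseI[of e "y 6" "y 5" "y 7"])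
       (use a_G a_fix[of 1] adj_y(1)[of 6] adj_y(2)[of 5] y_neq[of 5] n in \<open>auto simp: e_def\<close>)
  have e8: "\<not> pointwise e (y 8)"
    using a_move_right[of 1] n adj_y(1)[of 8] by (auto simp: e_def pointwise_def)
  have eu: "\<not> pointwise e u" using two_02[OF eK e6] e8 by blast
  have mult: "pointwise (s * e) w \<longleftrightarrow> (pointwise s w \<longleftrightarrow> pointwise e w)" if "adj ?c w" for w
    by (rule pointwise_mult[of s e w ?c])
       (use s(1) eK that adj_sym in \<open>auto simp: K pointwise_def\<close>)
  have "s * e \<in> D.F 6 7" using D.F_mult s(1) eK by blast
  moreover have "pointwise (s * e) (y 8)" "pointwise (s * e) u" "\<not> pointwise (s * e) (y 6)"
    using mult adj_c s_iff s6 e6 e8 eu by simp_all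
  ultimately show False using two_12 by blast
qed

text \<open>A neighbour fixed by \<open>s\<close> stays fixed when rotated by \<open>b\<close>, so
  \<open>s\<close> acts trivially on the neighbours. This places \<open>s\<close> in a smaller group
  of the chain and makes its square central enough for the bounds on \<open>D.lam\<close> to
  collide.\<close>

lemma commuting_order_4_order_3:
  assumes s: "s \<in> G" "s \<langle>$\<rangle> (y (Suc D.n)) = y (Suc D.n)" "s ^ 4 = 1" "s * s \<noteq> 1"
    and b: "b \<in> G" "b \<langle>$\<rangle> (y (Suc D.n)) = y (Suc D.n)" "b ^ 3 = 1" "b * s = s * b"
    and move: "\<forall>z. adj (y (Suc D.n)) z \<longrightarrow> b \<langle>$\<rangle> z \<noteq> z"
  shows False
proof -
  let ?c = "y (Suc D.n)"
  have sb: "s \<langle>$\<rangle> (b \<langle>$\<rangle> z) = b \<langle>$\<rangle> (s \<langle>$\<rangle> z)" for z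
    using b(4) by (metis apply_sequence)
  have nbr: "adj ?c (b \<langle>$\<rangle> z) \<longleftrightarrow> adj ?c z" for z using G_adj[OF b(1), of ?c z] b(2) by simp
  obtain w where w: "adj ?c w" "s \<langle>$\<rangle> w = w"
    using two_power_fix_nbr[of s 2 ?c] s y_V by auto
  have "pointwise s ?c"
    by (rule pointwiseI[of s ?c w "b \<langle>$\<rangle> w"]) (use s w nbr move sb in auto)
  then have sF: "s \<in> D.F D.n (1 + D.n)" using F_center s by simp
  then have sP: "s \<in> D.F D.n (0 + D.n)" using D.F_mono[of D.n D.n D.n "1 + D.n"] by auto
  have "D.n \<noteq> 0"
  proof
    assume "D.n = 0"
    then have "s = 1" using sP D.F_n[of 0] by simp
    then show False using s(4) by simp
  qed
  then have n: "0 < D.n" by simp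
  have lam: "D.lam < D.n"
  proof (rule ccontr)
    assume "\<not> D.lam < D.n"
    then have "s * s = 1" using D.square_F[OF sP] by simp
    then show False using s(4) by blast
  qed
  let ?z = "s * s"
  have za: "?z * D.a r = D.a r * ?z" if "r < D.n" for r
    using D.square_central_F that sP by simp
  have zP: "?z * h = h * ?z" if "h \<in> D.F D.n D.n" for h
    by (rule D.commute_F[of h D.n 0]) (use that za in auto)
  have zb: "?z * b = b * ?z" using b(4) by (metis mult.assoc)
  \<comment> \<open>\<open>1\<close>, \<open>b\<close>, \<open>b * b\<close> represent the cosets of
    the arc stabilizer \<open>D.F D.n D.n\<close> in the stabilizer of \<open>?c\<close>, and
    \<open>?z\<close> commutes with all of these.\<close>
  have z_center: "?z * h = h * ?z" if h: "h \<in> G" "h \<langle>$\<rangle> ?c = ?c" for h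
  proof -
    have "adj ?c (h \<langle>$\<rangle> (y D.n))" using G_adj[OF h(1), of ?c "y D.n"] h(2) adj_y(2)[of D.n] by simp
    then have "h \<langle>$\<rangle> (y D.n) = y D.n \<or> h \<langle>$\<rangle> (y D.n) = b \<langle>$\<rangle> (y D.n)
        \<or> h \<langle>$\<rangle> (y D.n) = b \<langle>$\<rangle> (b \<langle>$\<rangle> (y D.n))"
      by (rule rotates_orbit[OF b(1,2) move adj_y(2)])
    then obtain k where k: "k = 1 \<or> k = b \<or> k = b * b" "h \<langle>$\<rangle> (y D.n) = k \<langle>$\<rangle> (y D.n)"
      using that[of 1] that[of b] that[of "b * b"] by (auto simp: apply_times)
    have kG: "k \<in> G" "k \<langle>$\<rangle> ?c = ?c" using k(1) b one_closed mult_closed by (auto simp: apply_times)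
    have kz: "?z * k = k * ?z" using k(1) zb by (elim disjE) (simp_all, metis mult.assoc)
    have "inverse k * h \<in> D.F D.n D.n"
      using k(2) kG h inverse_closed mult_closed by (auto simp: F_arc apply_times apply_inverse_iff)
    note comm = zP[OF this]
    have "?z * h = ?z * k * (inverse k * h)" by (simp add: mult.assoc perm_cancel)
    also have "\<dots> = k * ?z * (inverse k * h)" by (simp only: kz)
    also have "\<dots> = k * (?z * (inverse k * h))" by (simp only: mult.assoc)
    also have "\<dots> = h * ?z" by (simp only: comm) (simp add: mult.assoc perm_cancel)
    finally show ?thesis .
  qed
  \<comment> \<open>The gain over \<open>square_central_F\<close> is that \<open>?z\<close> also
    commutes with \<open>D.a D.n\<close>, which fixes \<open>?c\<close> but lies outside the arc
    stabilizer.\<close>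
  have "D.n - D.lam + 1 < D.lam"
  proof (rule D.central_lower_bound[OF _ s(4) lam])
    show "?z \<in> D.F D.n (1 + D.n)" using D.F_mult[OF sF sF] .
    show "?z * D.a r = D.a r * ?z" if "r \<le> D.n" for r
    proof (cases "r = D.n")
      case True
      then show ?thesis using z_center[OF a_G] a_fix[of D.n "Suc D.n"] n by simp
    qed (use za that in simp)
  qed
  moreover have "2 * (D.n - D.lam) \<le> D.lam" using D.lam_lower_bound lam by blast
  moreover have "D.lam \<le> D.n - D.lam + 2" using lam_upper_bound lam by blast
  \<comment> \<open>\<open>s\<close> lies in the group of \<open>a 1, ..., a (D.n - 1)\<close>; if
    these were at most \<open>D.lam\<close> many, its square would be 1.\<close>
  moreover have "1 < D.n - D.lam"
  proof (rule ccontr)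
    assume "\<not> 1 < D.n - D.lam"
    then have "s * s = 1" using D.square_F[OF sF] n by simp
    then show False using s(4) by blast
  qed
  ultimately have n6: "D.n = 6" and lam4: "D.lam = 4" by linarith+
  have sF: "s \<in> D.F 6 7" using sF n6 by simp
  have "?c = y 7" by (simp add: n6)
  note orbit = rotates_orbit[OF b(1,2) move, unfolded this]
  have y678: "adj (y 7) (y 6)" "adj (y 7) (y 8)" "y 6 \<noteq> y 8"
    using adj_y(2)[of 6] adj_y(1)[of 7] y_neq[of 6] by simp_all
  have "b \<langle>$\<rangle> (y 6) = y 8 \<or> b \<langle>$\<rangle> (b \<langle>$\<rangle> (y 6)) = y 8"
    using orbit(1)[OF y678(1,2)] y678(3) by auto
  moreover have cyc: "b \<langle>$\<rangle> (b \<langle>$\<rangle> (b \<langle>$\<rangle> (y 6))) = y 6" "b \<langle>$\<rangle> (b \<langle>$\<rangle> (b \<langle>$\<rangle> (y 8))) = y 8"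
    using orbit(2)[OF y678(1)] orbit(2)[OF y678(2)] by blast+
  ultimately consider "b \<langle>$\<rangle> (y 6) = y 8" "b \<langle>$\<rangle> (b \<langle>$\<rangle> (y 8)) = y 6"
    | "b \<langle>$\<rangle> (b \<langle>$\<rangle> (y 6)) = y 8" "b \<langle>$\<rangle> (b \<langle>$\<rangle> (b \<langle>$\<rangle> (b \<langle>$\<rangle> (y 8)))) = y 6"
    by metis
  then show False
  proof cases
    case 1
    show False
      by (rule exceptional_case[OF n6 lam4 sF s(4) b(1)]) (use b 1 n6 in auto)
  next
    \<comment> \<open>Here \<open>b\<close> rotates the neighbours in the other direction, so its
      inverse \<open>b * b\<close> takes its place.\<close>
    case 2
    have "b * b * s = s * (b * b)" using b(4) by (metis mult.assoc)
    then show False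
      by (rule exceptional_case[OF n6 lam4 sF s(4) mult_closed[OF b(1) b(1)], rotated])
        (use b 2 n6 in \<open>auto simp: apply_times\<close>)
  qed
qed

end

context cubic_vertex_transitive
begin

text \<open>Otherwise \<open>g ^ 3\<close> and \<open>g ^ 4\<close> are commuting elements of orders
  4 and 3 fixing \<open>x\<close>. The second rotates the neighbours of \<open>x\<close>, which
  makes the graph arc-transitive, and conjugation moves \<open>x\<close> to the vertex of the walk
  treated before.\<close>

lemma stabilizer_no_order_12:
  assumes g: "g \<in> G" "g ^ 12 = 1" "g ^ 6 \<noteq> 1" and x: "x \<in> V" "g \<langle>$\<rangle> x = x"
  shows "g ^ 4 = 1"
proof (rule ccontr)
  assume b_1: "g ^ 4 \<noteq> 1"
  define s b where "s = g ^ 3" and "b = g ^ 4"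
  have fixp: "(g ^ i) \<langle>$\<rangle> x = x" for i
    by (induction i) (simp_all add: apply_times x)
  have sb: "s \<in> G" "b \<in> G" "s \<langle>$\<rangle> x = x" "b \<langle>$\<rangle> x = x"
    using power_closed g(1) fixp by (simp_all add: s_def b_def)
  have pw: "s ^ 4 = 1" "b ^ 3 = 1" "s * s \<noteq> 1" "b * s = s * b"
    using g by (simp_all add: s_def b_def flip: power_mult power_add)
  have move: "\<forall>z. adj x z \<longrightarrow> b \<langle>$\<rangle> z \<noteq> z"
    using odd_fix_arc[of b 3 x] sb pw b_1 by (auto simp: b_def)
  obtain x1 where x1: "adj x x1" using nbrs[OF x(1)] by metis
  have arc: arc_transitive
  proof (rule arc_transitiveI[OF x1])
    show "\<exists>h\<in>G. h \<langle>$\<rangle> x = x \<and> h \<langle>$\<rangle> x1 = w" if "adj x w" for w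
    proof -
      have "w = 1 \<langle>$\<rangle> x1 \<or> w = b \<langle>$\<rangle> x1 \<or> w = (b * b) \<langle>$\<rangle> x1"
        using rotates_orbit(1)[OF sb(2,4) move x1 that] by (simp add: apply_times)
      moreover have "1 \<langle>$\<rangle> x = x" "(b * b) \<langle>$\<rangle> x = x" using sb by (simp_all add: apply_times)
      ultimately show ?thesis using sb(2,4) one_closed mult_closed by metis
    qed
  qed
  obtain x2 where x2: "adj x1 x2" "x \<noteq> x2" by (rule other_nbrs[OF adj_sym[OF x1]]) blast
  obtain tau where tau: "tau \<in> G" "tau \<langle>$\<rangle> x = x1" "tau \<langle>$\<rangle> x1 = x2"
    using arc x1 x2 unfolding arc_transitive_def by metis
  interpret D: two_valent_digraph G act_arc "{e. adj (fst e) (snd e)}" "next_arc adj" tau "(x, tau \<langle>$\<rangle> x)"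
    by (rule arc_digraph[OF arc tau(1)]) (use x1 x2 tau in \<open>simp add: next_arc_def act_arc_def\<close>)
  interpret W: arc_walk G V adj tau x
    by unfold_locales (rule arc)
  let ?c = "W.y (Suc D.n)"
  obtain h where h: "h \<in> G" "h \<langle>$\<rangle> x = ?c" using G_transitive[OF x(1) W.y_V] by blast
  then have inv: "inverse h \<langle>$\<rangle> ?c = x" by (simp add: apply_inverse_iff)
  have hk: "h * k * inverse h \<in> G" "(h * k * inverse h) \<langle>$\<rangle> ?c = ?c" if "k \<in> G" "k \<langle>$\<rangle> x = x" for k
    using that h inv by (simp_all add: mult_closed inverse_closed apply_times)
  have conj_mult: "h * k * inverse h * (h * l * inverse h) = h * (k * l) * inverse h" for k l
    by (simp add: mult.assoc perm_cancel)
  have conj_1: "h * k * inverse h = 1 \<longleftrightarrow> k = 1" for k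
    using conj_eq_iff[of h k 1] by simp
  show False
  proof (rule W.commuting_order_4_order_3[OF hk[OF sb(1,3)] _ _ hk[OF sb(2,4)]])
    show "(h * s * inverse h) ^ 4 = 1" "(h * b * inverse h) ^ 3 = 1"
      by (simp_all add: conj_power pw)
    show "h * s * inverse h * (h * s * inverse h) \<noteq> 1"
      unfolding conj_mult conj_1 by (rule pw)
    show "h * b * inverse h * (h * s * inverse h) = h * s * inverse h * (h * b * inverse h)"
      unfolding conj_mult pw(4) ..
    show "\<forall>z. adj ?c z \<longrightarrow> (h * b * inverse h) \<langle>$\<rangle> z \<noteq> z"
    proof (intro allI impI notI)
      fix z assume that: "adj ?c z"
      assume "(h * b * inverse h) \<langle>$\<rangle> z = z"
      then have "inverse h \<langle>$\<rangle> z = b \<langle>$\<rangle> (inverse h \<langle>$\<rangle> z)"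
        by (simp add: apply_times apply_inverse_iff)
      moreover have "adj x (inverse h \<langle>$\<rangle> z)"
        using G_adj[OF inverse_closed[OF h(1)], of ?c z] inv that by simp
      ultimately show False using move by metis
    qed
  qed
qed

end

section \<open>Regular orbits\<close>

context cubic_vertex_transitive
begin

lemma power_period:
  assumes "\<And>m. p ^ m = 1 \<longleftrightarrow> N dvd m"
  shows "Perm.order p x dvd N"
  using assms[of N] by (simp flip: apply_power_eq_self_iff)

text \<open>With \<open>d\<close> the orbit length of \<open>x\<close>, the power
  \<open>p ^ d\<close> fixes \<open>x\<close> and has order \<open>k = N div d\<close>, which
  divides 12 and differs from 12.\<close>

lemma orbit_ratio:
  assumes p: "p \<in> G" and N: "0 < N" "\<And>m. p ^ m = 1 \<longleftrightarrow> N dvd m" and x: "x \<in> V"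
  shows "\<exists>k\<in>{1, 2, 3, 4, 6}. N = Perm.order p x * k"
proof -
  define d where "d = Perm.order p x"
  obtain k where k: "N = d * k" using power_period[OF N(2)] unfolding d_def by (rule dvdE)
  then have pos: "0 < d" "0 < k" using N(1) by simp_all
  let ?q = "p ^ d"
  have q1: "?q ^ m = 1 \<longleftrightarrow> k dvd m" for m
    using N(2)[of "d * m"] pos(1) by (simp add: k power_mult)
  have q: "?q \<in> G" "?q \<langle>$\<rangle> x = x" using power_closed p by (simp_all add: d_def)
  have "?q ^ k = 1" using q1[of k] by simp
  from stabilizer_power_12[OF q(1) pos(2) this x q(2)] have "?q ^ 12 = 1" .
  then have "k dvd 12" using q1[of 12] by simp
  moreover have "k \<noteq> 12"
  proof
    assume "k = 12"
    then have "?q ^ 6 \<noteq> 1" "?q ^ 4 \<noteq> 1" using q1[of 6] q1[of 4] by simp_all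
    then show False using stabilizer_no_order_12[OF q(1) \<open>?q ^ 12 = 1\<close> _ x q(2)] by simp
  qed
  moreover have "k \<le> 12" using \<open>k dvd 12\<close> by (rule dvd_imp_le) simp
  ultimately have "k \<in> {1, 2, 3, 4, 6}"
  proof -
    have "k \<noteq> 5" "k \<noteq> 7" "k \<noteq> 8" "k \<noteq> 9" "k \<noteq> 10" "k \<noteq> 11" using \<open>k dvd 12\<close> by auto
    then show ?thesis using \<open>k \<le> 12\<close> \<open>k \<noteq> 12\<close> pos(2) unfolding insert_iff empty_iff by presburger
  qed
  then show ?thesis using k d_def by blast
qed

text \<open>That any two neighbours of a vertex have a further common neighbour is invariant under
  \<open>G\<close>, so it passes from one vertex to all.\<close>

lemma rectangle_at:
  assumes "z \<in> V" "z' \<in> V"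
    and "\<And>p q. \<lbrakk>adj z p; adj z q; p \<noteq> q\<rbrakk> \<Longrightarrow> \<exists>w. w \<noteq> z \<and> adj w p \<and> adj w q"
    and "adj z' p" "adj z' q" "p \<noteq> q"
  shows "\<exists>w. w \<noteq> z' \<and> adj w p \<and> adj w q"
proof -
  obtain g where g: "g \<in> G" "g \<langle>$\<rangle> z' = z" using G_transitive assms(1,2) by blast
  have "adj z (g \<langle>$\<rangle> p)" "adj z (g \<langle>$\<rangle> q)" "g \<langle>$\<rangle> p \<noteq> g \<langle>$\<rangle> q"
    using assms(4-6) G_adj[OF g(1), of z'] g(2) by (simp_all add: apply_inj)
  then obtain w where w: "w \<noteq> z" "adj w (g \<langle>$\<rangle> p)" "adj w (g \<langle>$\<rangle> q)" using assms(3) by blast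
  let ?w = "inverse g \<langle>$\<rangle> w"
  have "?w \<noteq> z'" using w(1) g(2) by (auto simp: apply_inverse_iff)
  moreover have "adj ?w p" "adj ?w q"
    using w G_adj[OF g(1), of ?w] by simp_all
  ultimately show ?thesis by blast
qed

text \<open>A vertex \<open>v\<close> moved by \<open>a\<close> is fixed by \<open>b\<close>, so its
  neighbours are moved by \<open>b\<close> and fixed by \<open>a\<close>; hence \<open>v\<close> and
  \<open>a v\<close> share all three neighbours. Transferred by \<open>rectangle_at\<close> to a
  neighbour \<open>u\<close> of \<open>v\<close>, this gives \<open>v\<close> and the third
  neighbour \<open>w\<close> of \<open>u\<close> a second common neighbour. That forces
  \<open>b\<close> to fix \<open>w\<close>, so all neighbours of \<open>v\<close> have the same
  neighbours.\<close>

lemma K33_if_cover: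
  assumes a: "a \<in> G" "a \<noteq> 1" and b: "b \<in> G" "b \<noteq> 1" "b ^ 3 = 1" and ab: "a * b = b * a"
    and cover: "\<And>x. x \<in> V \<Longrightarrow> a \<langle>$\<rangle> x = x \<or> b \<langle>$\<rangle> x = x"
  shows "\<exists>U W. V = U \<union> W \<and> U \<inter> W = {} \<and> card U = 3 \<and> card W = 3
    \<and> (\<forall>x y. adj x y \<longleftrightarrow> (x \<in> U \<and> y \<in> W) \<or> (x \<in> W \<and> y \<in> U))"
proof -
  have ab': "a \<langle>$\<rangle> (b \<langle>$\<rangle> z) = b \<langle>$\<rangle> (a \<langle>$\<rangle> z)" for z using ab by (metis apply_sequence)
  have moved: "\<exists>v\<in>V. g \<langle>$\<rangle> v \<noteq> v" if "g \<in> G" "g \<noteq> 1" for g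
    using fix_all[OF that(1), of V] V_ne adj_V2 that(2) by blast
  have rot: "\<forall>y. adj x y \<longrightarrow> b \<langle>$\<rangle> y \<noteq> y" if "b \<langle>$\<rangle> x = x" for x
    using odd_fix_arc[OF b(1,3)] b(2) that by auto
  obtain v where v: "v \<in> V" "a \<langle>$\<rangle> v \<noteq> v" using moved[OF a] by blast
  have bv: "b \<langle>$\<rangle> v = v" using cover v by blast
  obtain u where u: "adj v u" using nbrs[OF v(1)] by metis
  have bu: "b \<langle>$\<rangle> u \<noteq> u" using rot[OF bv] u by blast
  have au: "a \<langle>$\<rangle> u = u" using cover[OF adj_V2[OF u]] bu by blast
  define u1 u2 v' where "u1 = b \<langle>$\<rangle> u" and "u2 = b \<langle>$\<rangle> u1" and "v' = a \<langle>$\<rangle> v"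
  note orb = rotates_orbit[OF b(1) bv rot[OF bv] u, folded u1_def, folded u2_def]
  have bu2: "b \<langle>$\<rangle> u2 = u" using orb(2) .
  have b_adj: "adj x y \<Longrightarrow> adj (b \<langle>$\<rangle> x) (b \<langle>$\<rangle> y)" for x y using G_adj[OF b(1)] by blast
  have a_adj: "adj x y \<Longrightarrow> adj (a \<langle>$\<rangle> x) (a \<langle>$\<rangle> y)" for x y using G_adj[OF a(1)] by blast
  have vu: "adj v u1" "adj v u2" using b_adj[OF u] b_adj[of v u1] bv by (simp_all add: u1_def u2_def)
  have ne_u: "u1 \<noteq> u" "u2 \<noteq> u1" "u2 \<noteq> u"
    using bu bu2 apply_inj[of b] by (auto simp: u1_def u2_def)
  have N_v: "adj v z \<longleftrightarrow> z \<in> {u, u1, u2}" for z using orb(1) u vu by auto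
  have au12: "a \<langle>$\<rangle> u1 = u1" "a \<langle>$\<rangle> u2 = u2" by (simp_all add: u1_def u2_def ab' au)
  have v'_ne: "v' \<noteq> v" using v(2) by (simp add: v'_def)
  have bv': "b \<langle>$\<rangle> v' = v'" using ab'[of v] bv by (simp add: v'_def)
  have vu': "adj v' u" "adj v' u1" "adj v' u2"
    using a_adj[OF u] a_adj[OF vu(1)] a_adj[OF vu(2)] au au12 by (simp_all add: v'_def)
  have uv: "adj u v" "adj u v'" using u vu'(1) adj_sym by blast+
  obtain w where w: "v \<noteq> w" "v' \<noteq> w" "\<And>z. adj u z \<longleftrightarrow> z = v \<or> z = v' \<or> z = w"
    by (rule third_nbr[OF uv v'_ne[symmetric]]) blast
  have square: "\<exists>z. z \<noteq> v \<and> adj z p \<and> adj z q" if "adj v p" "adj v q" for p q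
    using that vu' v'_ne unfolding N_v by auto
  have "\<exists>z. z \<noteq> u \<and> adj z w \<and> adj z v"
    by (rule rectangle_at[OF v(1) adj_V[OF uv(1)]]) (use square uv w in auto)
  then obtain z where z: "z \<noteq> u" "adj z w" "adj z v" by blast
  have N_u1: "adj u1 y \<longleftrightarrow> y = v \<or> y = v' \<or> y = b \<langle>$\<rangle> w" for y
  proof -
    have "adj u1 y \<longleftrightarrow> adj u (inverse b \<langle>$\<rangle> y)"
      using G_adj[OF b(1), of u "inverse b \<langle>$\<rangle> y"] by (simp add: u1_def)
    then show ?thesis unfolding w(3) apply_inverse_iff by (auto simp: bv bv')
  qed
  have N_u2: "adj u2 y \<longleftrightarrow> y = v \<or> y = v' \<or> y = b \<langle>$\<rangle> (b \<langle>$\<rangle> w)" for y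
  proof -
    have "adj u2 y \<longleftrightarrow> adj u1 (inverse b \<langle>$\<rangle> y)"
      using G_adj[OF b(1), of u1 "inverse b \<langle>$\<rangle> y"] by (simp add: u2_def)
    then show ?thesis unfolding N_u1 apply_inverse_iff by (auto simp: bv bv')
  qed
  have b3: "b \<langle>$\<rangle> (b \<langle>$\<rangle> (b \<langle>$\<rangle> y)) = y" for y
    using arg_cong[OF b(3), of "\<lambda>g. g \<langle>$\<rangle> y"] by (simp add: numeral_3_eq_3 apply_times)
  \<comment> \<open>\<open>z\<close> is one of the other two neighbours of \<open>v\<close>, so
    \<open>w\<close> equals \<open>b w\<close> or \<open>b (b w)\<close>; as \<open>b\<close> has
    order 3, either means that it is fixed.\<close>
  have bw: "b \<langle>$\<rangle> w = w"
  proof -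
    have "z = u1 \<or> z = u2" using adj_sym[OF z(3)] z(1) unfolding N_v by auto
    then consider "b \<langle>$\<rangle> w = w" | "b \<langle>$\<rangle> (b \<langle>$\<rangle> w) = w"
      using z(2) N_u1[of w] N_u2[of w] w(1,2) by metis
    then show ?thesis using b3[of w] by cases auto
  qed
  define U W where "U = {u, u1, u2}" and "W = {v, v', w}"
  have N_U: "adj x y \<longleftrightarrow> y \<in> W" if "x \<in> U" for x y
    using that w(3)[of y] N_u1[of y] N_u2[of y] by (auto simp: U_def W_def bw)
  have card: "card U = 3" "card W = 3"
    using ne_u w(1,2) v'_ne by (auto simp: U_def W_def)
  have N_W: "adj x y \<longleftrightarrow> y \<in> U" if "x \<in> W" for x y
  proof -
    have sub: "U \<subseteq> {y. adj x y}" using N_U adj_sym that by blast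
    have "x \<in> V" using sub adj_V by (auto simp: U_def)
    then have "card {y. adj x y} = 3" by (rule card_nbrs)
    then have "U = {y. adj x y}" using card(1) sub by (intro card_subset_eq) (auto intro: card_ge_0_finite)
    then show ?thesis by blast
  qed
  have "U \<union> W = V"
  proof (rule connected)
    have "v \<in> W" "u \<in> U" by (simp_all add: U_def W_def)
    then show "U \<union> W \<subseteq> V" using N_U N_W adj_V by blast
    show "U \<union> W \<noteq> {}" by (simp add: U_def)
    show "y \<in> U \<union> W" if "x \<in> U \<union> W" "adj x y" for x y using N_U N_W that by blast
  qed
  moreover have "U \<inter> W = {}" using N_U adj_irrefl by blast
  moreover have "adj x y \<longleftrightarrow> (x \<in> U \<and> y \<in> W) \<or> (x \<in> W \<and> y \<in> U)" for x y
    using N_U N_W adj_V \<open>U \<union> W = V\<close> by blast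
  ultimately show ?thesis using card by blast
qed

lemma regular_point:
  assumes p: "p \<in> G" and N: "0 < N" "\<And>m. p ^ m = 1 \<longleftrightarrow> N dvd m"
    and not_K33: "\<not> (\<exists>U W. V = U \<union> W \<and> U \<inter> W = {} \<and> card U = 3 \<and> card W = 3
      \<and> (\<forall>x y. adj x y \<longleftrightarrow> (x \<in> U \<and> y \<in> W) \<or> (x \<in> W \<and> y \<in> U)))"
  shows "\<exists>x\<in>V. Perm.order p x = N"
proof (rule ccontr)
  assume neg: "\<not> ?thesis"
  \<comment> \<open>These have order 2 and 3 only if 2 or 3 divides \<open>N\<close>; otherwise
    \<open>div\<close> rounds, which is why the next fact carries the divisibilities. Without a
    regular orbit every quotient \<open>k\<close> exceeds 1 and is thus divisible by 2 or 3.\<close>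
  define a b where "a = p ^ (N div 2)" and "b = p ^ (N div 3)"
  have fixed: "2 dvd N \<and> a \<langle>$\<rangle> x = x \<or> 3 dvd N \<and> b \<langle>$\<rangle> x = x" if x: "x \<in> V" for x
  proof -
    obtain k where k: "k \<in> {1, 2, 3, 4, 6}" "N = Perm.order p x * k"
      using orbit_ratio[OF p N x] by blast
    have "k \<noteq> 1" using neg k(2) x by auto
    then have "2 dvd k \<or> 3 dvd k" using k(1) by auto
    then show ?thesis
    proof
      assume "2 dvd k"
      then obtain l where "k = 2 * l" by (rule dvdE)
      then have "N = 2 * (Perm.order p x * l)" using k(2) by simp
      then have "2 dvd N" "Perm.order p x dvd N div 2" by (simp_all del: One_nat_def)
      then show ?thesis by (simp add: a_def apply_power_eq_self_iff)
    next
      assume "3 dvd k"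
      then obtain l where "k = 3 * l" by (rule dvdE)
      then have "N = 3 * (Perm.order p x * l)" using k(2) by simp
      then have "3 dvd N" "Perm.order p x dvd N div 3" by simp_all
      then show ?thesis by (simp add: b_def apply_power_eq_self_iff)
    qed
  qed
  have a: "a \<in> G" "b \<in> G" using power_closed p by (simp_all add: a_def b_def)
  have a1: "a \<noteq> 1" if "2 dvd N"
    using that N by (auto simp: a_def N(2) dest!: dvd_imp_le)
  have b1: "b \<noteq> 1" if "3 dvd N"
    using that N by (auto simp: b_def N(2) dest!: dvd_imp_le)
  have all_fixed: "g = 1" if "g \<in> G" "\<And>x. x \<in> V \<Longrightarrow> g \<langle>$\<rangle> x = x" for g
    using fix_all[OF that(1), of V] V_ne adj_V2 that(2) by blast
  obtain x where x: "x \<in> V" using V_ne by blast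
  consider "2 dvd N" "3 dvd N" | "2 dvd N" "\<not> 3 dvd N" | "\<not> 2 dvd N" "3 dvd N"
    using fixed[OF x] by blast
  then show False
  proof cases
    case 1
    have "b ^ 3 = p ^ N" using \<open>3 dvd N\<close> by (simp add: b_def flip: power_mult)
    then have "b ^ 3 = 1" using N(2) by simp
    moreover have "a * b = b * a" by (simp add: a_def b_def add.commute flip: power_add)
    ultimately show False
      using K33_if_cover[OF a(1) a1 a(2) b1] 1 fixed not_K33 by blast
  next
    case 2
    then have "a = 1" using all_fixed[OF a(1)] fixed by blast
    then show False using a1 2 by blast
  next
    case 3
    then have "b = 1" using all_fixed[OF a(2)] fixed by blast
    then show False using b1 3 by blast
  qed
qed

end

section \<open>Automorphism groups as groups of permutations\<close>

context
  fixes \<Gamma> :: "'a pair_pre_digraph"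
  assumes cubic: "cubic_graph \<Gamma>" and vt: "vertex_transitive \<Gamma>"
begin

interpretation pair_graph \<Gamma> using cubic by (simp add: cubic_graph_def)

definition edge :: "'a \<Rightarrow> 'a \<Rightarrow> bool" where "edge x y \<longleftrightarrow> (x, y) \<in> parcs \<Gamma>"

text \<open>Automorphisms extended by the identity to the whole type, so that powers, inverses and
  orbits of \<open>Perm.perm\<close> apply. The equivalence can range over all points because arcs
  join vertices only.\<close>

definition perms :: "'a Perm.perm set" where
  "perms = {p. (\<forall>x. x \<notin> pverts \<Gamma> \<longrightarrow> p \<langle>$\<rangle> x = x) \<and> (\<forall>x y. edge (p \<langle>$\<rangle> x) (p \<langle>$\<rangle> y) \<longleftrightarrow> edge x y)}"

lemma perms_V: "p \<in> perms \<Longrightarrow> p \<langle>$\<rangle> x \<in> pverts \<Gamma> \<longleftrightarrow> x \<in> pverts \<Gamma>"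
  unfolding perms_def by (metis (mono_tags, lifting) apply_inj mem_Collect_eq)

lemma aut_extends:
  assumes "g \<in> graph_aut \<Gamma>"
  obtains p where "p \<in> perms" "\<And>x. x \<in> pverts \<Gamma> \<Longrightarrow> p \<langle>$\<rangle> x = g x"
proof -
  define f where "f x = (if x \<in> pverts \<Gamma> then g x else x)" for x
  have g: "bij_betw g (pverts \<Gamma>) (pverts \<Gamma>)"
    and adj: "\<And>u v. \<lbrakk>u \<in> pverts \<Gamma>; v \<in> pverts \<Gamma>\<rbrakk> \<Longrightarrow> (g u, g v) \<in> parcs \<Gamma> \<longleftrightarrow> (u, v) \<in> parcs \<Gamma>"
    using assms by (auto simp: graph_aut_def Bij_def)
  have "bij_betw f (pverts \<Gamma>) (pverts \<Gamma>)"
    using g by (simp add: f_def bij_betw_def inj_on_def image_def)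
  moreover have "bij_betw f (- pverts \<Gamma>) (- pverts \<Gamma>)"
    by (auto simp: f_def bij_betw_def inj_on_def image_def)
  ultimately have "bij_betw f (pverts \<Gamma> \<union> - pverts \<Gamma>) (pverts \<Gamma> \<union> - pverts \<Gamma>)"
    by (rule bij_betw_combine) simp
  then have "bij f" by simp
  moreover have "finite {x. f x \<noteq> x}"
    by (rule finite_subset[OF _ pair_finite_verts]) (auto simp: f_def)
  ultimately have p: "apply (Perm f) = f" by (simp add: Perm_inverse)
  have mem: "u \<in> pverts \<Gamma>" "v \<in> pverts \<Gamma>" if "(u, v) \<in> parcs \<Gamma>" for u v
    using that arc_fst_in_verts arc_snd_in_verts by fastforce+
  have fV: "f x \<in> pverts \<Gamma> \<longleftrightarrow> x \<in> pverts \<Gamma>" for x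
    using g by (auto simp: f_def bij_betw_def)
  have "(f x, f y) \<in> parcs \<Gamma> \<longleftrightarrow> (x, y) \<in> parcs \<Gamma>" for x y
  proof (cases "x \<in> pverts \<Gamma> \<and> y \<in> pverts \<Gamma>")
    case True
    then show ?thesis using adj by (simp add: f_def)
  next
    case False
    then show ?thesis using mem[of x y] mem[of "f x" "f y"] fV by blast
  qed
  then have "Perm f \<in> perms" by (simp add: perms_def p edge_def) (simp add: f_def)
  then show ?thesis using that[of "Perm f"] by (simp add: p) (simp add: f_def)
qed

lemma finite_perms: "finite perms"
proof (rule inj_on_finite)
  show "inj_on (\<lambda>p. restrict (apply p) (pverts \<Gamma>)) perms"
  proof (rule inj_onI, rule perm_eqI)
    fix p q :: "'a Perm.perm" and x
    assume *: "p \<in> perms" "q \<in> perms" "restrict (apply p) (pverts \<Gamma>) = restrict (apply q) (pverts \<Gamma>)"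
    show "p \<langle>$\<rangle> x = q \<langle>$\<rangle> x"
      using fun_cong[OF *(3), of x] *(1,2) by (cases "x \<in> pverts \<Gamma>") (simp_all add: perms_def)
  qed
  show "(\<lambda>p. restrict (apply p) (pverts \<Gamma>)) ` perms \<subseteq> pverts \<Gamma> \<rightarrow>\<^sub>E pverts \<Gamma>"
    using perms_V by (auto simp: PiE_def)
  show "finite (pverts \<Gamma> \<rightarrow>\<^sub>E pverts \<Gamma>)"
    by (intro finite_PiE pair_finite_verts)
qed

lemma finite_aut: "finite (graph_aut \<Gamma>)"
proof (rule finite_subset)
  show "graph_aut \<Gamma> \<subseteq> pverts \<Gamma> \<rightarrow>\<^sub>E pverts \<Gamma>"
    by (auto simp: graph_aut_def Bij_def PiE_def dest: bij_betwE)
  show "finite (pverts \<Gamma> \<rightarrow>\<^sub>E pverts \<Gamma>)"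
    by (intro finite_PiE pair_finite_verts)
qed

lemma cubic_vertex_transitive_perms: "cubic_vertex_transitive perms (pverts \<Gamma>) edge"
proof
  show "1 \<in> perms" by (simp add: perms_def)
  show "p * q \<in> perms" if "p \<in> perms" "q \<in> perms" for p q
    using that by (auto simp: perms_def apply_times)
  show "inverse p \<in> perms" if "p \<in> perms" for p
  proof -
    have "edge (inverse p \<langle>$\<rangle> x) (inverse p \<langle>$\<rangle> y) \<longleftrightarrow> edge x y" for x y
      using that apply_inverse_cancel(2)[of p] unfolding perms_def by (metis (mono_tags, lifting) mem_Collect_eq)
    moreover have "inverse p \<langle>$\<rangle> x = x" if "x \<notin> pverts \<Gamma>" for x
      using that \<open>p \<in> perms\<close> by (simp add: apply_inverse_iff perms_def)
    ultimately show ?thesis by (simp add: perms_def)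
  qed
  show "finite perms" by (rule finite_perms)
  show "finite (pverts \<Gamma>)" by (rule pair_finite_verts)
  have con: "strongly_connected (mk_symmetric \<Gamma>)"
    using cubic by (simp add: cubic_graph_def connected_def)
  then show "pverts \<Gamma> \<noteq> {}" by (auto simp: strongly_connected_def)
  show "edge y x" if "edge x y" for x y
    using that arcs_symmetric by (simp add: edge_def)
  show "\<not> edge x x" for x
    using pair_no_loops[of "(x, x)"] by (auto simp: edge_def)
  show "x \<in> pverts \<Gamma>" if "edge x y" for x y
    using that arc_fst_in_verts[of "(x, y)"] by (simp add: edge_def)
  show "card {y. edge x y} = 3" if "x \<in> pverts \<Gamma>" for x
  proof -
    have "out_arcs (with_proj \<Gamma>) x = Pair x ` {y. edge x y}"
      by (auto simp: out_arcs_def edge_def)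
    moreover have "card (out_arcs (with_proj \<Gamma>) x) = 3"
      using cubic that by (simp add: cubic_graph_def out_degree_def)
    ultimately show ?thesis by (simp add: card_image inj_on_def)
  qed
  show "X = pverts \<Gamma>" if X: "X \<subseteq> pverts \<Gamma>" "X \<noteq> {}" "\<And>x y. \<lbrakk>x \<in> X; edge x y\<rbrakk> \<Longrightarrow> y \<in> X" for X
  proof -
    obtain x where x: "x \<in> X" using X(2) by blast
    have "y \<in> X" if "y \<in> pverts \<Gamma>" for y
    proof -
      have "x \<rightarrow>\<^sup>*\<^bsub>mk_symmetric \<Gamma>\<^esub> y"
        using con x X(1) that by (auto simp: strongly_connected_def)
      then have "x \<rightarrow>\<^sup>*\<^bsub>\<Gamma>\<^esub> y" using reachable_mk_symmetric_eq[OF pair_sym_arcs] by simp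
      then show ?thesis
      proof (induct rule: reachable_induct)
        case (step y z)
        then show ?case using X(3) by (simp add: edge_def)
      qed (rule x)
    qed
    then show ?thesis using X(1) by blast
  qed
  show "edge (p \<langle>$\<rangle> x) (p \<langle>$\<rangle> y) \<longleftrightarrow> edge x y" if "p \<in> perms" for p x y
    using that by (simp add: perms_def)
  show "p \<langle>$\<rangle> x = x" if "p \<in> perms" "x \<notin> pverts \<Gamma>" for p x
    using that by (simp add: perms_def)
  show "\<exists>p\<in>perms. p \<langle>$\<rangle> x = y" if "x \<in> pverts \<Gamma>" "y \<in> pverts \<Gamma>" for x y
  proof -
    interpret transitive_action "Aut_group \<Gamma>" "pverts \<Gamma>" "\<lambda>g. g"
      using vt by (simp add: vertex_transitive_def)
    obtain g where "g \<in> graph_aut \<Gamma>" "g x = y" using unique_orbit[OF \<open>x \<in> pverts \<Gamma>\<close> \<open>y \<in> pverts \<Gamma>\<close>] by auto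
    moreover obtain p where "p \<in> perms" "\<And>x. x \<in> pverts \<Gamma> \<Longrightarrow> p \<langle>$\<rangle> x = g x"
      using aut_extends[OF \<open>g \<in> graph_aut \<Gamma>\<close>] by blast
    ultimately show ?thesis using \<open>x \<in> pverts \<Gamma>\<close> by auto
  qed
qed

lemma aut_mult:
  "\<lbrakk>f \<in> Bij (pverts \<Gamma>); g \<in> Bij (pverts \<Gamma>)\<rbrakk> \<Longrightarrow> f \<otimes>\<^bsub>Aut_group \<Gamma>\<^esub> g = compose (pverts \<Gamma>) f g"
  by (simp add: Aut_group_def BijGroup_def)

lemma aut_power_apply:
  assumes "p \<in> perms" "g \<in> graph_aut \<Gamma>" "\<And>x. x \<in> pverts \<Gamma> \<Longrightarrow> p \<langle>$\<rangle> x = g x" "x \<in> pverts \<Gamma>"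
  shows "(g [^]\<^bsub>Aut_group \<Gamma>\<^esub> m) x = (p ^ m) \<langle>$\<rangle> x"
  using assms(4)
proof (induction m arbitrary: x)
  case 0
  then show ?case by (simp add: Aut_group_def BijGroup_def)
next
  case (Suc m)
  interpret A: group "Aut_group \<Gamma>" by (rule group_Aut_group)
  have "g [^]\<^bsub>Aut_group \<Gamma>\<^esub> m \<in> carrier (Aut_group \<Gamma>)" by (rule A.nat_pow_closed) (simp add: assms(2))
  then have Bij: "g [^]\<^bsub>Aut_group \<Gamma>\<^esub> m \<in> Bij (pverts \<Gamma>)" "g \<in> Bij (pverts \<Gamma>)"
    using assms(2) unfolding carrier_Aut_group graph_aut_def by blast+
  have "g [^]\<^bsub>Aut_group \<Gamma>\<^esub> Suc m = compose (pverts \<Gamma>) (g [^]\<^bsub>Aut_group \<Gamma>\<^esub> m) g"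
    unfolding A.nat_pow_Suc using Bij by (rule aut_mult)
  then have "(g [^]\<^bsub>Aut_group \<Gamma>\<^esub> Suc m) x = (g [^]\<^bsub>Aut_group \<Gamma>\<^esub> m) (g x)"
    using Suc.prems by (simp add: compose_eq)
  also have "\<dots> = (p ^ m) \<langle>$\<rangle> (g x)"
    using Suc.IH[of "g x"] Suc.prems perms_V[OF assms(1), of x] assms(3)[of x] by simp
  also have "\<dots> = (p ^ m) \<langle>$\<rangle> (p \<langle>$\<rangle> x)"
    using assms(3)[OF Suc.prems] by simp
  finally show ?case by (simp add: power_Suc2 apply_times del: power_Suc)
qed

lemma aut_power_eq_one_iff:
  assumes "p \<in> perms" "g \<in> graph_aut \<Gamma>" "\<And>x. x \<in> pverts \<Gamma> \<Longrightarrow> p \<langle>$\<rangle> x = g x"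
  shows "p ^ m = 1 \<longleftrightarrow> group.ord (Aut_group \<Gamma>) g dvd m"
proof -
  interpret A: group "Aut_group \<Gamma>" by (rule group_Aut_group)
  interpret cubic_vertex_transitive perms "pverts \<Gamma>" edge by (rule cubic_vertex_transitive_perms)
  have "p ^ m = 1 \<longleftrightarrow> (\<forall>x \<in> pverts \<Gamma>. (p ^ m) \<langle>$\<rangle> x = x)"
    using G_outside[OF power_closed[OF assms(1)]] by (auto simp: perm_eq_iff)
  also have "\<dots> \<longleftrightarrow> (\<forall>x \<in> pverts \<Gamma>. (g [^]\<^bsub>Aut_group \<Gamma>\<^esub> m) x = x)"
    using aut_power_apply[OF assms] by simp
  also have "\<dots> \<longleftrightarrow> g [^]\<^bsub>Aut_group \<Gamma>\<^esub> m = \<one>\<^bsub>Aut_group \<Gamma>\<^esub>"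
  proof -
    have "g [^]\<^bsub>Aut_group \<Gamma>\<^esub> m \<in> carrier (Aut_group \<Gamma>)" by (rule A.nat_pow_closed) (simp add: assms(2))
    then have "g [^]\<^bsub>Aut_group \<Gamma>\<^esub> m \<in> extensional (pverts \<Gamma>)"
      by (simp add: graph_aut_def Bij_def)
    moreover have "\<one>\<^bsub>Aut_group \<Gamma>\<^esub> = (\<lambda>x\<in>pverts \<Gamma>. x)" by (simp add: Aut_group_def BijGroup_def)
    ultimately show ?thesis by (auto intro: extensionalityI)
  qed
  also have "\<dots> \<longleftrightarrow> group.ord (Aut_group \<Gamma>) g dvd m"
    by (rule A.pow_eq_id) (simp add: assms(2))
  finally show ?thesis .
qed

lemma cyclic_orbits_eq:
  assumes "p \<in> perms" "g \<in> graph_aut \<Gamma>" "\<And>x. x \<in> pverts \<Gamma> \<Longrightarrow> p \<langle>$\<rangle> x = g x"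
  shows "cyclic_orbits \<Gamma> g = Perm.orbit p ` pverts \<Gamma>"
proof -
  interpret A: group "Aut_group \<Gamma>" by (rule group_Aut_group)
  \<comment> \<open>Positive order lets natural powers exhaust the generated subgroup, matching the
    orbits of \<open>Perm\<close>.\<close>
  have "A.ord g \<noteq> 0" using A.ord_ge_1[of g] finite_aut assms(2) by simp
  then have "generate (Aut_group \<Gamma>) {g} = range (\<lambda>k::nat. g [^]\<^bsub>Aut_group \<Gamma>\<^esub> k)"
    using A.generate_pow_nat[of g] assms(2) by auto
  then have "carrier (subgroup_generated (Aut_group \<Gamma>) {g}) = range (\<lambda>k::nat. g [^]\<^bsub>Aut_group \<Gamma>\<^esub> k)"
    using assms(2) by (simp add: carrier_subgroup_generated)
  then have carrier: "{h x | h. h \<in> carrier (subgroup_generated (Aut_group \<Gamma>) {g})}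
      = range (\<lambda>k::nat. (g [^]\<^bsub>Aut_group \<Gamma>\<^esub> k) x)" for x
    by auto
  have "Group_Action.orbit (subgroup_generated (Aut_group \<Gamma>) {g}) (\<lambda>h. h) x = Perm.orbit p x"
    if "x \<in> pverts \<Gamma>" for x
    unfolding Group_Action.orbit_def carrier using aut_power_apply[OF assms that] by (simp add: Perm.orbit_def)
  then show ?thesis by (auto simp: cyclic_orbits_def orbits_def)
qed

lemma regular_and_orbit_sizes:
  assumes "\<not> complete_bipartite_digraph 3 3 (with_proj \<Gamma>)" and g: "g \<in> graph_aut \<Gamma>"
  shows "\<exists>C. regular_orbit \<Gamma> g C"
    and "\<And>C. C \<in> cyclic_orbits \<Gamma> g \<Longrightarrow> \<exists>k \<in> {1, 2, 3, 4, 6 :: nat}.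
      real (card C) = real (longest_orbit_length \<Gamma> g) / real k"
proof -
  interpret A: group "Aut_group \<Gamma>" by (rule group_Aut_group)
  interpret cubic_vertex_transitive perms "pverts \<Gamma>" edge by (rule cubic_vertex_transitive_perms)
  define N where "N = A.ord g"
  obtain p where p: "p \<in> perms" and pg: "\<And>x. x \<in> pverts \<Gamma> \<Longrightarrow> p \<langle>$\<rangle> x = g x"
    using aut_extends[OF g] by blast
  have N: "0 < N" "p ^ m = 1 \<longleftrightarrow> N dvd m" for m
    using A.ord_ge_1[of g] finite_aut g aut_power_eq_one_iff[OF p g pg] by (simp_all add: N_def)
  have orbits: "cyclic_orbits \<Gamma> g = Perm.orbit p ` pverts \<Gamma>"
    using cyclic_orbits_eq[OF p g pg] .
  have not_K33: "\<not> (\<exists>U W. pverts \<Gamma> = U \<union> W \<and> U \<inter> W = {} \<and> card U = 3 \<and> card W = 3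
      \<and> (\<forall>x y. edge x y \<longleftrightarrow> (x \<in> U \<and> y \<in> W) \<or> (x \<in> W \<and> y \<in> U)))"
  proof
    assume "\<exists>U W. pverts \<Gamma> = U \<union> W \<and> U \<inter> W = {} \<and> card U = 3 \<and> card W = 3
      \<and> (\<forall>x y. edge x y \<longleftrightarrow> (x \<in> U \<and> y \<in> W) \<or> (x \<in> W \<and> y \<in> U))"
    then obtain U W where UW: "pverts \<Gamma> = U \<union> W" "U \<inter> W = {}" "card U = 3" "card W = 3"
      and adj: "\<And>x y. edge x y \<longleftrightarrow> (x \<in> U \<and> y \<in> W) \<or> (x \<in> W \<and> y \<in> U)"
      by blast
    have "parcs \<Gamma> = U \<times> W \<union> W \<times> U" using adj unfolding edge_def by auto
    then have "complete_bipartite_digraph 3 3 (with_proj \<Gamma>)"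
      unfolding complete_bipartite_digraph_pair_def using UW pair_finite_verts by blast
    then show False using assms(1) by blast
  qed
  obtain x where x: "x \<in> pverts \<Gamma>" "Perm.order p x = N"
    using regular_point[OF p N not_K33] by blast
  have card: "card (Perm.orbit p z) = Perm.order p z" for z by simp
  show "\<exists>C. regular_orbit \<Gamma> g C"
    unfolding regular_orbit_def orbits using x by (intro exI[of _ "Perm.orbit p x"]) (simp add: N_def)
  \<comment> \<open>All orbit lengths divide \<open>N\<close>, and the regular orbit attains
    it.\<close>
  have "longest_orbit_length \<Gamma> g = N"
    unfolding longest_orbit_length_def orbits
  proof (rule Max_eqI)
    show "finite (card ` Perm.orbit p ` pverts \<Gamma>)" using pair_finite_verts by blast
    show "N \<in> card ` Perm.orbit p ` pverts \<Gamma>" using x card by force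
    show "d \<le> N" if "d \<in> card ` Perm.orbit p ` pverts \<Gamma>" for d
      using that power_period[OF N(2)] N(1) by (auto intro: dvd_imp_le)
  qed
  then show "\<exists>k \<in> {1, 2, 3, 4, 6 :: nat}. real (card C) = real (longest_orbit_length \<Gamma> g) / real k"
    if C: "C \<in> cyclic_orbits \<Gamma> g" for C
  proof -
    obtain z where z: "z \<in> pverts \<Gamma>" "C = Perm.orbit p z" using C orbits by blast
    obtain k where k: "k \<in> {1, 2, 3, 4, 6}" "N = Perm.order p z * k"
      using orbit_ratio[OF p N z(1)] by blast
    have "0 < k" using k(1) by auto
    then have "real (card C) = real N / real k"
      unfolding z(2) card k(2) by simp
    then show ?thesis using k(1) \<open>longest_orbit_length \<Gamma> g = N\<close> by blast
  qed
qed

end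

theorem theorem4p7:
  fixes \<Gamma> :: "'a pair_pre_digraph"
  assumes "cubic_graph \<Gamma>"
    and "vertex_transitive \<Gamma>"
    and "\<not> complete_bipartite_digraph 3 3 (with_proj \<Gamma>)"
  shows "\<forall>g \<in> carrier (Aut_group \<Gamma>).
    (\<exists>C. regular_orbit \<Gamma> g C) \<and>
    (\<forall>C \<in> cyclic_orbits \<Gamma> g. \<exists>k \<in> {1, 2, 3, 4, 6 :: nat}.
       real (card C) = real (longest_orbit_length \<Gamma> g) / real k)"
  using regular_and_orbit_sizes[OF assms] by simp

end
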